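(* Let $(\mathcal T,\mathcal E,(x_K)_{K\in\mathcal T})$ be an admissible mesh of $\Omega$, let $0=t_0<t_1<\dots<t_N=T$ be a time discretization, and let $c^0_{\mathcal T}=(c_K^0)_{K\in\mathcal T}$ be given by $c_K^0=\frac1{m_K}\int_K c^0\,dx$. Let $\mathcal F$ be any one of the four flux functions (centered, Sedan, activity based, Bessemoulin-Chatard). Then for all $1\le n\le N$ (the vector $c^{n-1}$ being $(c^0_K)_K$ if $n=1$ and a solution of the previous time step if $n\ge2$), the nonlinear system constituted by the scheme has a solution $(c^n,\Phi^n)\in[0,1]^{\mathcal T}\times\mathbb R^{\mathcal T}$. Moreover, the solution to the scheme satisfies, for all $1\le n\le N$, $$E_{\mathcal T}(c^n,\Phi^n)\le E_{\mathcal T}(c^{n-1},\Phi^{n-1})\quad\text{and}\quad 0<c_K^n<1\quad\text{for all }K\in\mathcal T.$$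
   Context: Data (fixed). $d\in\{1,2,3\}$; $\Omega\subset\mathbb R^d$ is a connected bounded open set with polyhedral Lipschitz continuous boundary; $\partial\Omega$ is split into $\Gamma_D$ (of positive $(d-1)$-dimensional measure) and $\Gamma_N=\partial\Omega\setminus\Gamma_D$; $T>0$; $c^{dp}\in L^\infty(\Omega)$; $c^0\in L^\infty(\Omega)$ with $0\le c^0\le 1$ and $0<\overline c<1$, where $\overline c=\frac1{m(\Omega)}\int_\Omega c^0\,dx$; $\Phi^D\in H^1(\Omega)\cap L^\infty(\Omega)$ is independent of time. Admissible mesh. A triplet $(\mathcal T,\mathcal E,(x_K)_{K\in\mathcal T})$ ($\mathcal T$, $\mathcal E$ finite) such that: (i) each cell $K\in\mathcal T$ is non-empty, open, polyhedral and convex, distinct cells are disjoint, and $\bigcup_K\overline K=\overline\Omega$; (ii) each face $\sigma\in\mathcal E$ is closed, contained in a hyperplane, with $(d-1)$-dimensional measure $m_\sigma>0$; distinct faces intersect in a set of zero $(d-1)$-measure; for each $K$ there is $\mathcal E_K\subset\mathcal E$ with $\partial K=\bigcup_{\sigma\in\mathcal E_K}\sigma$, and $\bigcup_K\mathcal E_K=\mathcal E$; for distinct $K,L$, $\overline K\cap\overline L$ is either a single face denoted $K|L$ or has zero $(d-1)$-measure; (iii) the centers $x_K\in K$ are pairwise distinct and $x_L-x_K$ is orthogonal to $K|L$ whenever $K,L$ share the face $K|L$; (iv) each boundary face satisfies $\sigma\subset\Gamma_D$ or $\sigma\subset\overline{\Gamma_N}$, and for $\sigma\in\mathcal E_K$,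 $\sigma\subset\partial\Omega$, there is $x_\sigma\in\sigma$ with $x_\sigma-x_K$ orthogonal to $\sigma$. $m_K$ is the Lebesgue measure of $K$; $\mathcal E_{\rm int}$ is the set of faces of the form $K|L$, $\mathcal E_{\rm ext}$ the set of faces contained in $\partial\Omega$, $\mathcal E^D=\{\sigma\subset\Gamma_D\}$, $\mathcal E^N=\{\sigma\subset\overline{\Gamma_N}\}$. $d_\sigma=|x_K-x_L|$ if $\sigma=K|L$, $d_\sigma=|x_K-x_\sigma|$ if $\sigma\in\mathcal E_{\rm ext}\cap\mathcal E_K$, and $\tau_\sigma=m_\sigma/d_\sigma$. Time steps: $\Delta t_n=t_n-t_{n-1}$. Scheme. $c_K^{dp}=\frac1{m_K}\int_Kc^{dp}dx$, $\Phi^D_\sigma=\frac1{m_\sigma}\int_\sigma\Phi^D$ for $\sigma\in\mathcal E^D$. Mirror values: $c_{K\sigma}^n=c_L^n$, $\Phi_{K\sigma}^n=\Phi_L^n$ if $\sigma=K|L$; $c_{K\sigma}^n=c_K^n$ if $\sigma\in\mathcal E_{\rm ext}$; $\Phi^n_{K\sigma}=\Phi_K^n$ if $\sigma\in\mathcal E^N$, $\Phi^n_{K\sigma}=\Phi^D_\sigma$ if $\sigma\in\mathcal E^D$. Jumps: $D_{K\sigma}u=u_{K\sigma}-u_K$, $D_\sigma u=|D_{K\sigma}u|$. The scheme is: for all $K\in\mathcal T$, $1\le n\le N$, $$-\sum_{\sigma\in\mathcal E_K}\tau_\sigma D_{K\sigma}\Phi^n=m_K(c_K^n+c_K^{dp}),\qquad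 m_K\frac{c_K^n-c_K^{n-1}}{\Delta t_n}+\sum_{\sigma\in\mathcal E_K}F_{K\sigma}^n=0,$$ with $F_{K\sigma}^n=0$ if $\sigma\in\mathcal E_{\rm ext}$ and $F_{K\sigma}^n=\tau_\sigma\mathcal F(c_K^n,c_L^n,\Phi_K^n,\Phi_L^n)$ if $\sigma=K|L$. The flux function $\mathcal F$ is defined on $(0,1)^2\times\mathbb R^2$, so being a solution includes that the fluxes are well defined. Flux functions. Let $h(c)=\log\frac{c}{1-c}$, $\nu(c)=r(c)=-\log(1-c)$, $a(c)=\frac c{1-c}$, $\beta(c)=1-c$, $B(u)=\frac u{e^u-1}$ with $B(0)=1$, and $dr(c_K,c_L)=\frac{h(c_K)-h(c_L)}{\log c_K-\log c_L}$ if $c_K\ne c_L$, $dr(c_K,c_K)=r'(c_K)=\frac1{1-c_K}$. Then $\mathcal F(c_K,c_L,\Phi_K,\Phi_L)$ is: - centered: $-\frac{c_K+c_L}2\big(h(c_L)+\Phi_L-h(c_K)-\Phi_K\big)$; - Sedan: $B(\Phi_L+\nu(c_L)-\Phi_K-\nu(c_K))\,c_K-B(\Phi_K+\nu(c_K)-\Phi_L-\nu(c_L))\,c_L$; - activity based: $\frac{\beta(c_K)+\beta(c_L)}2\big(B(\Phi_L-\Phi_K)a(c_K)-B(\Phi_K-\Phi_L)a(c_L)\big)$; - Bessemoulin-Chatard: $dr\,\big(B(\tfrac{\Phi_L-\Phi_K}{dr})c_K-B(\tfrac{\Phi_K-\Phi_L}{dr})c_L\big)$ with $dr=dr(c_K,c_L)$.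 Energy. $H(c)=c\log c+(1-c)\log(1-c)$ (with $H(0)=H(1)=0$) and $$E_{\mathcal T}(c^n,\Phi^n)=\sum_{K}m_KH(c_K^n)+\frac12\sum_{\sigma\in\mathcal E}\tau_\sigma(D_\sigma\Phi^n)^2-\sum_{K}\sum_{\sigma\in\mathcal E^D\cap\mathcal E_K}\tau_\sigma\Phi^D_\sigma D_{K\sigma}\Phi^n.$$ For $n=0$, $\Phi^0$ denotes the solution of the discrete Poisson equation $-\sum_{\sigma\in\mathcal E_K}\tau_\sigma D_{K\sigma}\Phi^0=m_K(c_K^0+c_K^{dp})$ with the same boundary mirror values.
   Formalization: Added: Γ_D minus the closure of Γ_N has positive (d−1)-measure (otherwise no face lies in Γ_D and the discrete Poisson equation can be unsolvable); every face is of the form K|L or contained in ∂Ω, so that mirror values and fluxes are defined. *)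

theory Defs
  imports "HOL-Analysis.Analysis"
begin

section \<open>Hausdorff measure\<close>

text \<open>Normalised so that the measure of dimension \<open>s\<close> agrees with Lebesgue measure on
  \<open>s\<close>-dimensional planes. Since \<open>0 ^ 0 = 1\<close> and only the empty set has cost \<open>0\<close> by fiat,
  dimension \<open>0\<close> gives the counting measure. Covering sets are required to be bounded because
  \<^term>\<open>diameter\<close> is unspecified on unbounded sets.\<close>

definition hausdorff_cost :: "nat \<Rightarrow> 'a::metric_space set \<Rightarrow> ennreal" where
  "hausdorff_cost s U =
     (if U = {} then 0 else ennreal (unit_ball_vol (real s) * (diameter U / 2) ^ s))"

definition hausdorff_covers :: "real \<Rightarrow> 'a::metric_space set \<Rightarrow> (nat \<Rightarrow> 'a set) set" where
  "hausdorff_covers \<delta> A =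
     {U. A \<subseteq> (\<Union>i. U i) \<and> (\<forall>i. bounded (U i) \<and> diameter (U i) \<le> \<delta>)}"

definition hausdorff_pre :: "nat \<Rightarrow> real \<Rightarrow> 'a::metric_space set \<Rightarrow> ennreal" where
  "hausdorff_pre s \<delta> A = (INF U\<in>hausdorff_covers \<delta> A. \<Sum>i. hausdorff_cost s (U i))"

definition hausdorff_outer :: "nat \<Rightarrow> 'a::metric_space set \<Rightarrow> ennreal" where
  "hausdorff_outer s A = (SUP \<delta>\<in>{0<..}. hausdorff_pre s \<delta> A)"

text \<open>The measure lives on the Caratheodory-measurable sets.\<close>

definition hausdorff_measure :: "nat \<Rightarrow> 'a::metric_space measure" where
  "hausdorff_measure s =
     measure_of UNIV (lambda_system UNIV (Pow UNIV) (hausdorff_outer s)) (hausdorff_outer s)"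

lemma hausdorff_pre_countable_subadditive:
  fixes A :: "nat \<Rightarrow> 'a::metric_space set"
  shows "hausdorff_pre s \<delta> (\<Union>i. A i) \<le> (\<Sum>i. hausdorff_pre s \<delta> (A i))"
proof (rule ennreal_le_epsilon)
  fix e :: real
  assume e: "0 < e" and fin: "(\<Sum>i. hausdorff_pre s \<delta> (A i)) < top"
  define b where "b i = ennreal (e * (1/2) ^ Suc i)" for i
  have b0: "0 < b i" for i
    using e by (simp add: b_def)
  have sb: "(\<Sum>i. b i) = ennreal e"
  proof -
    have "(\<lambda>i. e * (1/2) ^ Suc i) sums (e * 1)"
      using power_half_series by (rule sums_mult)
    then show ?thesis
      unfolding b_def using e by (intro suminf_ennreal_eq) auto
  qed
  have "\<exists>U\<in>hausdorff_covers \<delta> (A i).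
      (\<Sum>j. hausdorff_cost s (U j)) \<le> hausdorff_pre s \<delta> (A i) + b i" for i
  proof -
    have "hausdorff_pre s \<delta> (A i) < top"
      using fin ennreal_suminf_lessD by blast
    then have "hausdorff_pre s \<delta> (A i) < hausdorff_pre s \<delta> (A i) + b i"
      using b0[of i] by (metis ennreal_add_left_cancel_less add.right_neutral top.not_eq_extremum infinity_ennreal_def)
    then show ?thesis
      by (subst (asm) (1) hausdorff_pre_def) (auto simp: INF_less_iff intro: less_imp_le)
  qed
  then obtain U where U: "\<And>i. U i \<in> hausdorff_covers \<delta> (A i)"
    "\<And>i. (\<Sum>j. hausdorff_cost s (U i j)) \<le> hausdorff_pre s \<delta> (A i) + b i"
    by metis
  define V where "V n = case_prod U (prod_decode n)" for n
  have "V \<in> hausdorff_covers \<delta> (\<Union>i. A i)"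
  proof -
    have "x \<in> (\<Union>n. V n)" if "x \<in> A i" for x i
    proof -
      have "A i \<subseteq> (\<Union>j. U i j)"
        using U(1)[of i] by (simp add: hausdorff_covers_def)
      with that obtain j where "x \<in> U i j"
        by blast
      then have "x \<in> V (prod_encode (i, j))"
        by (simp add: V_def)
      then show ?thesis by blast
    qed
    moreover have "bounded (V n) \<and> diameter (V n) \<le> \<delta>" for n
      using U(1) by (auto simp: V_def hausdorff_covers_def split: prod.split)
    ultimately show ?thesis
      unfolding hausdorff_covers_def by blast
  qed
  then have "hausdorff_pre s \<delta> (\<Union>i. A i) \<le> (\<Sum>n. hausdorff_cost s (V n))"
    unfolding hausdorff_pre_def by (rule INF_lower)
  also have "\<dots> = (\<Sum>i. \<Sum>j. hausdorff_cost s (U i j))"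
    using suminf_ennreal_2dimen[of "\<lambda>i. \<Sum>j. hausdorff_cost s (U i j)"
        "\<lambda>(i, j). hausdorff_cost s (U i j)"]
    by (simp add: V_def comp_def case_prod_unfold)
  also have "\<dots> \<le> (\<Sum>i. hausdorff_pre s \<delta> (A i) + b i)"
    by (intro suminf_le U(2)) auto
  also have "\<dots> = (\<Sum>i. hausdorff_pre s \<delta> (A i)) + ennreal e"
    by (subst suminf_add[symmetric]) (auto simp: sb)
  finally show "hausdorff_pre s \<delta> (\<Union>i. A i) \<le> (\<Sum>i. hausdorff_pre s \<delta> (A i)) + ennreal e" .
qed

lemma hausdorff_outer_empty [simp]: "hausdorff_outer s {} = 0"
proof -
  have "hausdorff_pre s \<delta> ({} :: 'a set) = 0" if "\<delta> > 0" for \<delta>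
  proof -
    have "(\<lambda>_. {}) \<in> hausdorff_covers \<delta> ({} :: 'a set)"
      using that by (auto simp: hausdorff_covers_def)
    then have "hausdorff_pre s \<delta> ({} :: 'a set) \<le> (\<Sum>i::nat. hausdorff_cost s ({} :: 'a set))"
      unfolding hausdorff_pre_def by (rule INF_lower)
    then show ?thesis
      by (simp add: hausdorff_cost_def)
  qed
  then show ?thesis
    by (simp add: hausdorff_outer_def)
qed

lemma hausdorff_outer_mono: "A \<subseteq> B \<Longrightarrow> hausdorff_outer s A \<le> hausdorff_outer s B"
  unfolding hausdorff_outer_def hausdorff_pre_def
  by (intro SUP_mono' INF_superset_mono) (auto simp: hausdorff_covers_def)

lemma hausdorff_outer_countable_subadditive:
  "hausdorff_outer s (\<Union>i. A i) \<le> (\<Sum>i. hausdorff_outer s (A i))"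
  unfolding hausdorff_outer_def[of s "\<Union>i. A i"]
proof (rule SUP_least)
  fix \<delta> :: real
  assume "\<delta> \<in> {0<..}"
  then have "(\<Sum>i. hausdorff_pre s \<delta> (A i)) \<le> (\<Sum>i. hausdorff_outer s (A i))"
    unfolding hausdorff_outer_def by (intro suminf_le SUP_upper) auto
  with hausdorff_pre_countable_subadditive[of s \<delta> A]
  show "hausdorff_pre s \<delta> (\<Union>i. A i) \<le> (\<Sum>i. hausdorff_outer s (A i))"
    by (rule order_trans)
qed

lemma measure_space_hausdorff:
  "measure_space UNIV (lambda_system UNIV (Pow UNIV) (hausdorff_outer s)) (hausdorff_outer s)"
proof (rule sigma_algebra.caratheodory_lemma)
  show "sigma_algebra UNIV (Pow (UNIV :: 'a set))"
    by (rule sigma_algebra_Pow)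
  show "outer_measure_space (Pow UNIV) (hausdorff_outer s :: 'a set \<Rightarrow> ennreal)"
    unfolding outer_measure_space_def positive_def increasing_def countably_subadditive_def
    by (auto intro: hausdorff_outer_mono hausdorff_outer_countable_subadditive)
qed

lemma sets_hausdorff_measure:
  "sets (hausdorff_measure s :: 'a::metric_space measure) =
     lambda_system UNIV (Pow UNIV) (hausdorff_outer s)"
proof -
  have "sigma_algebra UNIV (lambda_system UNIV (Pow (UNIV :: 'a set)) (hausdorff_outer s))"
    using measure_space_hausdorff by (auto simp: measure_space_def)
  then show ?thesis
    unfolding hausdorff_measure_def by (rule sigma_algebra.sets_measure_of_eq)
qed

lemma emeasure_hausdorff_measure:
  fixes A :: "'a::metric_space set"
  assumes "A \<in> sets (hausdorff_measure s)"
  shows "emeasure (hausdorff_measure s) A = hausdorff_outer s A"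
proof -
  have "measure_space UNIV (lambda_system UNIV (Pow (UNIV :: 'a set)) (hausdorff_outer s))
      (hausdorff_outer s)"
    by (rule measure_space_hausdorff)
  then show ?thesis
    using assms unfolding sets_hausdorff_measure unfolding hausdorff_measure_def measure_space_def
    by (intro emeasure_measure_of_sigma) auto
qed

section \<open>The domain\<close>

definition polyhedral_boundary :: "'a::euclidean_space set \<Rightarrow> bool" where
  "polyhedral_boundary \<Omega> \<longleftrightarrow>
     (\<exists>P. finite P \<and> (\<forall>p\<in>P. polytope p) \<and> frontier \<Omega> = \<Union>P)"

text \<open>Near every boundary point, \<open>\<Omega>\<close> is the strict epigraph, in some direction \<open>e\<close>, of a
  Lipschitz function on the hyperplane orthogonal to \<open>e\<close>.\<close>

definition lipschitz_boundary :: "'a::euclidean_space set \<Rightarrow> bool" where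
  "lipschitz_boundary \<Omega> \<longleftrightarrow>
     (\<forall>x\<in>frontier \<Omega>. \<exists>r>0. \<exists>e L g. norm e = 1 \<and> L-lipschitz_on {z. z \<bullet> e = 0} (g :: 'a \<Rightarrow> real) \<and>
        \<Omega> \<inter> ball x r = {y \<in> ball x r. g (y - (y \<bullet> e) *\<^sub>R e) < y \<bullet> e})"

abbreviation surface_outer :: "'a::euclidean_space set \<Rightarrow> ennreal" where
  "surface_outer \<equiv> hausdorff_outer (DIM('a) - 1)"

text \<open>The part of \<open>\<Gamma>D\<close> away from the closure of \<open>\<Gamma>N\<close> is required to have positive surface
  measure. For splittings whose interface is a surface-null set this says just that \<open>\<Gamma>D\<close> has
  positive measure. It excludes splittings (\<open>\<Gamma>D\<close> a fat Cantor set, \<open>\<Gamma>N\<close> dense in the boundary)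
  for which no face of any mesh lies in \<open>\<Gamma>D\<close>, so that the discrete Poisson problem would be
  a pure Neumann problem.\<close>

definition boundary_splitting :: "'a::euclidean_space set \<Rightarrow> 'a set \<Rightarrow> 'a set \<Rightarrow> bool" where
  "boundary_splitting \<Omega> \<Gamma>D \<Gamma>N \<longleftrightarrow>
     \<Gamma>D \<subseteq> frontier \<Omega> \<and> \<Gamma>N = frontier \<Omega> - \<Gamma>D \<and>
     surface_outer \<Gamma>D > 0 \<and> surface_outer (\<Gamma>D - closure \<Gamma>N) > 0"

section \<open>Function spaces\<close>

definition ess_bounded :: "'a measure \<Rightarrow> ('a \<Rightarrow> real) \<Rightarrow> bool" where
  "ess_bounded M f \<longleftrightarrow> f \<in> borel_measurable M \<and> (\<exists>C. AE x in M. \<bar>f x\<bar> \<le> C)"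

definition square_integrable :: "'a measure \<Rightarrow> ('a \<Rightarrow> real) \<Rightarrow> bool" where
  "square_integrable M f \<longleftrightarrow> f \<in> borel_measurable M \<and> integrable M (\<lambda>x. (f x)\<^sup>2)"

definition L2_conv :: "'a measure \<Rightarrow> (nat \<Rightarrow> 'a \<Rightarrow> real) \<Rightarrow> ('a \<Rightarrow> real) \<Rightarrow> bool" where
  "L2_conv M f g \<longleftrightarrow> (\<lambda>k. \<integral>\<^sup>+ x. ennreal ((f k x - g x)\<^sup>2) \<partial>M) \<longlonglongrightarrow> 0"

abbreviation partial_deriv :: "'a::euclidean_space \<Rightarrow> ('a \<Rightarrow> real) \<Rightarrow> 'a \<Rightarrow> real" where
  "partial_deriv i f \<equiv> (\<lambda>x. frechet_derivative f (at x) i)"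

primrec Ck :: "nat \<Rightarrow> ('a::euclidean_space \<Rightarrow> real) \<Rightarrow> bool" where
  "Ck 0 f \<longleftrightarrow> continuous_on UNIV f"
| "Ck (Suc k) f \<longleftrightarrow> (\<forall>x. f differentiable (at x)) \<and> (\<forall>i\<in>Basis. Ck k (partial_deriv i f))"

definition smooth :: "('a::euclidean_space \<Rightarrow> real) \<Rightarrow> bool" where
  "smooth f \<longleftrightarrow> (\<forall>k. Ck k f)"

definition test_function :: "'a::euclidean_space set \<Rightarrow> ('a \<Rightarrow> real) \<Rightarrow> bool" where
  "test_function \<Omega> \<phi> \<longleftrightarrow> smooth \<phi> \<and> (\<exists>C. compact C \<and> C \<subseteq> \<Omega> \<and> (\<forall>x. x \<notin> C \<longrightarrow> \<phi> x = 0))"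

definition weak_gradient ::
    "'a::euclidean_space set \<Rightarrow> ('a \<Rightarrow> real) \<Rightarrow> ('a \<Rightarrow> 'a \<Rightarrow> real) \<Rightarrow> bool" where
  "weak_gradient \<Omega> u g \<longleftrightarrow>
     (\<forall>i\<in>Basis. square_integrable (lebesgue_on \<Omega>) (g i) \<and>
        (\<forall>\<phi>. test_function \<Omega> \<phi> \<longrightarrow>
           (LINT x|lebesgue_on \<Omega>. u x * partial_deriv i \<phi> x)
             = - (LINT x|lebesgue_on \<Omega>. g i x * \<phi> x)))"

definition sobolev_H1 :: "'a::euclidean_space set \<Rightarrow> ('a \<Rightarrow> real) \<Rightarrow> bool" where
  "sobolev_H1 \<Omega> u \<longleftrightarrow> square_integrable (lebesgue_on \<Omega>) u \<and> (\<exists>g. weak_gradient \<Omega> u g)"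

abbreviation surface_measure :: "'a::euclidean_space measure" where
  "surface_measure \<equiv> hausdorff_measure (DIM('a) - 1)"

text \<open>The trace is the continuous extension to \<open>H\<^sup>1(\<Omega>)\<close> of the restriction to the boundary of
  functions smooth up to the boundary.\<close>

definition is_trace :: "'a::euclidean_space set \<Rightarrow> ('a \<Rightarrow> real) \<Rightarrow> ('a \<Rightarrow> real) \<Rightarrow> bool" where
  "is_trace \<Omega> u \<gamma> \<longleftrightarrow>
     square_integrable (restrict_space surface_measure (frontier \<Omega>)) \<gamma> \<and>
     (\<exists>g \<phi>. weak_gradient \<Omega> u g \<and> (\<forall>k. smooth (\<phi> k)) \<and>
        L2_conv (lebesgue_on \<Omega>) \<phi> u \<and>
        (\<forall>i\<in>Basis. L2_conv (lebesgue_on \<Omega>) (\<lambda>k. partial_deriv i (\<phi> k)) (g i)) \<and>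
        L2_conv (restrict_space surface_measure (frontier \<Omega>)) \<phi> \<gamma>)"

text \<open>Determined only up to surface-null sets, which is all that face averages see.\<close>

definition trace_of :: "'a::euclidean_space set \<Rightarrow> ('a \<Rightarrow> real) \<Rightarrow> 'a \<Rightarrow> real" where
  "trace_of \<Omega> u = (SOME \<gamma>. is_trace \<Omega> u \<gamma>)"

section \<open>Admissible meshes\<close>

text \<open>Besides cells, faces and cell centers the record carries the data whose existence
  admissibility asserts: the faces of each cell, and the points \<open>x\<^sub>\<sigma>\<close> of the boundary faces.\<close>

record 'a fv_mesh =
  cells :: "'a set set"
  faces :: "'a set set"
  cfaces :: "'a set \<Rightarrow> 'a set set"
  ctr :: "'a set \<Rightarrow> 'a"
  fctr :: "'a set \<Rightarrow> 'a"

definition face_meas :: "'a::euclidean_space set \<Rightarrow> real" where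
  "face_meas \<sigma> = enn2real (surface_outer \<sigma>)"

definition int_faces :: "'a::euclidean_space fv_mesh \<Rightarrow> 'a set set" where
  "int_faces M =
     {\<sigma> \<in> faces M. \<exists>K\<in>cells M. \<exists>L\<in>cells M. K \<noteq> L \<and> \<sigma> = closure K \<inter> closure L}"

definition ext_faces :: "'a::euclidean_space set \<Rightarrow> 'a fv_mesh \<Rightarrow> 'a set set" where
  "ext_faces \<Omega> M = {\<sigma> \<in> faces M. \<sigma> \<subseteq> frontier \<Omega>}"

definition dir_faces :: "'a set \<Rightarrow> 'a fv_mesh \<Rightarrow> 'a set set" where
  "dir_faces \<Gamma>D M = {\<sigma> \<in> faces M. \<sigma> \<subseteq> \<Gamma>D}"

text \<open>The condition that every face is interior or exterior is implicit in the scheme: mirror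
  values and fluxes are given for these two kinds of faces only.\<close>

definition admissible_mesh ::
    "'a::euclidean_space set \<Rightarrow> 'a set \<Rightarrow> 'a set \<Rightarrow> 'a fv_mesh \<Rightarrow> bool" where
  "admissible_mesh \<Omega> \<Gamma>D \<Gamma>N M \<longleftrightarrow>
     finite (cells M) \<and> finite (faces M) \<and>
     (\<forall>K\<in>cells M. K \<noteq> {} \<and> open K \<and> convex K \<and> polyhedron (closure K)) \<and>
     (\<forall>K\<in>cells M. \<forall>L\<in>cells M. K \<noteq> L \<longrightarrow> K \<inter> L = {}) \<and>
     (\<Union>K\<in>cells M. closure K) = closure \<Omega> \<and>
     (\<forall>\<sigma>\<in>faces M. closed \<sigma> \<and> (\<exists>a b. a \<noteq> 0 \<and> \<sigma> \<subseteq> {x. a \<bullet> x = b}) \<and> face_meas \<sigma> > 0) \<and>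
     (\<forall>\<sigma>\<in>faces M. \<forall>\<sigma>'\<in>faces M. \<sigma> \<noteq> \<sigma>' \<longrightarrow> surface_outer (\<sigma> \<inter> \<sigma>') = 0) \<and>
     (\<forall>K\<in>cells M. cfaces M K \<subseteq> faces M \<and> frontier K = \<Union>(cfaces M K)) \<and>
     (\<Union>K\<in>cells M. cfaces M K) = faces M \<and>
     (\<forall>K\<in>cells M. \<forall>L\<in>cells M. K \<noteq> L \<longrightarrow>
        closure K \<inter> closure L \<in> faces M \<or> surface_outer (closure K \<inter> closure L) = 0) \<and>
     faces M = int_faces M \<union> ext_faces \<Omega> M \<and>
     (\<forall>K\<in>cells M. ctr M K \<in> K) \<and> inj_on (ctr M) (cells M) \<and>
     (\<forall>K\<in>cells M. \<forall>L\<in>cells M. K \<noteq> L \<longrightarrow> closure K \<inter> closure L \<in> faces M \<longrightarrow>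
        (\<forall>y\<in>closure K \<inter> closure L. \<forall>z\<in>closure K \<inter> closure L.
           orthogonal (ctr M L - ctr M K) (y - z))) \<and>
     (\<forall>\<sigma>\<in>ext_faces \<Omega> M. \<sigma> \<subseteq> \<Gamma>D \<or> \<sigma> \<subseteq> closure \<Gamma>N) \<and>
     (\<forall>K\<in>cells M. \<forall>\<sigma>\<in>cfaces M K \<inter> ext_faces \<Omega> M.
        fctr M \<sigma> \<in> \<sigma> \<and> (\<forall>y\<in>\<sigma>. \<forall>z\<in>\<sigma>. orthogonal (fctr M \<sigma> - ctr M K) (y - z)))"

text \<open>The cell \<open>L\<close> with \<open>\<sigma> = K|L\<close>; meaningful for interior faces of \<open>K\<close>.\<close>

definition nbr :: "'a::euclidean_space fv_mesh \<Rightarrow> 'a set \<Rightarrow> 'a set \<Rightarrow> 'a set" where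
  "nbr M K \<sigma> = (THE L. L \<in> cells M \<and> L \<noteq> K \<and> closure K \<inter> closure L = \<sigma>)"

text \<open>An interior face belongs to two cells, an exterior one to a single cell. Quantities that do
  not depend on the choice are evaluated from the cell chosen here.\<close>

definition owner :: "'a fv_mesh \<Rightarrow> 'a set \<Rightarrow> 'a set" where
  "owner M \<sigma> = (SOME K. K \<in> cells M \<and> \<sigma> \<in> cfaces M K)"

definition face_dist :: "'a::euclidean_space fv_mesh \<Rightarrow> 'a set \<Rightarrow> real" where
  "face_dist M \<sigma> =
     (let K = owner M \<sigma>
      in if \<sigma> \<in> int_faces M then dist (ctr M K) (ctr M (nbr M K \<sigma>))
         else dist (ctr M K) (fctr M \<sigma>))"

definition transm :: "'a::euclidean_space fv_mesh \<Rightarrow> 'a set \<Rightarrow> real" where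
  "transm M \<sigma> = face_meas \<sigma> / face_dist M \<sigma>"

section \<open>Flux functions\<close>

definition bernoulli_fun :: "real \<Rightarrow> real" where
  "bernoulli_fun u = (if u = 0 then 1 else u / (exp u - 1))"

definition chem_pot :: "real \<Rightarrow> real" where "chem_pot c = ln (c / (1 - c))"
definition excess_pot :: "real \<Rightarrow> real" where "excess_pot c = - ln (1 - c)"
definition activity :: "real \<Rightarrow> real" where "activity c = c / (1 - c)"
definition inv_act_coeff :: "real \<Rightarrow> real" where "inv_act_coeff c = 1 - c"

definition dr :: "real \<Rightarrow> real \<Rightarrow> real" where
  "dr cK cL = (if cK = cL then 1 / (1 - cK) else (chem_pot cK - chem_pot cL) / (ln cK - ln cL))"

datatype flux_kind = Centered | Sedan | Activity | Bessemoulin_Chatard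

fun flux :: "flux_kind \<Rightarrow> real \<Rightarrow> real \<Rightarrow> real \<Rightarrow> real \<Rightarrow> real" where
  "flux Centered cK cL \<Phi>K \<Phi>L = - ((cK + cL) / 2) * (chem_pot cL + \<Phi>L - chem_pot cK - \<Phi>K)"
| "flux Sedan cK cL \<Phi>K \<Phi>L =
     bernoulli_fun (\<Phi>L + excess_pot cL - \<Phi>K - excess_pot cK) * cK
     - bernoulli_fun (\<Phi>K + excess_pot cK - \<Phi>L - excess_pot cL) * cL"
| "flux Activity cK cL \<Phi>K \<Phi>L =
     (inv_act_coeff cK + inv_act_coeff cL) / 2
     * (bernoulli_fun (\<Phi>L - \<Phi>K) * activity cK - bernoulli_fun (\<Phi>K - \<Phi>L) * activity cL)"
| "flux Bessemoulin_Chatard cK cL \<Phi>K \<Phi>L =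
     dr cK cL
     * (bernoulli_fun ((\<Phi>L - \<Phi>K) / dr cK cL) * cK - bernoulli_fun ((\<Phi>K - \<Phi>L) / dr cK cL) * cL)"

section \<open>The scheme\<close>

text \<open>Vectors indexed by the cells are functions on sets; only their values at cells matter.\<close>

definition cell_avg :: "('a::euclidean_space \<Rightarrow> real) \<Rightarrow> 'a set \<Rightarrow> real" where
  "cell_avg f K = (LINT x:K|lebesgue. f x) / measure lebesgue K"

definition face_avg :: "('a::euclidean_space \<Rightarrow> real) \<Rightarrow> 'a set \<Rightarrow> real" where
  "face_avg \<gamma> \<sigma> = (LINT x:\<sigma>|surface_measure. \<gamma> x) / face_meas \<sigma>"

text \<open>\<open>D\<^sub>K\<^sub>\<sigma>\<Phi>\<close>, where \<open>\<Phi>D\<close> gives the face values on Dirichlet faces.\<close>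

definition jump ::
    "'a::euclidean_space fv_mesh \<Rightarrow> 'a set \<Rightarrow> ('a set \<Rightarrow> real) \<Rightarrow> ('a set \<Rightarrow> real)
      \<Rightarrow> 'a set \<Rightarrow> 'a set \<Rightarrow> real" where
  "jump M \<Gamma>D \<Phi>D \<Phi> K \<sigma> =
     (if \<sigma> \<in> int_faces M then \<Phi> (nbr M K \<sigma>)
      else if \<sigma> \<in> dir_faces \<Gamma>D M then \<Phi>D \<sigma>
      else \<Phi> K) - \<Phi> K"

definition discrete_poisson ::
    "'a::euclidean_space fv_mesh \<Rightarrow> 'a set \<Rightarrow> ('a set \<Rightarrow> real) \<Rightarrow> ('a set \<Rightarrow> real)
      \<Rightarrow> ('a set \<Rightarrow> real) \<Rightarrow> ('a set \<Rightarrow> real) \<Rightarrow> bool" where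
  "discrete_poisson M \<Gamma>D \<Phi>D cdp c \<Phi> \<longleftrightarrow>
     (\<forall>K\<in>cells M. - (\<Sum>\<sigma>\<in>cfaces M K. transm M \<sigma> * jump M \<Gamma>D \<Phi>D \<Phi> K \<sigma>)
                  = measure lebesgue K * (c K + cdp K))"

definition num_flux ::
    "flux_kind \<Rightarrow> 'a::euclidean_space fv_mesh \<Rightarrow> ('a set \<Rightarrow> real) \<Rightarrow> ('a set \<Rightarrow> real)
      \<Rightarrow> 'a set \<Rightarrow> 'a set \<Rightarrow> real" where
  "num_flux k M c \<Phi> K \<sigma> =
     (if \<sigma> \<in> int_faces M
      then transm M \<sigma> * flux k (c K) (c (nbr M K \<sigma>)) (\<Phi> K) (\<Phi> (nbr M K \<sigma>))
      else 0)"

text \<open>The first conjunct says that the flux functions, whose domain is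
  \<open>(0,1)\<^sup>2 \<times> \<real>\<^sup>2\<close>, are evaluated inside their domain.\<close>

definition scheme_step ::
    "flux_kind \<Rightarrow> 'a::euclidean_space fv_mesh \<Rightarrow> 'a set \<Rightarrow> ('a set \<Rightarrow> real) \<Rightarrow> ('a set \<Rightarrow> real)
      \<Rightarrow> real \<Rightarrow> ('a set \<Rightarrow> real) \<Rightarrow> ('a set \<Rightarrow> real) \<Rightarrow> ('a set \<Rightarrow> real) \<Rightarrow> bool" where
  "scheme_step k M \<Gamma>D \<Phi>D cdp \<Delta>t c_old c \<Phi> \<longleftrightarrow>
     (\<forall>K\<in>cells M. \<forall>\<sigma>\<in>cfaces M K \<inter> int_faces M.
        0 < c K \<and> c K < 1 \<and> 0 < c (nbr M K \<sigma>) \<and> c (nbr M K \<sigma>) < 1) \<and>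
     discrete_poisson M \<Gamma>D \<Phi>D cdp c \<Phi> \<and>
     (\<forall>K\<in>cells M. measure lebesgue K * ((c K - c_old K) / \<Delta>t)
                  + (\<Sum>\<sigma>\<in>cfaces M K. num_flux k M c \<Phi> K \<sigma>) = 0)"

section \<open>Energy\<close>

definition mixing_entropy :: "real \<Rightarrow> real" where
  "mixing_entropy c = (if c = 0 \<or> c = 1 then 0 else c * ln c + (1 - c) * ln (1 - c))"

definition energy ::
    "'a::euclidean_space fv_mesh \<Rightarrow> 'a set \<Rightarrow> ('a set \<Rightarrow> real)
      \<Rightarrow> ('a set \<Rightarrow> real) \<Rightarrow> ('a set \<Rightarrow> real) \<Rightarrow> real" where
  "energy M \<Gamma>D \<Phi>D c \<Phi> =
     (\<Sum>K\<in>cells M. measure lebesgue K * mixing_entropy (c K))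
     + 1 / 2 * (\<Sum>\<sigma>\<in>faces M. transm M \<sigma> * \<bar>jump M \<Gamma>D \<Phi>D \<Phi> (owner M \<sigma>) \<sigma>\<bar>\<^sup>2)
     - (\<Sum>K\<in>cells M. \<Sum>\<sigma>\<in>dir_faces \<Gamma>D M \<inter> cfaces M K.
          transm M \<sigma> * \<Phi>D \<sigma> * jump M \<Gamma>D \<Phi>D \<Phi> K \<sigma>)"

end

theory Submission
  imports Defs
begin

text \<open>A step is posed in the unknowns \<open>y = h(c)\<close> and \<open>\<Phi>\<close> on a large cube, where a continuous vector
  field always solves the corresponding variational inequality. Testing the Poisson residual with
  \<open>\<Phi>\<close> and the mass balance with \<open>y + \<Phi>\<close> gives the energy estimate for such a solution. The
  dissipation of each edge blows up when one of its two concentrations tends to \<open>0\<close> (or \<open>1\<close>) and the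
  other one does not, and the entropy term keeps away from \<open>0\<close> a cell with positive old
  concentration and from \<open>1\<close> a cell with old concentration below \<open>1\<close>; both bounds spread through
  the connected graph of cells. So the solution stays away from the boundary of a cube that
  is large enough, and all residuals vanish.

  The energy decreases because \<open>H\<close> is convex with derivative \<open>h\<close>, the electric energy is half a
  nonnegative quadratic form in \<open>\<Phi>\<close> up to a constant, and each flux has the sign of the drop of
  \<open>h(c) + \<Phi>\<close>.

  The graph of cells is connected: if the closures of two complementary families of cells met
  only in surface-null sets, then the union of all segments in a given direction through these sets
  would be negligible, yet it contains a ball. A Dirichlet face exists because \<open>\<Gamma>D - closure \<Gamma>N\<close>
  meets interior faces only in their relative boundaries, which are surface-null.\<close>

section \<open>A variational inequality on a box\<close>

text \<open>The fluxes live on the open square and may be singular at its edges, so \<open>c\<close>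
  itself is a poor unknown for a fixed point argument on [0,1]. In terms of \<open>y = h(c)\<close>
  the state \<open>c = logistic y\<close> is always admissible and the residuals are continuous on
  the whole space. On the boundary of the cube no equation can be demanded, but tests with the
  potential and with \<open>y\<close> plus the potential need just the sign of the residual there,
  so the estimates are available before any constraint is known to be inactive. They do not involve
  the side of the cube, which is therefore chosen last. It has to exceed the bound of the potential,
  so that \<open>y + u\<close> has the sign of \<open>y\<close> wherever \<open>y\<close> reaches
  the boundary.

  The strict bounds on the mean of the initial datum supply the two cells from which the bounds on
  \<open>y\<close> start, and they settle the mesh with a single cell, where no flux is ever
  evaluated.

  The geometry enters through a finite weighted graph. The Lipschitz boundary gives
  \<open>interior (closure \<Omega>) = \<Omega>\<close>. Dimension at most 3 puts every set of
  codimension two into a point or a line, whose surface measure is computed by hand.\<close>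

lemma convergent_subseq_bounded_coords:
  fixes X :: "nat \<Rightarrow> nat \<Rightarrow> real"
  assumes "\<And>k i. \<bar>X k i\<bar> \<le> R"
  obtains y r where "strict_mono (r :: nat \<Rightarrow> nat)" "\<And>i. \<bar>y i\<bar> \<le> R" "\<And>i. (\<lambda>k. X (r k) i) \<longlonglongrightarrow> y i"
proof -
  have "compactin (product_topology (\<lambda>_. euclidean) UNIV) (PiE UNIV (\<lambda>_::nat. {-R..R}))"
    by (subst compactin_PiE) auto
  then have "compact (PiE UNIV (\<lambda>_::nat. {-R..R}))"
    by (simp add: euclidean_product_topology)
  moreover have "X k \<in> PiE UNIV (\<lambda>_::nat. {-R..R})" for k
    using assms[of k] by (auto simp: abs_le_iff) (smt (verit))
  ultimately obtain y r where y: "y \<in> PiE UNIV (\<lambda>_::nat. {-R..R})"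
    "strict_mono (r :: nat \<Rightarrow> nat)" "(X \<circ> r) \<longlonglongrightarrow> y"
    unfolding compact_eq_seq_compact_metric seq_compact_def by metis
  have "(\<lambda>k. X (r k) i) \<longlonglongrightarrow> y i" for i
  proof -
    have "continuous_on UNIV (\<lambda>x::nat \<Rightarrow> real. x i)" by simp
    then have "isCont (\<lambda>x::nat \<Rightarrow> real. x i) y"
      by (metis continuous_on_eq_continuous_at open_UNIV UNIV_I)
    then show ?thesis
      using isCont_tendsto_compose[OF _ y(3)] by (simp add: comp_def)
  qed
  moreover have "\<bar>y i\<bar> \<le> R" for i
    using y(1) by (auto simp: PiE_iff abs_le_iff) (smt (verit))
  ultimately show ?thesis
    using y(2) that by blast
qed

text \<open>Kuhn's combinatorial lemma is used instead of Brouwer's theorem because the dimension, which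
  will be twice the number of cells, has to be a term and not a type.\<close>

lemma box_variational_inequality_nat:
  fixes G :: "nat \<Rightarrow> (nat \<Rightarrow> real) \<Rightarrow> real"
  assumes R: "R > 0"
    and G: "\<And>i. i < n \<Longrightarrow> continuous_on UNIV (G i)"
  shows "\<exists>y. (\<forall>i. \<bar>y i\<bar> \<le> R) \<and>
    (\<forall>i<n. (G i y \<le> 0 \<or> y i = -R) \<and> (G i y \<ge> 0 \<or> y i = R))"
proof -
  \<comment> \<open>Sends the grid with entries 0, ..., \<open>p\<close> onto an equidistant grid of
    the cube; coordinates from \<open>n\<close> on are frozen at 0.\<close>
  define pt where "pt p x = (\<lambda>i. if i < n then R * (2 * real (x i) / real p - 1) else 0)" for p :: nat and x :: "nat \<Rightarrow> nat"
  \<comment> \<open>Label 0 records \<open>G \<le> 0\<close> or the lower side of the cube, label 1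
    records \<open>G > 0\<close> or the upper side. Giving the sides priority meets the boundary
    conditions of Kuhn's lemma, and it is the origin of the two exceptional alternatives in the
    conclusion.\<close>
  define lab where "lab p x i = (if x i = 0 then 0 else if x i = p then 1 else if G i (pt p x) \<le> 0 then 0 else (1::nat))"
    for p x i
  have "\<exists>q. (\<forall>i<n. q i < Suc p) \<and> (\<forall>i<n. \<exists>r s. (\<forall>j<n. q j \<le> r j \<and> r j \<le> q j + 1) \<and>
        (\<forall>j<n. q j \<le> s j \<and> s j \<le> q j + 1) \<and> lab (Suc p) r i = 0 \<and> lab (Suc p) s i = 1)" for p
  proof -
    obtain q where q: "\<forall>i<n. q i < Suc p"
      "\<forall>i<n. \<exists>r s. (\<forall>j<n. q j \<le> r j \<and> r j \<le> q j + 1) \<and>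
        (\<forall>j<n. q j \<le> s j \<and> s j \<le> q j + 1) \<and> lab (Suc p) r i \<noteq> lab (Suc p) s i"
      by (rule kuhn_lemma[of "Suc p" n "lab (Suc p)"]) (auto simp: lab_def)
    have "lab (Suc p) r i = 0 \<or> lab (Suc p) r i = 1" for r i
      by (auto simp: lab_def)
    with q show ?thesis
      by (intro exI[of _ q]) metis
  qed
  then obtain q where q: "\<And>p i. i < n \<Longrightarrow> q p i < Suc p"
    and "\<And>p. \<forall>i. \<exists>r s. i < n \<longrightarrow> (\<forall>j<n. q p j \<le> r j \<and> r j \<le> q p j + 1) \<and>
        (\<forall>j<n. q p j \<le> s j \<and> s j \<le> q p j + 1) \<and> lab (Suc p) r i = 0 \<and> lab (Suc p) s i = 1"
    by metis
  then obtain r s where rs: "\<And>p i j. i < n \<Longrightarrow> j < n \<Longrightarrow> q p j \<le> r p i j \<and> r p i j \<le> q p j + 1"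
    "\<And>p i j. i < n \<Longrightarrow> j < n \<Longrightarrow> q p j \<le> s p i j \<and> s p i j \<le> q p j + 1"
    "\<And>p i. i < n \<Longrightarrow> lab (Suc p) (r p i) i = 0" "\<And>p i. i < n \<Longrightarrow> lab (Suc p) (s p i) i = 1"
    by metis
  have ptb: "\<bar>pt (Suc p) x i\<bar> \<le> R" if "\<And>i. i < n \<Longrightarrow> x i \<le> Suc p" for p x i
  proof (cases "i < n")
    case True
    have "real (x i) / real (Suc p) \<le> 1" "0 \<le> real (x i) / real (Suc p)"
      using that[OF True] by (simp_all del: of_nat_Suc)
    then have "\<bar>2 * real (x i) / real (Suc p) - 1\<bar> \<le> 1"
      unfolding times_divide_eq_right[symmetric] by linarith
    then have "R * \<bar>2 * real (x i) / real (Suc p) - 1\<bar> \<le> R * 1"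
      using R by (intro mult_left_mono) auto
    then show ?thesis
      using True R by (simp add: pt_def abs_mult)
  next
    case False
    then show ?thesis using R by (simp add: pt_def)
  qed
  obtain y \<phi> where \<phi>: "strict_mono (\<phi> :: nat \<Rightarrow> nat)" and yb: "\<And>i. \<bar>y i\<bar> \<le> R"
    and lim: "\<And>i. (\<lambda>k. pt (Suc (\<phi> k)) (q (\<phi> k)) i) \<longlonglongrightarrow> y i"
    by (rule convergent_subseq_bounded_coords[of "\<lambda>p. pt (Suc p) (q p)" R])
      (use ptb q less_imp_le in blast)+
  \<comment> \<open>All vertices of the selected small cubes have the same limit, so the vertices
    labelled 0 and those labelled 1 can both be evaluated at \<open>y\<close>.\<close>
  have near: "(\<lambda>k. pt (Suc (\<phi> k)) (x (\<phi> k)) j) \<longlonglongrightarrow> y j"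
    if "\<And>p j. j < n \<Longrightarrow> q p j \<le> x p j \<and> x p j \<le> q p j + 1" for x j
  proof -
    have "\<bar>pt (Suc p) (x p) j - pt (Suc p) (q p) j\<bar> \<le> 2 * R / real (Suc p)" for p
    proof (cases "j < n")
      case True
      have "real (x p j) - real (q p j) \<le> 1" "real (x p j) - real (q p j) \<ge> 0"
        using that[OF True, of p] by linarith+
      moreover have "pt (Suc p) (x p) j - pt (Suc p) (q p) j = 2 * R * (real (x p j) - real (q p j)) / real (Suc p)"
        using True by (simp add: pt_def diff_divide_distrib right_diff_distrib mult_ac del: of_nat_Suc)
      ultimately show ?thesis
        using R by (simp add: abs_mult divide_right_mono)
    next
      case False
      then show ?thesis using R by (simp add: pt_def)
    qed
    note b = this
    have "(\<lambda>p. 2 * R / real (Suc p)) \<longlonglongrightarrow> 0"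
      by (intro tendsto_divide_0[OF tendsto_const] filterlim_compose[OF filterlim_real_sequentially] filterlim_at_top_imp_at_infinity filterlim_Suc)
    then have "(\<lambda>p. pt (Suc p) (x p) j - pt (Suc p) (q p) j) \<longlonglongrightarrow> 0"
      by (rule Lim_null_comparison[rotated]) (use b in \<open>simp del: of_nat_Suc\<close>)
    from tendsto_add[OF LIMSEQ_subseq_LIMSEQ[OF this \<phi>] lim[of j]]
    show ?thesis by (simp add: comp_def)
  qed
  have cont: "(\<lambda>k. G i (X k)) \<longlonglongrightarrow> G i y" if "i < n" "\<And>j. (\<lambda>k. X k j) \<longlonglongrightarrow> y j" for i X
  proof -
    have "X \<longlonglongrightarrow> y"
      using that(2)
      by (simp add: limitin_componentwise flip: limitin_canonical_iff euclidean_product_topology)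
    moreover have "isCont (G i) y"
      using G[OF that(1)] by (simp add: continuous_on_eq_continuous_at)
    ultimately show ?thesis
      using isCont_tendsto_compose by blast
  qed
  have "(G i y \<le> 0 \<or> y i = -R) \<and> (G i y \<ge> 0 \<or> y i = R)" if i: "i < n" for i
  proof (intro conjI; rule ccontr)
    assume H: "\<not> (G i y \<le> 0 \<or> y i = - R)"
    let ?X = "\<lambda>k. pt (Suc (\<phi> k)) (r (\<phi> k) i)"
    have l: "\<And>j. (\<lambda>k. ?X k j) \<longlonglongrightarrow> y j"
      using near[of "\<lambda>p. r p i"] rs(1)[OF i] by blast
    have "\<forall>\<^sub>F k in sequentially. G i (?X k) > 0"
      using order_tendstoD(1)[OF cont[OF i l]] H by auto
    moreover have "\<forall>\<^sub>F k in sequentially. ?X k i > - R"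
      using order_tendstoD(1)[OF l[of i]] H yb[of i] by (simp add: abs_le_iff)
    ultimately have "\<forall>\<^sub>F k in sequentially. False"
    proof eventually_elim
      case (elim k)
      then show ?case
        using rs(3)[OF i, of "\<phi> k"] i by (auto simp: lab_def pt_def split: if_splits)
    qed
    then show False by simp
  next
    assume H: "\<not> (G i y \<ge> 0 \<or> y i = R)"
    let ?X = "\<lambda>k. pt (Suc (\<phi> k)) (s (\<phi> k) i)"
    have l: "\<And>j. (\<lambda>k. ?X k j) \<longlonglongrightarrow> y j"
      using near[of "\<lambda>p. s p i"] rs(2)[OF i] by blast
    have "\<forall>\<^sub>F k in sequentially. G i (?X k) < 0"
      using order_tendstoD(2)[OF cont[OF i l]] H by auto
    moreover have "\<forall>\<^sub>F k in sequentially. ?X k i < R"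
      using order_tendstoD(2)[OF l[of i]] H yb[of i] by (simp add: abs_le_iff)
    ultimately have "\<forall>\<^sub>F k in sequentially. False"
    proof eventually_elim
      case (elim k)
      then show ?case
        using rs(4)[OF i, of "\<phi> k"] i R by (auto simp: lab_def pt_def field_simps split: if_splits)
    qed
    then show False by simp
  qed
  with yb show ?thesis by blast
qed

lemma box_variational_inequality:
  fixes G :: "'v \<Rightarrow> ('v \<Rightarrow> real) \<Rightarrow> real"
  assumes V: "finite V" and R: "R > 0"
    and G: "\<And>K. K \<in> V \<Longrightarrow> continuous_on UNIV (G K)"
  shows "\<exists>y. (\<forall>K. \<bar>y K\<bar> \<le> R) \<and>
    (\<forall>K\<in>V. (G K y \<le> 0 \<or> y K = -R) \<and> (G K y \<ge> 0 \<or> y K = R))"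
proof -
  obtain e n where e: "bij_betw e {..<n::nat} V"
    using ex_bij_betw_nat_finite[OF V] by (auto simp: atLeast0LessThan)
  define \<iota> where "\<iota> = inv_into {..<n} e"
  have e\<iota>: "\<iota> (e i) = i" if "i < n" for i
    using e that by (simp add: \<iota>_def bij_betw_def)
  have "continuous_on UNIV (\<lambda>z::nat \<Rightarrow> real. G (e i) (\<lambda>K. z (\<iota> K)))" if "i < n" for i
  proof -
    have "e i \<in> V" using e that by (auto simp: bij_betw_def)
    moreover have "continuous_on UNIV (\<lambda>(z::nat \<Rightarrow> real) K. z (\<iota> K))"
      by (intro continuous_on_coordinatewise_then_product continuous_on_product_coordinates)
    ultimately show ?thesis
      using continuous_on_compose2[OF G[OF \<open>e i \<in> V\<close>]] by (metis subset_UNIV)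
  qed
  note G' = this
  obtain z where z: "\<forall>i. \<bar>z i\<bar> \<le> R"
    "\<forall>i<n. (G (e i) (\<lambda>K. z (\<iota> K)) \<le> 0 \<or> z i = -R) \<and> (G (e i) (\<lambda>K. z (\<iota> K)) \<ge> 0 \<or> z i = R)"
    using box_variational_inequality_nat[OF R, of n "\<lambda>i z. G (e i) (\<lambda>K. z (\<iota> K))"] G'
    by auto
  have "V = e ` {..<n}" using e by (simp add: bij_betw_def)
  with z e\<iota> show ?thesis
    by (intro exI[of _ "\<lambda>K. z (\<iota> K)"]) auto
qed

section \<open>Flux functions and entropy\<close>

lemma bernoulli_fun_pos: "bernoulli_fun u > 0"
proof -
  have "u < 0 \<Longrightarrow> exp u - 1 < 0" by simp
  then show ?thesis
    by (cases "u < 0") (auto simp: bernoulli_fun_def divide_neg_neg)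
qed

lemma bernoulli_fun_minus: "bernoulli_fun (- u) = exp u * bernoulli_fun u"
proof (cases "u = 0")
  case False
  then have "exp u - 1 \<noteq> 0" "exp (-u) - 1 \<noteq> 0" by auto
  then show ?thesis
    using False by (simp add: bernoulli_fun_def exp_minus field_simps)
qed (simp add: bernoulli_fun_def)

lemma bernoulli_fun_antimono:
  assumes "u \<le> v"
  shows "bernoulli_fun v \<le> bernoulli_fun u"
proof -
  text \<open>\<open>1 / B(u)\<close> is the mean of \<open>exp\<close> over the interval between \<open>0\<close> and \<open>u\<close>.\<close>
  have int: "((\<lambda>s. exp (w * s)) has_integral 1 / bernoulli_fun w) {0..1}" for w :: real
  proof (cases "w = 0")
    case True
    then show ?thesis
      using has_integral_const_real[of "1::real" 0 1] by (simp add: bernoulli_fun_def)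
  next
    case False
    have "((\<lambda>s. exp (w * s)) has_integral exp (w * 1) / w - exp (w * 0) / w) {0..1}"
      by (rule fundamental_theorem_of_calculus)
        (use False in \<open>auto intro!: derivative_eq_intros simp flip: has_real_derivative_iff_has_vector_derivative\<close>)
    then show ?thesis
      using False by (simp add: bernoulli_fun_def diff_divide_distrib)
  qed
  have "1 / bernoulli_fun u \<le> 1 / bernoulli_fun v"
    by (rule has_integral_le[OF int int]) (use assms in \<open>auto intro: mult_right_mono\<close>)
  then show ?thesis
    using bernoulli_fun_pos[of u] bernoulli_fun_pos[of v] by (simp add: field_simps)
qed

lemma continuous_on_bernoulli_fun: "continuous_on UNIV bernoulli_fun"
proof -
  have "isCont bernoulli_fun u" for u
  proof (cases "u = 0")
    case True
    have "((\<lambda>u. (exp u - 1) / u) \<longlongrightarrow> (1::real)) (at 0)"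
      using DERIV_exp[of "0::real"] by (simp add: has_field_derivative_iff)
    then have "((\<lambda>u. 1 / ((exp u - 1) / u)) \<longlongrightarrow> 1 / (1::real)) (at 0)"
      by (intro tendsto_intros) auto
    moreover have "\<forall>\<^sub>F u in at 0. 1 / ((exp u - 1) / u) = bernoulli_fun u"
      by (auto simp: eventually_at_filter bernoulli_fun_def)
    ultimately have "(bernoulli_fun \<longlongrightarrow> 1) (at 0)"
      using tendsto_cong by fastforce
    then show ?thesis
      using True by (simp add: isCont_def bernoulli_fun_def)
  next
    case False
    then have "isCont (\<lambda>u::real. u / (exp u - 1)) u"
      by (intro continuous_intros) auto
    moreover have "\<forall>\<^sub>F v in nhds u. v \<noteq> 0"
      using False by (intro t1_space_nhds) auto
    then have "\<forall>\<^sub>F v in nhds u. bernoulli_fun v = v / (exp v - 1)"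
      by eventually_elim (simp add: bernoulli_fun_def)
    ultimately show ?thesis
      using isCont_cong[of bernoulli_fun "\<lambda>v. v / (exp v - 1)" u] by simp
  qed
  then show ?thesis
    by (simp add: continuous_at_imp_continuous_on)
qed

section \<open>The chemical potential and the mean \<open>dr\<close>\<close>

lemma chem_pot_eq: "0 < c \<Longrightarrow> c < 1 \<Longrightarrow> chem_pot c = ln c - ln (1 - c)"
  by (simp add: chem_pot_def ln_div)

lemma chem_pot_strict_mono: "0 < a \<Longrightarrow> a < b \<Longrightarrow> b < 1 \<Longrightarrow> chem_pot a < chem_pot b"
  by (simp add: chem_pot_eq) (smt (verit) ln_less_cancel_iff)

lemma chem_pot_mono: "0 < a \<Longrightarrow> a \<le> b \<Longrightarrow> b < 1 \<Longrightarrow> chem_pot a \<le> chem_pot b"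
  using chem_pot_strict_mono[of a b] by (cases "a = b") auto

lemma dr_commute: "dr a b = dr b a"
  by (simp add: dr_def) (metis minus_diff_eq minus_divide_divide)

text \<open>As a function of \<open>log c\<close>, the potential \<open>h\<close> has derivative \<open>1 / (1 - c)\<close>.\<close>

lemma dr_mean_value:
  assumes "0 < a" "a < b" "b < 1"
  shows "\<exists>\<theta>. a < \<theta> \<and> \<theta> < b \<and> dr a b = 1 / (1 - \<theta>)"
proof -
  define g where "g p = p - ln (1 - exp p)" for p :: real
  have l: "ln a < ln b" using assms by simp
  have "(g has_real_derivative 1 / (1 - exp p)) (at p)" if "p \<le> ln b" for p
  proof -
    have "exp p \<le> b"
      using that assms by (metis exp_le_cancel_iff exp_ln less_trans)
    then have "exp p < 1"
      using assms by linarith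
    then have "p < 0" by simp
    then show ?thesis
      unfolding g_def by (auto intro!: derivative_eq_intros simp: field_simps)
  qed
  from MVT2[OF l, of g "\<lambda>p. 1 / (1 - exp p)"] this
  obtain z where z: "ln a < z" "z < ln b" "g (ln b) - g (ln a) = (ln b - ln a) * (1 / (1 - exp z))"
    by (meson)
  have "a < exp z" "exp z < b"
    using z assms by (metis exp_less_cancel_iff exp_ln less_trans)+
  moreover have "dr a b = (g (ln b) - g (ln a)) / (ln b - ln a)"
    using assms l by (subst dr_commute) (simp add: dr_def g_def chem_pot_eq)
  then have "dr a b = 1 / (1 - exp z)"
    using z(3) l by simp
  ultimately show ?thesis by blast
qed

lemma dr_bounds:
  assumes "0 < a" "a < 1" "0 < b" "b < 1"
  shows "1 / (1 - min a b) \<le> dr a b" "dr a b \<le> 1 / (1 - max a b)"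
proof -
  have *: "1 / (1 - a) \<le> dr a b \<and> dr a b \<le> 1 / (1 - b)" if ab: "0 < a" "a < b" "b < 1" for a b
  proof -
    from dr_mean_value[OF ab] obtain \<theta> where "a < \<theta>" "\<theta> < b" "dr a b = 1 / (1 - \<theta>)"
      by blast
    then show ?thesis
      using ab by (auto simp: frac_le)
  qed
  consider "a < b" | "b < a" | "a = b" by linarith
  then have "1 / (1 - min a b) \<le> dr a b \<and> dr a b \<le> 1 / (1 - max a b)"
  proof cases
    case 1 with *[of a b] assms show ?thesis by simp
  next
    case 2 with *[of b a] assms show ?thesis by (simp add: dr_commute)
  next
    case 3 then show ?thesis by (simp add: dr_def)
  qed
  then show "1 / (1 - min a b) \<le> dr a b" "dr a b \<le> 1 / (1 - max a b)" by auto
qed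

lemma dr_ge_1:
  assumes "0 < a" "a < 1" "0 < b" "b < 1"
  shows "dr a b \<ge> 1"
proof -
  have "1 \<le> 1 / (1 - min a b)" using assms by (auto simp: min_def)
  then show ?thesis using dr_bounds(1)[OF assms] by linarith
qed

lemma chem_pot_diff_eq_dr:
  assumes "0 < a" "a < 1" "0 < b" "b < 1"
  shows "chem_pot a - chem_pot b = dr a b * (ln a - ln b)"
  using assms by (auto simp: dr_def)

text \<open>Off the diagonal the difference quotient is continuous. On the diagonal both cases of
  \<open>dr\<close> occur arbitrarily close by, and the two bounds of \<open>dr_bounds\<close>,
  which have the same limit there, squeeze them together.\<close>

lemma tendsto_dr:
  fixes a b :: real
  assumes "0 < a" "a < 1" "0 < b" "b < 1" and f: "(f \<longlongrightarrow> a) F" and g: "(g \<longlongrightarrow> b) F"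
  shows "((\<lambda>x. dr (f x) (g x)) \<longlongrightarrow> dr a b) F"
proof (cases "a = b")
  case True
  have ev: "\<forall>\<^sub>F x in F. 0 < f x \<and> f x < 1 \<and> 0 < g x \<and> g x < 1"
    using order_tendstoD[OF f] order_tendstoD[OF g] assms by (intro eventually_conj) auto
  have "((\<lambda>x. 1 / (1 - min (f x) (g x))) \<longlongrightarrow> 1 / (1 - min a b)) F"
    "((\<lambda>x. 1 / (1 - max (f x) (g x))) \<longlongrightarrow> 1 / (1 - max a b)) F"
    using assms by (intro tendsto_intros; simp)+
  then have l: "((\<lambda>x. 1 / (1 - min (f x) (g x))) \<longlongrightarrow> dr a b) F"
    "((\<lambda>x. 1 / (1 - max (f x) (g x))) \<longlongrightarrow> dr a b) F"
    using True by (simp_all add: dr_def)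
  show ?thesis
    by (rule tendsto_sandwich[OF _ _ l]) (use ev in \<open>(eventually_elim, use dr_bounds in blast)+\<close>)
next
  case False
  have "((\<lambda>x. f x - g x) \<longlongrightarrow> a - b) F"
    by (intro tendsto_intros f g)
  then have "\<forall>\<^sub>F x in F. f x - g x \<noteq> 0"
    using False by (intro tendsto_imp_eventually_ne) auto
  then have "\<forall>\<^sub>F x in F. (chem_pot (f x) - chem_pot (g x)) / (ln (f x) - ln (g x)) = dr (f x) (g x)"
    by eventually_elim (auto simp: dr_def)
  moreover have "((\<lambda>x. (chem_pot (f x) - chem_pot (g x)) / (ln (f x) - ln (g x)))
      \<longlongrightarrow> (chem_pot a - chem_pot b) / (ln a - ln b)) F"
    unfolding chem_pot_def using assms False by (intro tendsto_intros f g) auto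
  ultimately show ?thesis
    using False by (simp add: dr_def tendsto_cong)
qed

lemma tendsto_flux:
  fixes a b p q :: real
  assumes ab: "0 < a" "a < 1" "0 < b" "b < 1"
    and f: "(f \<longlongrightarrow> a) F" and g: "(g \<longlongrightarrow> b) F" and u: "(u \<longlongrightarrow> p) F" and v: "(v \<longlongrightarrow> q) F"
  shows "((\<lambda>x. flux k (f x) (g x) (u x) (v x)) \<longlongrightarrow> flux k a b p q) F"
proof -
  have B: "((\<lambda>x. bernoulli_fun (w x)) \<longlongrightarrow> bernoulli_fun r) F" if "(w \<longlongrightarrow> r) F" for w r
    using continuous_on_tendsto_compose[OF continuous_on_bernoulli_fun that] by simp
  have "dr a b \<noteq> 0" using dr_ge_1[OF ab] by simp
  then show ?thesis
    using ab by (cases k)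
      (auto simp: chem_pot_def excess_pot_def activity_def inv_act_coeff_def
         intro!: tendsto_intros f g u v B tendsto_dr)
qed

section \<open>Antisymmetry and sign of the fluxes\<close>

lemma flux_antisym: "flux k a b p q = - flux k b a q p"
  by (cases k) (auto simp: dr_commute algebra_simps add_divide_distrib diff_divide_distrib)

text \<open>All fluxes but the centered one are of the form \<open>A (B(x) p - B(-x) q)\<close>, which has the
  sign of \<open>log p - log q - x\<close>.\<close>

lemma bernoulli_diff_eq: "bernoulli_fun x * p - bernoulli_fun (- x) * q = bernoulli_fun x * (p - exp x * q)"
  by (simp add: bernoulli_fun_minus algebra_simps)

lemma bernoulli_diff_eq': "bernoulli_fun x * p - bernoulli_fun (- x) * q = - bernoulli_fun (- x) * (q - exp (- x) * p)"
  using bernoulli_diff_eq[of "- x" q p] by simp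

lemma bernoulli_diff_sign:
  assumes "p > 0" "q > 0"
  shows "(bernoulli_fun x * p - bernoulli_fun (- x) * q) * (ln p - ln q - x) \<ge> 0"
proof -
  have "p \<ge> exp x * q \<longleftrightarrow> ln p \<ge> x + ln q"
    using assms by (metis exp_add exp_le_cancel_iff exp_ln)
  then have "(p - exp x * q) * (ln p - ln q - x) \<ge> 0"
    by (auto simp: zero_le_mult_iff)
  then show ?thesis
    using bernoulli_fun_pos[of x] by (simp add: bernoulli_diff_eq mult.assoc)
qed

lemma flux_Sedan_eq:
  "flux Sedan a b p q = (let x = q + excess_pot b - p - excess_pot a in
     bernoulli_fun x * a - bernoulli_fun (- x) * b)"
  by (simp add: Let_def algebra_simps)

lemma flux_Activity_eq:
  "flux Activity a b p q = (inv_act_coeff a + inv_act_coeff b) / 2 *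
     (bernoulli_fun (q - p) * activity a - bernoulli_fun (- (q - p)) * activity b)"
  by simp

lemma flux_BC_eq:
  "flux Bessemoulin_Chatard a b p q = dr a b *
     (bernoulli_fun ((q - p) / dr a b) * a - bernoulli_fun (- ((q - p) / dr a b)) * b)"
  by (simp add: minus_divide_left)

declare flux.simps(2-4) [simp del]

text \<open>For the Bernoulli fluxes the potential drop is a positive multiple of
  \<open>ln p - ln q - x\<close> for the matching arguments. Sedan uses that \<open>h\<close> is the
  logarithm plus the excess potential, the activity flux that \<open>h\<close> is the logarithm of
  the activity, and Bessemoulin-Chatard that \<open>dr\<close> turns differences of logarithms into
  differences of \<open>h\<close>.\<close>

lemma flux_dissipative:
  assumes ab: "0 < a" "a < 1" "0 < b" "b < 1"
  shows "flux k a b p q * (chem_pot a + p - chem_pot b - q) \<ge> 0"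
proof (cases k)
  case Centered
  have "flux Centered a b p q = (a + b) / 2 * (chem_pot a + p - chem_pot b - q)"
    by (simp add: algebra_simps)
  then show ?thesis using Centered ab by (simp only: mult.assoc) simp
next
  case Sedan
  then show ?thesis
    using bernoulli_diff_sign[of a b "q + excess_pot b - p - excess_pot a"] ab
    by (simp add: flux_Sedan_eq Let_def chem_pot_eq excess_pot_def algebra_simps)
next
  case Activity
  have "activity a > 0" "activity b > 0" and m: "(inv_act_coeff a + inv_act_coeff b) / 2 \<ge> 0"
    using ab by (auto simp: activity_def inv_act_coeff_def)
  note X = mult_nonneg_nonneg[OF m bernoulli_diff_sign[OF this(1,2), of "q - p"]]
  have e: "chem_pot a + p - chem_pot b - q = ln (activity a) - ln (activity b) - (q - p)"
    by (simp add: activity_def chem_pot_def)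
  show ?thesis
    using X by (simp only: Activity flux_Activity_eq e mult.assoc)
next
  case Bessemoulin_Chatard
  let ?d = "dr a b"
  have d: "?d \<ge> 1" using dr_ge_1[OF ab] .
  have "?d * (ln a - ln b - (q - p) / ?d) = ?d * (ln a - ln b) - (q - p)"
    using d by (simp add: right_diff_distrib[of "dr a b" "ln a - ln b"])
  then have "chem_pot a + p - chem_pot b - q = ?d * (ln a - ln b - (q - p) / ?d)"
    using chem_pot_diff_eq_dr[OF ab] by linarith
  moreover have "?d * ?d * ((bernoulli_fun ((q - p) / ?d) * a - bernoulli_fun (- ((q - p) / ?d)) * b) * (ln a - ln b - (q - p) / ?d)) \<ge> 0"
    by (rule mult_nonneg_nonneg[OF _ bernoulli_diff_sign]) (use ab d in auto)
  ultimately show ?thesis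
    using Bessemoulin_Chatard by (simp add: flux_BC_eq mult_ac)
qed


text \<open>The inverse of \<open>chem_pot\<close>. Its values lie strictly between 0 and 1, so a
  state given by \<open>y\<close> never leaves the domain of the fluxes.\<close>

definition logistic :: "real \<Rightarrow> real" where
  "logistic y = 1 / (1 + exp (- y))"

lemma logistic_pos: "0 < logistic y" and logistic_less_1: "logistic y < 1"
  using add_pos_pos[of 1 "exp (- y)"] by (auto simp: logistic_def)

lemma chem_pot_logistic [simp]: "chem_pot (logistic y) = y"
proof -
  have "1 + exp (- y) > 0" using add_pos_pos[of 1 "exp (- y)"] by simp
  then have "logistic y / (1 - logistic y) = exp y"
    by (simp add: logistic_def field_simps exp_minus)
  then show ?thesis by (simp add: chem_pot_def)
qed

lemma logistic_chem_pot: "0 < c \<Longrightarrow> c < 1 \<Longrightarrow> logistic (chem_pot c) = c"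
  by (metis chem_pot_logistic chem_pot_strict_mono less_irrefl linorder_less_linear logistic_less_1 logistic_pos)

lemma logistic_mono: "x \<le> y \<Longrightarrow> logistic x \<le> logistic y"
  using add_pos_pos[of 1 "exp (- y)"] by (auto simp: logistic_def intro!: frac_le)

lemma continuous_on_logistic [continuous_intros]:
  "continuous_on S f \<Longrightarrow> continuous_on S (\<lambda>x. logistic (f x))"
proof -
  have "1 + exp (- y) \<noteq> 0" for y :: real
    using add_pos_pos[of 1 "exp (- y)"] by simp
  then show "continuous_on S f \<Longrightarrow> continuous_on S (\<lambda>x. logistic (f x))"
    unfolding logistic_def by (intro continuous_intros) auto
qed

text \<open>Factoring out \<open>bernoulli_fun x\<close> leaves \<open>a - exp x * b\<close>, and
  the smallness of \<open>b\<close> costs at most half of \<delta>. This is the common source of the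
  lower bounds for flow into a nearly empty cell.\<close>

lemma bernoulli_diff_ge:
  assumes "x \<le> C" "\<delta> > 0" "\<delta> \<le> a" "exp C * b \<le> \<delta> / 2" "b \<ge> 0"
  shows "bernoulli_fun x * a - bernoulli_fun (- x) * b \<ge> bernoulli_fun C * (\<delta> / 2)"
proof -
  have "exp x * b \<le> exp C * b"
    using assms by (intro mult_right_mono) auto
  then have "\<delta> / 2 \<le> a - exp x * b"
    using assms by linarith
  then have "bernoulli_fun C * (\<delta> / 2) \<le> bernoulli_fun x * (a - exp x * b)"
    using assms bernoulli_fun_antimono[OF assms(1)] bernoulli_fun_pos[of x]
    by (intro mult_mono) auto
  then show ?thesis by (simp add: bernoulli_diff_eq)
qed

text \<open>The next two lemmas make the dissipation coercive at the two ends of \<open>(0,1)\<close>.\<close>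

lemma flux_into_empty:
  assumes \<delta>: "0 < \<delta>" "\<delta> < 1"
  shows "\<exists>\<kappa>>0. \<exists>b0>0. \<forall>a b p q. 0 < a \<and> a < 1 \<and> 0 < b \<and> b < 1 \<and> \<delta> \<le> a \<and> b \<le> b0 \<and> \<bar>q - p\<bar> \<le> C
    \<longrightarrow> \<kappa> \<le> flux k a b p q"
proof (cases k)
  case Centered
  show ?thesis
  proof (intro exI conjI allI impI)
    \<comment> \<open>The second witness pushes \<open>h(b)\<close> so far below
      \<open>h(\<delta>)\<close> that the potential drop is at least 1 in spite of the electric part
      \<open>C\<close>.\<close>
    show "0 < \<delta> / 2" "0 < logistic (chem_pot \<delta> - C - 1)"
      using \<delta> logistic_pos by auto
    fix a b p q
    assume H: "0 < a \<and> a < 1 \<and> 0 < b \<and> b < 1 \<and> \<delta> \<le> a \<and> b \<le> logistic (chem_pot \<delta> - C - 1) \<and> \<bar>q - p\<bar> \<le> C"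
    then have "chem_pot b \<le> chem_pot \<delta> - C - 1"
      using chem_pot_mono[of b "logistic (chem_pot \<delta> - C - 1)"] logistic_less_1 by auto
    moreover have "chem_pot \<delta> \<le> chem_pot a"
      using H \<delta> by (intro chem_pot_mono) auto
    ultimately have "1 \<le> chem_pot a + p - chem_pot b - q"
      using H by (simp add: abs_le_iff)
    then have "\<delta> / 2 * 1 \<le> (a + b) / 2 * (chem_pot a + p - chem_pot b - q)"
      using H \<delta> by (intro mult_mono) auto
    then show "\<delta> / 2 \<le> flux k a b p q"
      using Centered by (simp add: algebra_simps)
  qed
next
  case Sedan
  show ?thesis
  proof (intro exI conjI allI impI)
    \<comment> \<open>For \<open>b \<le> 1/2\<close> the excess potential of \<open>b\<close> is at
      most \<open>ln 2\<close>, hence at most 1: this is the shift from \<open>C\<close> to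
      \<open>C + 1\<close>.\<close>
    show "0 < bernoulli_fun (C + 1) * (\<delta> / 2)" "0 < min (1/2) (\<delta> / (2 * exp (C + 1)))"
      using \<delta> bernoulli_fun_pos by auto
    fix a b p q
    assume H: "0 < a \<and> a < 1 \<and> 0 < b \<and> b < 1 \<and> \<delta> \<le> a \<and> b \<le> min (1/2) (\<delta> / (2 * exp (C + 1))) \<and> \<bar>q - p\<bar> \<le> C"
    let ?x = "q + excess_pot b - p - excess_pot a"
    have "ln (1/2) \<le> ln (1 - b)"
      using H by simp
    moreover have "- ln (1/2) \<le> (1::real)"
      using ln_le_minus_one[of "2::real"] by (simp add: ln_div)
    moreover have "ln (1 - a) \<le> 0"
      using H by simp
    moreover have "q - p \<le> C"
      using H by linarith
    ultimately have "?x \<le> C + 1"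
      unfolding excess_pot_def by linarith
    moreover have "exp (C + 1) * b \<le> \<delta> / 2"
      using H by (simp add: field_simps)
    ultimately show "bernoulli_fun (C + 1) * (\<delta> / 2) \<le> flux k a b p q"
      using bernoulli_diff_ge[of ?x "C + 1" \<delta> a b] H \<delta> Sedan by (simp add: flux_Sedan_eq Let_def)
  qed
next
  case Activity
  show ?thesis
  proof (intro exI conjI allI impI)
    \<comment> \<open>Since \<open>a\<close> may be close to 1, the averaged coefficient is bounded
      below through \<open>b \<le> 1/2\<close> alone, which gives 1/4. The same bound yields
      \<open>activity b \<le> 2 * b\<close>, hence the 4 in the second witness.\<close>
    show "0 < 1 / 4 * (bernoulli_fun C * (\<delta> / 2))" "0 < min (1/2) (\<delta> / (4 * exp C))"
      using \<delta> bernoulli_fun_pos by auto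
    fix a b p q
    assume H: "0 < a \<and> a < 1 \<and> 0 < b \<and> b < 1 \<and> \<delta> \<le> a \<and> b \<le> min (1/2) (\<delta> / (4 * exp C)) \<and> \<bar>q - p\<bar> \<le> C"
    have "activity b \<le> 2 * b"
      using H by (simp add: activity_def field_simps)
    then have "exp C * activity b \<le> exp C * (2 * b)"
      by (intro mult_left_mono) auto
    also have "\<dots> \<le> \<delta> / 2"
      using H by (simp add: field_simps)
    finally have 1: "exp C * activity b \<le> \<delta> / 2" .
    have "a \<le> activity a" "0 \<le> activity b"
      using H by (simp_all add: activity_def field_simps)
    then have "bernoulli_fun C * (\<delta> / 2) \<le> bernoulli_fun (q - p) * activity a - bernoulli_fun (- (q - p)) * activity b"
      using 1 H \<delta> by (intro bernoulli_diff_ge) auto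
    then have "1 / 4 * (bernoulli_fun C * (\<delta> / 2)) \<le> (inv_act_coeff a + inv_act_coeff b) / 2 *
        (bernoulli_fun (q - p) * activity a - bernoulli_fun (- (q - p)) * activity b)"
      using H \<delta> bernoulli_fun_pos[of C] by (intro mult_mono) (auto simp: inv_act_coeff_def)
    then show "1 / 4 * (bernoulli_fun C * (\<delta> / 2)) \<le> flux k a b p q"
      unfolding Activity flux_Activity_eq .
  qed
next
  case Bessemoulin_Chatard
  show ?thesis
  proof (intro exI conjI allI impI)
    show "0 < bernoulli_fun C * (\<delta> / 2)" "0 < \<delta> / (2 * exp C)"
      using \<delta> bernoulli_fun_pos by auto
    fix a b p q
    assume H: "0 < a \<and> a < 1 \<and> 0 < b \<and> b < 1 \<and> \<delta> \<le> a \<and> b \<le> \<delta> / (2 * exp C) \<and> \<bar>q - p\<bar> \<le> C"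
    have d: "1 \<le> dr a b" using dr_ge_1 H by blast
    \<comment> \<open>As \<open>dr\<close> is at least 1, dividing by it only weakens the drift, and
      the bound \<open>C\<close> survives.\<close>
    have "\<bar>q - p\<bar> / dr a b \<le> \<bar>q - p\<bar>"
      using d by (simp add: divide_le_eq mult_le_cancel_left1)
    then have "(q - p) / dr a b \<le> C"
      using H d by (smt (verit) divide_right_mono)
    moreover have "exp C * b \<le> \<delta> / 2"
      using H by (simp add: field_simps)
    ultimately have "bernoulli_fun C * (\<delta> / 2) \<le> bernoulli_fun ((q - p) / dr a b) * a - bernoulli_fun (- ((q - p) / dr a b)) * b"
      using H \<delta> by (intro bernoulli_diff_ge) auto
    then have "1 * (bernoulli_fun C * (\<delta> / 2)) \<le> dr a b * (bernoulli_fun ((q - p) / dr a b) * a - bernoulli_fun (- ((q - p) / dr a b)) * b)"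
      using d \<delta> bernoulli_fun_pos[of C] by (intro mult_mono) auto
    then show "bernoulli_fun C * (\<delta> / 2) \<le> flux k a b p q"
      unfolding Bessemoulin_Chatard flux_BC_eq by simp
  qed
qed

lemma flux_from_full:
  assumes \<delta>: "0 < \<delta>" "\<delta> < 1" and C: "0 \<le> C"
  shows "\<exists>\<kappa>>0. \<exists>b0<1. \<forall>a b p q. 0 < a \<and> a < 1 \<and> 0 < b \<and> b < 1 \<and> a \<le> 1 - \<delta> \<and> b0 \<le> b \<and> \<bar>q - p\<bar> \<le> C
    \<longrightarrow> \<kappa> \<le> - flux k a b p q"
proof (cases k)
  case Centered
  let ?l = "logistic (chem_pot (1 - \<delta>) + C + 1)"
  show ?thesis
  proof (intro exI conjI allI impI)
    show "0 < (1 / 4 :: real)" "max (1 / 2) ?l < 1"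
      using logistic_less_1 by auto
    fix a b p q
    assume H: "0 < a \<and> a < 1 \<and> 0 < b \<and> b < 1 \<and> a \<le> 1 - \<delta> \<and> max (1 / 2) ?l \<le> b \<and> \<bar>q - p\<bar> \<le> C"
    then have "chem_pot (1 - \<delta>) + C + 1 \<le> chem_pot b"
      using chem_pot_mono[of ?l b] logistic_pos by auto
    moreover have "chem_pot a \<le> chem_pot (1 - \<delta>)"
      using H \<delta> by (intro chem_pot_mono) auto
    ultimately have "1 \<le> chem_pot b + q - chem_pot a - p"
      using H by (simp add: abs_le_iff)
    then have "1 / 4 * 1 \<le> (a + b) / 2 * (chem_pot b + q - chem_pot a - p)"
      using H \<delta> by (intro mult_mono) auto
    then show "1 / 4 \<le> - flux k a b p q"
      using Centered by (simp add: algebra_simps)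
  qed
next
  case Sedan
  \<comment> \<open>Chosen so that the excess potential of \<open>b\<close> beats that of
    \<open>a\<close> and the electric part by \<open>ln 4\<close>. Then
    \<open>exp (- ?x) * a \<le> 1/4\<close>, while \<open>b\<close> is at least 1/2.\<close>
  let ?b0 = "1 - \<delta> * exp (- C) / 4"
  show ?thesis
  proof (intro exI conjI allI impI)
    show "0 < (1 / 4 :: real)" "?b0 < 1"
      using \<delta> by auto
    fix a b p q
    assume H: "0 < a \<and> a < 1 \<and> 0 < b \<and> b < 1 \<and> a \<le> 1 - \<delta> \<and> ?b0 \<le> b \<and> \<bar>q - p\<bar> \<le> C"
    let ?x = "q + excess_pot b - p - excess_pot a"
    have "ln (1 - b) \<le> ln (\<delta> * exp (- C) / 4)"
      using H by simp
    also have "\<dots> = ln \<delta> - C - ln 4"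
      using \<delta> by (simp add: ln_div ln_mult)
    finally have "ln (1 - b) \<le> ln \<delta> - C - ln 4" .
    moreover have "ln \<delta> \<le> ln (1 - a)"
      using H \<delta> by simp
    ultimately have x: "ln 4 \<le> ?x"
      using H by (simp add: excess_pot_def abs_le_iff)
    then have "exp (- ?x) \<le> exp (- ln 4)"
      by simp
    then have "exp (- ?x) \<le> 1 / 4"
      by (simp add: exp_minus)
    then have "exp (- ?x) * a \<le> 1 / 4 * 1"
      using H by (intro mult_mono) auto
    moreover have "\<delta> * exp (- C) \<le> 1 * 1"
      using \<delta> C by (intro mult_mono) auto
    then have "1 / 2 \<le> b"
      using H by linarith
    ultimately have 1: "1 / 4 \<le> b - exp (- ?x) * a"
      by linarith
    have "ln 4 \<ge> (0::real)" by simp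
    then have "- ?x \<le> 0" using x by linarith
    then have "1 \<le> bernoulli_fun (- ?x)"
      using bernoulli_fun_antimono[of "- ?x" 0] by (metis bernoulli_fun_def)
    then have "1 * (1 / 4) \<le> bernoulli_fun (- ?x) * (b - exp (- ?x) * a)"
      using 1 by (intro mult_mono) auto
    then show "1 / 4 \<le> - flux k a b p q"
      unfolding Sedan flux_Sedan_eq Let_def bernoulli_diff_eq' by simp
  qed
next
  case Activity
  \<comment> \<open>This makes \<open>activity b\<close> at least
    \<open>exp C / \<delta> + 1\<close>, one more than the largest possible
    \<open>exp (- (q - p)) * activity a\<close>. The coefficient \<delta>/2 comes from
    \<open>a\<close>, because that of \<open>b\<close> degenerates.\<close>
  let ?d0 = "1 / (exp C / \<delta> + 2)"
  have e: "exp C / \<delta> > 0" using \<delta> by simp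
  show ?thesis
  proof (intro exI conjI allI impI)
    show "0 < \<delta> / 2 * bernoulli_fun C" "1 - ?d0 < 1"
      using \<delta> bernoulli_fun_pos e by (auto intro!: add_pos_pos)
    fix a b p q
    assume H: "0 < a \<and> a < 1 \<and> 0 < b \<and> b < 1 \<and> a \<le> 1 - \<delta> \<and> 1 - ?d0 \<le> b \<and> \<bar>q - p\<bar> \<le> C"
    have "1 - b \<le> ?d0" using H by linarith
    then have "(1 - b) * (exp C / \<delta> + 2) \<le> 1"
      using e by (simp add: pos_le_divide_eq)
    then have "exp C / \<delta> + 2 \<le> 1 / (1 - b)"
      using H by (simp add: pos_le_divide_eq mult.commute)
    moreover have "activity b = 1 / (1 - b) - 1"
      using H by (simp add: activity_def field_simps)
    moreover have "activity a \<le> 1 / \<delta>"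
      unfolding activity_def using H \<delta> by (intro frac_le) auto
    then have "exp (- (q - p)) * activity a \<le> exp C * (1 / \<delta>)"
      using H by (intro mult_mono) (auto simp: activity_def)
    ultimately have 1: "1 \<le> activity b - exp (- (q - p)) * activity a"
      by simp
    have "bernoulli_fun C \<le> bernoulli_fun (- (q - p))"
      using H by (intro bernoulli_fun_antimono) auto
    then have "bernoulli_fun C * 1 \<le> bernoulli_fun (- (q - p)) * (activity b - exp (- (q - p)) * activity a)"
      using 1 bernoulli_fun_pos by (intro mult_mono) (auto intro: less_imp_le)
    then have "\<delta> / 2 * bernoulli_fun C \<le> (inv_act_coeff a + inv_act_coeff b) / 2 *
        (bernoulli_fun (- (q - p)) * (activity b - exp (- (q - p)) * activity a))"
      using H \<delta> bernoulli_fun_pos[of C] by (intro mult_mono) (auto simp: inv_act_coeff_def)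
    then show "\<delta> / 2 * bernoulli_fun C \<le> - flux k a b p q"
      unfolding Activity flux_Activity_eq bernoulli_diff_eq' by simp
  qed
next
  case Bessemoulin_Chatard
  \<comment> \<open>A drift below \<eta> can raise \<open>a \<le> 1 - \<delta>\<close> to at most
    \<open>1 - \<delta>/2\<close>, which stays \<delta>/4 below \<open>b\<close>. With
    \<open>D = C / \<eta>\<close>, the drift is that weak as soon as
    \<open>dr a b \<ge> D\<close>.\<close>
  define \<eta> where "\<eta> = ln ((1 - \<delta> / 2) / (1 - \<delta>))"
  have "1 < (1 - \<delta> / 2) / (1 - \<delta>)"
    using \<delta> by (simp add: field_simps)
  then have \<eta>: "\<eta> > 0" and exp_\<eta>: "exp \<eta> = (1 - \<delta> / 2) / (1 - \<delta>)"
    unfolding \<eta>_def by auto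
  define D where "D = C / \<eta>"
  have D: "D \<ge> 0" using C \<eta> by (simp add: D_def)
  let ?l = "logistic (chem_pot (1 - \<delta>) + D * (C + ln 4))"
  let ?b0 = "max (max (1 / 2) (1 - \<delta> / 4)) ?l"
  show ?thesis
  proof (intro exI conjI allI impI)
    show "0 < bernoulli_fun C * (\<delta> / 4)" "?b0 < 1"
      using \<delta> bernoulli_fun_pos logistic_less_1 by auto
    fix a b p q
    assume H: "0 < a \<and> a < 1 \<and> 0 < b \<and> b < 1 \<and> a \<le> 1 - \<delta> \<and> ?b0 \<le> b \<and> \<bar>q - p\<bar> \<le> C"
    let ?x = "(q - p) / dr a b"
    have d: "1 \<le> dr a b" using dr_ge_1 H by blast
    have "- ?x = (p - q) / dr a b"
      by (metis minus_diff_eq minus_divide_left)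
    also have "\<dots> \<le> C / dr a b"
      using H d by (intro divide_right_mono) auto
    finally have xd: "- ?x \<le> C / dr a b" .
    have "C / dr a b \<le> C"
      using d C by (simp add: divide_le_eq mult_le_cancel_left1)
    with xd have xC: "- ?x \<le> C" by linarith
    have 1: "\<delta> / 4 \<le> b - exp (- ?x) * a"
    \<comment> \<open>If \<open>a\<close> is tiny, the crude bound \<open>exp C\<close> for the
      exponential suffices. Otherwise \<open>ln b - ln a\<close> is at most \<open>C + ln 4\<close>,
      so the large difference of \<open>h\<close> enforced by \<open>?l\<close> can come only from a
      large \<open>dr\<close>.\<close>
    proof (cases "a \<le> exp (- C) / 4")
      case True
      then have "exp (- ?x) * a \<le> exp C * (exp (- C) / 4)"
        using xC H by (intro mult_mono) auto
      then have "exp (- ?x) * a \<le> 1 / 4"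
        by (simp add: exp_minus)
      moreover have "1 / 2 \<le> b" using H by simp
      ultimately show ?thesis
        using \<delta> by linarith
    next
      case False
      have "ln (exp (- C) / 4) \<le> ln a"
        using False by (intro ln_mono) auto
      moreover have "ln b \<le> 0" using H by simp
      ultimately have l: "ln b - ln a \<le> C + ln 4"
        by (simp add: ln_div)
      have "a < b" using H \<delta> by auto
      then have lpos: "0 < ln b - ln a" using H by simp
      have "chem_pot (1 - \<delta>) + D * (C + ln 4) \<le> chem_pot b"
        using chem_pot_mono[of ?l b] logistic_pos H by auto
      moreover have "chem_pot a \<le> chem_pot (1 - \<delta>)"
        using H \<delta> by (intro chem_pot_mono) auto
      moreover have "D * (ln b - ln a) \<le> D * (C + ln 4)"
        using D l by (intro mult_left_mono)
      ultimately have "D * (ln b - ln a) \<le> chem_pot b - chem_pot a"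
        by linarith
      also have "\<dots> = dr a b * (ln b - ln a)"
        using chem_pot_diff_eq_dr[of b a] H by (simp add: dr_commute)
      finally have "D \<le> dr a b"
        using lpos by simp
      then have "C / dr a b \<le> \<eta>"
        using \<eta> d by (simp add: D_def field_simps)
      then have "- ?x \<le> \<eta>" using xd by linarith
      then have "exp (- ?x) * a \<le> exp \<eta> * (1 - \<delta>)"
        using H by (intro mult_mono) auto
      also have "\<dots> = 1 - \<delta> / 2"
        using \<delta> by (simp add: exp_\<eta>)
      finally show ?thesis
        using H by simp
    qed
    have "bernoulli_fun C * (\<delta> / 4) \<le> bernoulli_fun (- ?x) * (b - exp (- ?x) * a)"
      using bernoulli_fun_antimono[OF xC] 1 \<delta> bernoulli_fun_pos by (intro mult_mono) (auto intro: less_imp_le)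
    then have "1 * (bernoulli_fun C * (\<delta> / 4)) \<le> dr a b * (bernoulli_fun (- ?x) * (b - exp (- ?x) * a))"
      by (rule mult_mono[OF d]) (use d \<delta> bernoulli_fun_pos[of C] in auto)
    then show "bernoulli_fun C * (\<delta> / 4) \<le> - flux k a b p q"
      unfolding Bessemoulin_Chatard flux_BC_eq bernoulli_diff_eq' by simp
  qed
qed


text \<open>A pointwise Gibbs inequality, from \<open>ln t \<le> t - 1\<close> at
  \<open>t = y / x\<close>. Including \<open>x = 0\<close> lets the entropy estimates accept old
  concentrations equal to 0 or 1.\<close>

lemma mult_ln_div_ge:
  fixes x y :: real
  assumes "0 \<le> x" "0 < y"
  shows "x - y \<le> x * (ln x - ln y)"
proof (cases "x = 0")
  case False
  then have x: "x > 0" using assms by simp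
  have "ln (y / x) \<le> y / x - 1"
    using x assms by (intro ln_le_minus_one) auto
  then have "x * ln (y / x) \<le> x * (y / x - 1)"
    using x by (intro mult_left_mono) auto
  then show ?thesis
    using x assms by (simp add: ln_div algebra_simps)
qed (use assms in auto)

lemma mixing_entropy_eq: "mixing_entropy c = c * ln c + (1 - c) * ln (1 - c)"
  by (auto simp: mixing_entropy_def)

text \<open>The right side minus the left side is the relative entropy of \<open>(d, 1 - d)\<close>
  with respect to \<open>(c, 1 - c)\<close>.\<close>

lemma mixing_entropy_convex:
  assumes "0 < c" "c < 1" "0 \<le> d" "d \<le> 1"
  shows "mixing_entropy c - mixing_entropy d \<le> (c - d) * chem_pot c"
  using mult_ln_div_ge[of d c] mult_ln_div_ge[of "1 - d" "1 - c"] assms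
  by (simp add: mixing_entropy_eq chem_pot_eq algebra_simps)

lemma mixing_entropy_le_0:
  assumes "0 \<le> c" "c \<le> 1"
  shows "mixing_entropy c \<le> 0"
proof -
  have "x * ln x \<le> 0" if "0 \<le> x" "x \<le> 1" for x :: real
    using that by (cases "x = 0") (auto simp: mult_le_0_iff)
  from this[of c] this[of "1 - c"] show ?thesis
    using assms by (simp add: mixing_entropy_eq)
qed

lemma mixing_entropy_ge:
  assumes "0 \<le> c" "c \<le> 1"
  shows "- 1 \<le> mixing_entropy c"
  using mult_ln_div_ge[of c 1] mult_ln_div_ge[of "1 - c" 1] assms
  by (simp add: mixing_entropy_eq)

text \<open>The discrete time derivative tested with \<open>h(c)\<close> is bounded below uniformly,
  even as \<open>c\<close> approaches 0 or 1. So in a bounded sum of such terms each single term is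
  bounded above.\<close>

lemma entropy_test_ge:
  assumes "0 < c" "c < 1" "0 \<le> d" "d \<le> 1"
  shows "- 1 \<le> (c - d) * chem_pot c"
  using mixing_entropy_convex[OF assms] mixing_entropy_ge[of c] mixing_entropy_le_0[of d] assms
  by simp

section \<open>Drift-diffusion on a finite network\<close>

lemma continuous_on_flux:
  assumes "continuous_on S f" "continuous_on S g" "continuous_on S u" "continuous_on S v"
    and "\<And>x. x \<in> S \<Longrightarrow> 0 < f x \<and> f x < 1 \<and> 0 < g x \<and> g x < 1"
  shows "continuous_on S (\<lambda>x. flux k (f x) (g x) (u x) (v x))"
  using assms unfolding continuous_on_def by (intro ballI tendsto_flux) auto

text \<open>Discrete integration by parts. Every edge is counted in both directions, hence the
  factor 1/2.\<close>

lemma sum_antisym: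
  fixes A :: "'v \<Rightarrow> 'v \<Rightarrow> real"
  assumes "\<And>K L. K \<in> V \<Longrightarrow> L \<in> V \<Longrightarrow> A K L = - A L K"
  shows "(\<Sum>K\<in>V. (\<Sum>L\<in>V. A K L) * v K) = 1 / 2 * (\<Sum>K\<in>V. \<Sum>L\<in>V. A K L * (v K - v L))"
proof -
  have "(\<Sum>K\<in>V. \<Sum>L\<in>V. A K L * v L) = (\<Sum>L\<in>V. \<Sum>K\<in>V. A K L * v L)"
    by (rule sum.swap)
  also have "\<dots> = (\<Sum>L\<in>V. \<Sum>K\<in>V. - (A L K * v L))"
    using assms by (intro sum.cong refl) (metis mult_minus_left)
  also have "\<dots> = - (\<Sum>K\<in>V. \<Sum>L\<in>V. A K L * v K)"
    by (simp add: sum_negf)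
  finally show ?thesis
    by (simp add: right_diff_distrib sum_subtractf sum_distrib_right)
qed

text \<open>The mesh reduced to a weighted graph: \<open>w\<close> stands for the transmissibilities
  of interior faces, \<open>b K\<close> for the total transmissibility of the Dirichlet faces of
  \<open>K\<close>, and \<open>m\<close> for the volumes. Connectedness is stated by cuts, since
  cuts are what the geometry of the mesh delivers.\<close>

locale network =
  fixes V :: "'v set" and w :: "'v \<Rightarrow> 'v \<Rightarrow> real" and b m :: "'v \<Rightarrow> real"
  assumes finite_V: "finite V"
    and w_sym: "\<And>K L. K \<in> V \<Longrightarrow> L \<in> V \<Longrightarrow> w K L = w L K"
    and w_nonneg: "\<And>K L. K \<in> V \<Longrightarrow> L \<in> V \<Longrightarrow> w K L \<ge> 0"
    and b_nonneg: "\<And>K. K \<in> V \<Longrightarrow> b K \<ge> 0"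
    and m_pos: "\<And>K. K \<in> V \<Longrightarrow> m K > 0"
    and connected_V: "\<And>A. A \<subseteq> V \<Longrightarrow> A \<noteq> {} \<Longrightarrow> A \<noteq> V \<Longrightarrow> \<exists>K\<in>A. \<exists>L\<in>V - A. w K L > 0"
    and dirichlet: "\<exists>K\<in>V. b K > 0"
begin

text \<open>Minus the discrete Laplacian with zero Dirichlet data; actual boundary data are moved
  into the source \<open>s\<close>.\<close>

definition lap :: "('v \<Rightarrow> real) \<Rightarrow> 'v \<Rightarrow> real" where
  "lap u K = (\<Sum>L\<in>V. w K L * (u K - u L)) + b K * u K"

definition form :: "('v \<Rightarrow> real) \<Rightarrow> ('v \<Rightarrow> real) \<Rightarrow> real" where
  "form u v = 1 / 2 * (\<Sum>K\<in>V. \<Sum>L\<in>V. w K L * ((u K - u L) * (v K - v L))) + (\<Sum>K\<in>V. b K * (u K * v K))"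

definition outflow :: "flux_kind \<Rightarrow> ('v \<Rightarrow> real) \<Rightarrow> ('v \<Rightarrow> real) \<Rightarrow> 'v \<Rightarrow> real" where
  "outflow k c u K = (\<Sum>L\<in>V. w K L * flux k (c K) (c L) (u K) (u L))"

section \<open>Quadratic form and tested fluxes\<close>

lemma lap_form: "(\<Sum>K\<in>V. lap u K * v K) = form u v"
proof -
  have "(\<Sum>K\<in>V. (\<Sum>L\<in>V. w K L * (u K - u L)) * v K)
      = 1 / 2 * (\<Sum>K\<in>V. \<Sum>L\<in>V. w K L * (u K - u L) * (v K - v L))"
    using w_sym by (intro sum_antisym) (metis minus_diff_eq mult_minus_right)
  then show ?thesis
    by (simp add: lap_def form_def distrib_right sum.distrib mult.assoc)
qed

lemma form_commute: "form u v = form v u"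
  by (simp add: form_def mult.commute)

lemma form_nonneg: "form u u \<ge> 0"
  unfolding form_def using w_nonneg b_nonneg
  by (intro add_nonneg_nonneg mult_nonneg_nonneg[of "1 / 2"] sum_nonneg)
    (auto intro: mult_nonneg_nonneg[OF _ zero_le_square])

lemma lap_diff: "lap (\<lambda>K. u K - v K) K = lap u K - lap v K"
proof -
  have "(\<Sum>L\<in>V. w K L * ((u K - v K) - (u L - v L)))
      = (\<Sum>L\<in>V. w K L * (u K - u L) - w K L * (v K - v L))"
    by (intro sum.cong) (auto simp: algebra_simps)
  then show ?thesis
    by (simp add: lap_def sum_subtractf right_diff_distrib[of "b K"])
qed

lemma form_diff: "form (\<lambda>K. u K - v K) x = form u x - form v x"
  unfolding lap_form[symmetric] lap_diff by (simp add: left_diff_distrib sum_subtractf)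

lemma outflow_test:
  "(\<Sum>K\<in>V. outflow k c u K * v K)
     = 1 / 2 * (\<Sum>K\<in>V. \<Sum>L\<in>V. w K L * flux k (c K) (c L) (u K) (u L) * (v K - v L))"
  unfolding outflow_def
  by (intro sum_antisym) (metis flux_antisym mult_minus_right w_sym)

lemma sum_outflow: "(\<Sum>K\<in>V. outflow k c u K) = 0"
  using outflow_test[of k c u "\<lambda>_. 1"] by simp

text \<open>Induction over a connected graph: the vertices satisfying \<open>P\<close> form a set
  that no positive edge leaves.\<close>

lemma propagate:
  assumes "K0 \<in> V" "P K0" and "\<And>K L. K \<in> V \<Longrightarrow> L \<in> V \<Longrightarrow> w K L > 0 \<Longrightarrow> P K \<Longrightarrow> P L" and "K \<in> V"
  shows "P K"
proof (rule ccontr)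
  assume "\<not> P K"
  then have "\<exists>K\<in>{K \<in> V. P K}. \<exists>L\<in>V - {K \<in> V. P K}. w K L > 0"
    using assms(1,2,4) by (intro connected_V) auto
  then show False using assms(3) by blast
qed

lemma flux_dissipation_nonneg:
  assumes "K \<in> V" "L \<in> V" "\<And>K. K \<in> V \<Longrightarrow> 0 < c K \<and> c K < 1"
  shows "w K L * flux k (c K) (c L) (u K) (u L) * (chem_pot (c K) + u K - (chem_pot (c L) + u L)) \<ge> 0"
proof -
  have "flux k (c K) (c L) (u K) (u L) * (chem_pot (c K) + u K - chem_pot (c L) - u L) \<ge> 0"
    using assms by (intro flux_dissipative) auto
  then show ?thesis
    using w_nonneg[of K L] assms by (simp add: mult.assoc diff_diff_eq add.commute mult_nonneg_nonneg)
qed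

lemma energy_decay:
  assumes dt: "\<Delta>t > 0"
    and c: "\<And>K. K \<in> V \<Longrightarrow> 0 < c K \<and> c K < 1" and d: "\<And>K. K \<in> V \<Longrightarrow> 0 \<le> d K \<and> d K \<le> 1"
    and u: "\<And>K. K \<in> V \<Longrightarrow> lap u K = m K * c K + s K"
    and v: "\<And>K. K \<in> V \<Longrightarrow> lap v K = m K * d K + s K"
    and cons: "\<And>K. K \<in> V \<Longrightarrow> m K * ((c K - d K) / \<Delta>t) + outflow k c u K = 0"
  shows "(\<Sum>K\<in>V. m K * mixing_entropy (c K)) + 1 / 2 * form u u
     \<le> (\<Sum>K\<in>V. m K * mixing_entropy (d K)) + 1 / 2 * form v v"
proof -
  let ?\<mu> = "\<lambda>K. chem_pot (c K) + u K"
  define e where "e = (\<lambda>K. u K - v K)"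
  have "(\<Sum>K\<in>V. m K * mixing_entropy (c K)) - (\<Sum>K\<in>V. m K * mixing_entropy (d K))
      = (\<Sum>K\<in>V. m K * (mixing_entropy (c K) - mixing_entropy (d K)))"
    by (simp add: right_diff_distrib sum_subtractf)
  also have "\<dots> \<le> (\<Sum>K\<in>V. m K * ((c K - d K) * chem_pot (c K)))"
    using c d m_pos by (intro sum_mono mult_left_mono mixing_entropy_convex) (auto intro: less_imp_le)
  finally have 1: "(\<Sum>K\<in>V. m K * mixing_entropy (c K)) - (\<Sum>K\<in>V. m K * mixing_entropy (d K))
      \<le> (\<Sum>K\<in>V. m K * ((c K - d K) * chem_pot (c K)))" .
  \<comment> \<open>Dropping \<open>form e e\<close> is the numerical dissipation of the implicit
    step. Subtracting the two Poisson equations removes the common source, so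
    \<open>form e u\<close> becomes the mass increment tested with \<open>u\<close>, ready to be
    combined with the entropy part.\<close>
  have "form u u - form v v = 2 * form e u - form e e"
    unfolding e_def form_diff
    by (simp add: form_commute[of _ "\<lambda>K. u K - v K"] form_diff form_commute[of v u])
  moreover have "form e e \<ge> 0" by (rule form_nonneg)
  moreover have "form e u = (\<Sum>K\<in>V. m K * ((c K - d K) * u K))"
    unfolding lap_form[symmetric] e_def lap_diff using u v
    by (intro sum.cong) (auto simp: algebra_simps)
  ultimately have 2: "1 / 2 * form u u - 1 / 2 * form v v \<le> (\<Sum>K\<in>V. m K * ((c K - d K) * u K))"
    by linarith
  have eq: "m K * ((c K - d K) * chem_pot (c K)) + m K * ((c K - d K) * u K) = - (\<Delta>t * (outflow k c u K * ?\<mu> K))"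
    if "K \<in> V" for K
  proof -
    have "m K * (c K - d K) = - (\<Delta>t * outflow k c u K)"
      using cons[OF that] dt by (simp add: field_simps)
    then have "m K * (c K - d K) * ?\<mu> K = - (\<Delta>t * outflow k c u K) * ?\<mu> K"
      by simp
    then show ?thesis by (simp add: algebra_simps)
  qed
  have "(\<Sum>K\<in>V. m K * ((c K - d K) * chem_pot (c K))) + (\<Sum>K\<in>V. m K * ((c K - d K) * u K))
      = (\<Sum>K\<in>V. - (\<Delta>t * (outflow k c u K * ?\<mu> K)))"
    unfolding sum.distrib[symmetric] by (rule sum.cong[OF refl eq])
  also have "\<dots> = - (\<Delta>t * (\<Sum>K\<in>V. outflow k c u K * ?\<mu> K))"
    by (simp add: sum_negf sum_distrib_left)
  also have "\<dots> \<le> 0"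
  proof -
    have "0 \<le> (\<Sum>K\<in>V. \<Sum>L\<in>V. w K L * flux k (c K) (c L) (u K) (u L) * (?\<mu> K - ?\<mu> L))"
      by (intro sum_nonneg flux_dissipation_nonneg c)
    then show ?thesis
      unfolding outflow_test using dt by simp
  qed
  finally show ?thesis using 1 2 by linarith
qed

text \<open>A discrete Poincare inequality. At a Dirichlet vertex the form controls the value
  directly, and along an edge of weight \<open>w K L\<close> the constant \<open>C\<close>
  deteriorates to \<open>2 * C + 4 / w K L\<close>.\<close>

lemma poincare: "\<exists>C>0. \<forall>u. \<forall>K\<in>V. (u K)\<^sup>2 \<le> C * form u u"
proof -
  let ?P = "\<lambda>K. \<exists>C>0. \<forall>u. (u K)\<^sup>2 \<le> C * form u u"
  have nn: "(\<Sum>K\<in>V. \<Sum>L\<in>V. w K L * ((u K - u L) * (u K - u L))) \<ge> 0" "(\<Sum>K\<in>V. b K * (u K * u K)) \<ge> 0" for u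
    using w_nonneg b_nonneg by (auto intro!: sum_nonneg)
  obtain K0 where K0: "K0 \<in> V" "b K0 > 0" using dirichlet by blast
  have "?P K0"
  proof (intro exI conjI allI)
    show "1 / b K0 > 0" using K0 by simp
    fix u
    have "b K0 * (u K0 * u K0) \<le> (\<Sum>K\<in>V. b K * (u K * u K))"
      using K0 finite_V b_nonneg by (intro member_le_sum) auto
    then have "b K0 * (u K0 * u K0) \<le> form u u"
      using nn(1)[of u] by (simp add: form_def)
    then show "(u K0)\<^sup>2 \<le> 1 / b K0 * form u u"
      using K0 by (simp add: field_simps power2_eq_square)
  qed
  moreover have "?P L" if KL: "K \<in> V" "L \<in> V" "w K L > 0" "?P K" for K L
  proof -
    from KL obtain C where C: "C > 0" "\<And>u. (u K)\<^sup>2 \<le> C * form u u" by blast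
    show ?thesis
    proof (intro exI conjI allI)
      show "2 * C + 4 / w K L > 0" using C KL by (simp add: add_pos_pos)
      fix u
      have "w K L * ((u K - u L) * (u K - u L)) \<le> (\<Sum>L\<in>V. w K L * ((u K - u L) * (u K - u L)))"
        using KL finite_V w_nonneg
        by (intro member_le_sum[of L V "\<lambda>L. w K L * ((u K - u L) * (u K - u L))"]) auto
      also have "\<dots> \<le> (\<Sum>K\<in>V. \<Sum>L\<in>V. w K L * ((u K - u L) * (u K - u L)))"
        using KL finite_V w_nonneg
        by (intro member_le_sum[of K V "\<lambda>K. \<Sum>L\<in>V. w K L * ((u K - u L) * (u K - u L))"]) (auto intro!: sum_nonneg)
      also have "\<dots> \<le> 2 * form u u"
        using nn(2)[of u] by (simp add: form_def)
      finally have "(u K - u L)\<^sup>2 \<le> 2 * form u u / w K L"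
        using KL by (simp add: field_simps power2_eq_square)
      moreover have "(u L)\<^sup>2 \<le> 2 * (u K)\<^sup>2 + 2 * (u K - u L)\<^sup>2"
        using zero_le_power2[of "2 * u K - u L"] by (simp add: power2_eq_square algebra_simps)
      ultimately show "(u L)\<^sup>2 \<le> (2 * C + 4 / w K L) * form u u"
        using C(2)[of u] by (simp add: algebra_simps)
    qed
  qed
  ultimately have "\<forall>K\<in>V. ?P K"
    using propagate[OF K0(1), of ?P] by blast
  then obtain C where C: "\<And>K. K \<in> V \<Longrightarrow> C K > 0 \<and> (\<forall>u. (u K)\<^sup>2 \<le> C K * form u u)"
    by metis
  have le: "C K \<le> sum C V" if "K \<in> V" for K
    using C finite_V that by (intro member_le_sum) (auto intro: less_imp_le)
  have "sum C V > 0"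
    using le[OF K0(1)] C[OF K0(1)] by linarith
  moreover have "(u K)\<^sup>2 \<le> sum C V * form u u" if "K \<in> V" for u K
    using mult_right_mono[OF le[OF that] form_nonneg[of u]] C[OF that] by (meson order_trans)
  ultimately show ?thesis by blast
qed

text \<open>The hypothesis on \<open>u\<close> is a sign condition and not the Poisson equation, so
  that it also covers solutions of the variational inequality. At a vertex where
  \<open>\<bar>u\<bar>\<close> is largest, the form bounds its square while the source bounds the
  form linearly.\<close>

lemma potential_bound:
  "\<exists>C\<ge>0. \<forall>c u. (\<forall>K\<in>V. 0 \<le> c K \<and> c K \<le> 1) \<longrightarrow> (\<forall>K\<in>V. (lap u K - m K * c K - s K) * u K \<le> 0)
     \<longrightarrow> (\<forall>K\<in>V. \<bar>u K\<bar> \<le> C)"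
proof -
  obtain C where C: "C > 0" "\<And>u K. K \<in> V \<Longrightarrow> (u K)\<^sup>2 \<le> C * form u u"
    using poincare by blast
  define S where "S = (\<Sum>K\<in>V. m K + \<bar>s K\<bar>)"
  have S: "S \<ge> 0" unfolding S_def
    by (intro sum_nonneg add_nonneg_nonneg abs_ge_zero less_imp_le[OF m_pos])
  have V: "V \<noteq> {}" using dirichlet by blast
  show ?thesis
  proof (intro exI conjI allI impI ballI)
    show "0 \<le> C * S" using C S by simp
    fix c u K
    assume c: "\<forall>K\<in>V. 0 \<le> c K \<and> c K \<le> 1" and lap: "\<forall>K\<in>V. (lap u K - m K * c K - s K) * u K \<le> 0"
      and K: "K \<in> V"
    have "Max ((\<lambda>K. \<bar>u K\<bar>) ` V) \<in> (\<lambda>K. \<bar>u K\<bar>) ` V"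
      using finite_V V by (intro Max_in) auto
    then obtain K1 where "K1 \<in> V" and "\<bar>u K1\<bar> = Max ((\<lambda>K. \<bar>u K\<bar>) ` V)"
      by (auto simp: image_iff)
    then have K1: "K1 \<in> V" "\<And>K. K \<in> V \<Longrightarrow> \<bar>u K\<bar> \<le> \<bar>u K1\<bar>"
      using finite_V by simp_all
    have "form u u = (\<Sum>K\<in>V. lap u K * u K)"
      by (simp add: lap_form)
    also have "\<dots> \<le> (\<Sum>K\<in>V. (m K * c K + s K) * u K)"
      using lap by (intro sum_mono) (auto simp: algebra_simps)
    also have "\<dots> \<le> (\<Sum>K\<in>V. (m K + \<bar>s K\<bar>) * \<bar>u K1\<bar>)"
    proof (intro sum_mono)
      fix L assume L: "L \<in> V"
      have "(m L * c L + s L) * u L \<le> \<bar>m L * c L + s L\<bar> * \<bar>u L\<bar>"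
        by (simp flip: abs_mult)
      also have "\<dots> \<le> (m L + \<bar>s L\<bar>) * \<bar>u K1\<bar>"
      proof (intro mult_mono)
        have "\<bar>m L * c L\<bar> \<le> m L"
          using c L m_pos[OF L] by (simp add: abs_mult mult_le_cancel_left2)
        then show "\<bar>m L * c L + s L\<bar> \<le> m L + \<bar>s L\<bar>" by linarith
      qed (use K1 L m_pos[OF L] in auto)
      finally show "(m L * c L + s L) * u L \<le> (m L + \<bar>s L\<bar>) * \<bar>u K1\<bar>" .
    qed
    also have "\<dots> = S * \<bar>u K1\<bar>"
      by (simp add: S_def sum_distrib_right)
    finally have "C * form u u \<le> C * (S * \<bar>u K1\<bar>)"
      using C by simp
    then have "\<bar>u K1\<bar> * \<bar>u K1\<bar> \<le> C * S * \<bar>u K1\<bar>"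
      using C(2)[OF K1(1), of u] by (simp add: power2_eq_square flip: abs_mult)
    then have "\<bar>u K1\<bar> \<le> C * S"
      using C S by (cases "u K1 = 0") (simp, metis mult_le_cancel_right_pos zero_less_abs_iff)
    then show "\<bar>u K\<bar> \<le> C * S"
      using K1(2)[OF K] by linarith
  qed
qed


text \<open>What is kept of a state from the energy estimate: bounds for the potential, for the
  entropy term of each cell and for the dissipation of each edge. Neither the scheme nor the cube
  occurs here, so the consequences are available before the cube is fixed.\<close>

definition bounded_states :: "flux_kind \<Rightarrow> real \<Rightarrow> real \<Rightarrow> ('v \<Rightarrow> real) \<Rightarrow> (('v \<Rightarrow> real) \<times> ('v \<Rightarrow> real)) set" where
  "bounded_states k C W d = {(y, u). (\<forall>K\<in>V. \<bar>u K\<bar> \<le> C) \<and>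
     (\<forall>K\<in>V. m K * ((logistic (y K) - d K) * y K) \<le> W) \<and>
     (\<forall>K\<in>V. \<forall>L\<in>V. w K L * flux k (logistic (y K)) (logistic (y L)) (u K) (u L)
        * (y K + u K - (y L + u L)) \<le> W)}"

text \<open>At \<open>K0\<close> a very negative \<open>y\<close> keeps \<open>d - c\<close> above
  \<open>d/2\<close>, so the entropy term grows linearly in \<open>- y\<close>. Across an edge with
  \<open>y K\<close> bounded below, the flux into a nearly empty \<open>L\<close> is at least
  \<kappa>, and the potential drop it multiplies grows linearly in \<open>- y L\<close>.\<close>

lemma bounded_states_lower:
  assumes d: "K0 \<in> V" "0 < d K0" "d K0 \<le> 1"
  shows "\<exists>A. \<forall>(y, u)\<in>bounded_states k C W d. \<forall>K\<in>V. - A \<le> y K"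
proof -
  let ?P = "\<lambda>K. \<exists>A. \<forall>(y, u)\<in>bounded_states k C W d. - A \<le> y K"
  let ?h = "chem_pot (d K0 / 2)"
  have "?P K0"
  proof (intro exI ballI, clarify)
    fix y u assume B: "(y, u) \<in> bounded_states k C W d"
    show "- max \<bar>?h\<bar> (2 * W / (m K0 * d K0)) \<le> y K0"
    proof (cases "y K0 \<le> 0 \<and> y K0 \<le> ?h")
      case True
      then have "logistic (y K0) \<le> d K0 / 2"
        using logistic_mono[of "y K0" ?h] d by (simp add: logistic_chem_pot)
      then have "d K0 / 2 * (- y K0) \<le> (d K0 - logistic (y K0)) * (- y K0)"
        using True by (intro mult_right_mono) auto
      then have "m K0 * (d K0 / 2 * (- y K0)) \<le> m K0 * ((logistic (y K0) - d K0) * y K0)"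
        using m_pos[OF d(1)] by (intro mult_left_mono) (auto simp: algebra_simps)
      also have "\<dots> \<le> W"
        using B d by (simp add: bounded_states_def)
      finally have "- y K0 \<le> 2 * W / (m K0 * d K0)"
        using m_pos[OF d(1)] d by (simp add: field_simps)
      then show ?thesis by simp
    qed auto
  qed
  moreover have "?P L" if KL: "K \<in> V" "L \<in> V" "w K L > 0" "?P K" for K L
  proof -
    from KL obtain A where A: "\<And>y u. (y, u) \<in> bounded_states k C W d \<Longrightarrow> - A \<le> y K"
      by blast
    obtain \<kappa> b0 where \<kappa>: "\<kappa> > 0" "b0 > 0"
      and fl: "\<And>a b p q. 0 < a \<Longrightarrow> a < 1 \<Longrightarrow> 0 < b \<Longrightarrow> b < 1 \<Longrightarrow> logistic (- A) \<le> a \<Longrightarrow> b \<le> b0 \<Longrightarrow> \<bar>q - p\<bar> \<le> 2 * C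
        \<Longrightarrow> \<kappa> \<le> flux k a b p q"
      using flux_into_empty[OF logistic_pos logistic_less_1, of "- A" "2 * C" k] by metis
    let ?b = "min b0 (1 / 2)"
    show ?thesis
    proof (intro exI ballI, clarify)
      fix y u assume B: "(y, u) \<in> bounded_states k C W d"
      have u: "\<bar>u K\<bar> \<le> C" "\<bar>u L\<bar> \<le> C"
        using B KL by (auto simp: bounded_states_def)
      \<comment> \<open>The last entry is the bound from the dissipation. The first two cover the
        cases where \<open>L\<close> is not nearly empty or the factor
        \<open>- A - 2 * C - y L\<close> is negative. Two potentials bounded by \<open>C\<close>
        account for \<open>2 * C\<close>.\<close>
      show "- max (max \<bar>chem_pot ?b\<bar> (A + 2 * C)) (W / (w K L * \<kappa>) + A + 2 * C) \<le> y L"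
      proof (cases "logistic (y L) \<le> ?b \<and> y L \<le> - A - 2 * C")
        case True
        let ?f = "flux k (logistic (y K)) (logistic (y L)) (u K) (u L)"
        have "\<kappa> \<le> ?f"
          using True u logistic_mono[OF A[OF B]] by (intro fl logistic_pos logistic_less_1) auto
        moreover have le: "- A - 2 * C - y L \<le> y K + u K - (y L + u L)"
          using A[OF B] u by linarith
        ultimately have "\<kappa> * (- A - 2 * C - y L) \<le> ?f * (y K + u K - (y L + u L))"
          using True \<kappa> by (intro mult_mono) auto
        then have "w K L * (\<kappa> * (- A - 2 * C - y L)) \<le> w K L * (?f * (y K + u K - (y L + u L)))"
          using KL by simp
        also have "\<dots> \<le> W"
          using B KL by (simp add: bounded_states_def mult.assoc)
        finally have "(- A - 2 * C - y L) * (w K L * \<kappa>) \<le> W"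
          by (simp only: mult_ac)
        then have "- A - 2 * C - y L \<le> W / (w K L * \<kappa>)"
          using KL \<kappa> by (simp add: pos_le_divide_eq)
        then show ?thesis by simp
      next
        case False
        have "chem_pot ?b \<le> y L" if "?b < logistic (y L)"
          using chem_pot_mono[of ?b "logistic (y L)"] that \<kappa> logistic_less_1 by simp
        with False show ?thesis by fastforce
      qed
    qed
  qed
  ultimately have "\<forall>K\<in>V. ?P K"
    using propagate[OF d(1), of ?P] by blast
  then obtain A where A: "\<And>K y u. K \<in> V \<Longrightarrow> (y, u) \<in> bounded_states k C W d \<Longrightarrow> - A K \<le> y K"
    by (metis (no_types, lifting) case_prodD)
  have "\<bar>A K\<bar> \<le> (\<Sum>K\<in>V. \<bar>A K\<bar>)" if "K \<in> V" for K
    using finite_V that by (intro member_le_sum) auto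
  then have "- (\<Sum>K\<in>V. \<bar>A K\<bar>) \<le> y K" if "(y, u) \<in> bounded_states k C W d" "K \<in> V" for y u K
    using A[OF that(2,1)] that by fastforce
  then show ?thesis by blast
qed

text \<open>The mirror image at the full end, with the midpoint of \<open>d K0\<close> and 1 in
  place of half of \<open>d K0\<close>. Here the flux runs from the nearly full \<open>L\<close>
  towards \<open>K\<close>, which has room left.\<close>

lemma bounded_states_upper:
  assumes d: "K0 \<in> V" "0 \<le> d K0" "d K0 < 1" and C: "0 \<le> C"
  shows "\<exists>A. \<forall>(y, u)\<in>bounded_states k C W d. \<forall>K\<in>V. y K \<le> A"
proof -
  let ?P = "\<lambda>K. \<exists>A. \<forall>(y, u)\<in>bounded_states k C W d. y K \<le> A"
  let ?h = "chem_pot ((1 + d K0) / 2)"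
  have "?P K0"
  proof (intro exI ballI, clarify)
    fix y u assume B: "(y, u) \<in> bounded_states k C W d"
    show "y K0 \<le> max \<bar>?h\<bar> (2 * W / (m K0 * (1 - d K0)))"
    proof (cases "0 \<le> y K0 \<and> ?h \<le> y K0")
      case True
      then have "(1 + d K0) / 2 \<le> logistic (y K0)"
        using logistic_mono[of ?h "y K0"] d by (simp add: logistic_chem_pot)
      then have "(1 - d K0) / 2 \<le> logistic (y K0) - d K0"
        by (simp add: field_simps)
      then have "(1 - d K0) / 2 * y K0 \<le> (logistic (y K0) - d K0) * y K0"
        using True by (intro mult_right_mono) auto
      then have "m K0 * ((1 - d K0) / 2 * y K0) \<le> m K0 * ((logistic (y K0) - d K0) * y K0)"
        using m_pos[OF d(1)] by (intro mult_left_mono) auto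
      also have "\<dots> \<le> W"
        using B d by (simp add: bounded_states_def)
      finally have "y K0 * (m K0 * (1 - d K0)) \<le> 2 * W"
        by (simp add: mult_ac)
      then have "y K0 \<le> 2 * W / (m K0 * (1 - d K0))"
        using m_pos[OF d(1)] d by (simp add: pos_le_divide_eq)
      then show ?thesis by simp
    qed auto
  qed
  moreover have "?P L" if KL: "K \<in> V" "L \<in> V" "w K L > 0" "?P K" for K L
  proof -
    from KL obtain A where A: "\<And>y u. (y, u) \<in> bounded_states k C W d \<Longrightarrow> y K \<le> A"
      by blast
    obtain \<kappa> b0 where \<kappa>: "\<kappa> > 0" "b0 < 1"
      and fl: "\<And>a b p q. 0 < a \<Longrightarrow> a < 1 \<Longrightarrow> 0 < b \<Longrightarrow> b < 1 \<Longrightarrow> a \<le> logistic A \<Longrightarrow> b0 \<le> b \<Longrightarrow> \<bar>q - p\<bar> \<le> 2 * C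
        \<Longrightarrow> \<kappa> \<le> - flux k a b p q"
      using flux_from_full[of "1 - logistic A" "2 * C" k] logistic_pos[of A] logistic_less_1[of A] C
      by auto
    let ?b = "max b0 (1 / 2)"
    show ?thesis
    proof (intro exI ballI, clarify)
      fix y u assume B: "(y, u) \<in> bounded_states k C W d"
      have u: "\<bar>u K\<bar> \<le> C" "\<bar>u L\<bar> \<le> C"
        using B KL by (auto simp: bounded_states_def)
      show "y L \<le> max (max \<bar>chem_pot ?b\<bar> (A + 2 * C)) (W / (w K L * \<kappa>) + A + 2 * C)"
      proof (cases "?b \<le> logistic (y L) \<and> A + 2 * C \<le> y L")
        case True
        let ?f = "flux k (logistic (y K)) (logistic (y L)) (u K) (u L)"
        have "\<kappa> \<le> - ?f"
          using True u logistic_mono[OF A[OF B]] by (intro fl logistic_pos logistic_less_1) auto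
        moreover have le: "y L - A - 2 * C \<le> - (y K + u K - (y L + u L))"
          using A[OF B] u by linarith
        ultimately have "\<kappa> * (y L - A - 2 * C) \<le> - ?f * - (y K + u K - (y L + u L))"
          using True \<kappa> by (intro mult_mono) auto
        then have "\<kappa> * (y L - A - 2 * C) \<le> ?f * (y K + u K - (y L + u L))"
          by (simp only: minus_mult_minus)
        then have "w K L * (\<kappa> * (y L - A - 2 * C)) \<le> w K L * (?f * (y K + u K - (y L + u L)))"
          using KL by simp
        also have "\<dots> \<le> W"
          using B KL by (simp add: bounded_states_def mult.assoc)
        finally have "(y L - A - 2 * C) * (w K L * \<kappa>) \<le> W"
          by (simp only: mult_ac)
        then have "y L - A - 2 * C \<le> W / (w K L * \<kappa>)"
          using KL \<kappa> by (simp add: pos_le_divide_eq)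
        then show ?thesis by simp
      next
        case False
        have "y L \<le> chem_pot ?b" if "logistic (y L) < ?b"
          using chem_pot_mono[of "logistic (y L)" ?b] that \<kappa> logistic_pos by simp
        with False show ?thesis by fastforce
      qed
    qed
  qed
  ultimately have "\<forall>K\<in>V. ?P K"
    using propagate[OF d(1), of ?P] by blast
  then obtain A where A: "\<And>K y u. K \<in> V \<Longrightarrow> (y, u) \<in> bounded_states k C W d \<Longrightarrow> y K \<le> A K"
    by (metis (no_types, lifting) case_prodD)
  have "\<bar>A K\<bar> \<le> (\<Sum>K\<in>V. \<bar>A K\<bar>)" if "K \<in> V" for K
    using finite_V that by (intro member_le_sum) auto
  then have "y K \<le> (\<Sum>K\<in>V. \<bar>A K\<bar>)" if "(y, u) \<in> bounded_states k C W d" "K \<in> V" for y u K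
    using A[OF that(2,1)] that by fastforce
  then show ?thesis by blast
qed

lemma exists_step:
  assumes dt: "\<Delta>t > 0" and d: "\<And>K. K \<in> V \<Longrightarrow> 0 \<le> d K \<and> d K \<le> 1"
    and K0: "K0 \<in> V" "0 < d K0" and K1: "K1 \<in> V" "d K1 < 1"
  shows "\<exists>c u. (\<forall>K\<in>V. 0 < c K \<and> c K < 1) \<and> (\<forall>K\<in>V. lap u K = m K * c K + s K) \<and>
    (\<forall>K\<in>V. m K * ((c K - d K) / \<Delta>t) + outflow k c u K = 0)"
proof -
  obtain C where C: "C \<ge> 0" and Cb: "\<And>c u. (\<forall>K\<in>V. 0 \<le> c K \<and> c K \<le> 1) \<Longrightarrow>
      (\<forall>K\<in>V. (lap u K - m K * c K - s K) * u K \<le> 0) \<Longrightarrow> (\<forall>K\<in>V. \<bar>u K\<bar> \<le> C)"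
    using potential_bound[of s] by blast
  \<comment> \<open>\<open>W0\<close> is the total shift that makes all entropy terms nonnegative,
    namely 1 for the entropy and \<open>C\<close> for the potential in each unit of volume.
    \<open>W\<close> collects what this leaves for a single entropy term and for the dissipation of
    a single edge.\<close>
  define W0 where "W0 = (\<Sum>K\<in>V. m K * (1 + C))"
  define W where "W = max W0 (2 * W0 / \<Delta>t)"
  obtain A1 where A1: "\<And>y u K. (y, u) \<in> bounded_states k C W d \<Longrightarrow> K \<in> V \<Longrightarrow> - A1 \<le> y K"
    using bounded_states_lower[of K0 d k C W] K0 d[OF K0(1)] by blast
  obtain A2 where A2: "\<And>y u K. (y, u) \<in> bounded_states k C W d \<Longrightarrow> K \<in> V \<Longrightarrow> y K \<le> A2"
    using bounded_states_upper[of K1 d C k W] K1 C d[OF K1(1)] by blast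
  \<comment> \<open>Strictly larger than every a priori bound: the constraints turn out inactive,
    and where \<open>y\<close> is extremal \<open>u\<close> cannot change the sign of
    \<open>y + u\<close>.\<close>
  define R where "R = \<bar>A1\<bar> + \<bar>A2\<bar> + C + 1"
  have R: "R > 0" "A1 < R" "A2 < R" "C < R" using C by (auto simp: R_def)
  \<comment> \<open>Two copies of the cells index the unknowns: \<open>Inl K\<close> carries
    \<open>y\<close> with the mass balance, \<open>Inr K\<close> the potential with the Poisson
    equation.\<close>
  define G where "G = (\<lambda>i (z :: 'v + 'v \<Rightarrow> real). case i of
      Inl K \<Rightarrow> m K * ((logistic (z (Inl K)) - d K) / \<Delta>t) +
        outflow k (\<lambda>K. logistic (z (Inl K))) (\<lambda>K. z (Inr K)) K
    | Inr K \<Rightarrow> lap (\<lambda>K. z (Inr K)) K - m K * logistic (z (Inl K)) - s K)"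
  have co: "continuous_on UNIV (\<lambda>z :: 'v + 'v \<Rightarrow> real. z i)" for i
    by simp
  have "continuous_on UNIV (G i)" for i
    using dt logistic_pos logistic_less_1
    by (cases i) (auto simp: G_def outflow_def lap_def intro!: continuous_intros continuous_on_flux co)
  then have "\<exists>z. (\<forall>i. \<bar>z i\<bar> \<le> R) \<and>
      (\<forall>i\<in>Inl ` V \<union> Inr ` V. (G i z \<le> 0 \<or> z i = -R) \<and> (G i z \<ge> 0 \<or> z i = R))"
    using finite_V R by (intro box_variational_inequality) auto
  then obtain z where zR: "\<And>i. \<bar>z i\<bar> \<le> R"
    and zG: "\<And>i. i \<in> Inl ` V \<union> Inr ` V \<Longrightarrow> (G i z \<le> 0 \<or> z i = -R) \<and> (G i z \<ge> 0 \<or> z i = R)"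
    by blast
  define y where "y = (\<lambda>K. z (Inl K))"
  define u where "u = (\<lambda>K. z (Inr K))"
  define c where "c = (\<lambda>K. logistic (y K))"
  have c: "0 < c K \<and> c K < 1" for K by (simp add: c_def logistic_pos logistic_less_1)
  have h: "chem_pot (c K) = y K" for K by (simp add: c_def)
  define P where "P = (\<lambda>K. lap u K - m K * c K - s K)"
  define Q where "Q = (\<lambda>K. m K * ((c K - d K) / \<Delta>t) + outflow k c u K)"
  have GP: "G (Inr K) z = P K" and GQ: "G (Inl K) z = Q K" for K
    by (simp_all add: G_def P_def Q_def u_def c_def y_def)
  have P: "(P K \<le> 0 \<or> u K = -R) \<and> (P K \<ge> 0 \<or> u K = R)" if "K \<in> V" for K
    using zG[of "Inr K"] that by (simp add: GP u_def)
  have Q: "(Q K \<le> 0 \<or> y K = -R) \<and> (Q K \<ge> 0 \<or> y K = R)" if "K \<in> V" for K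
    using zG[of "Inl K"] that by (simp add: GQ y_def)
  text \<open>Wherever the box constraint is active, the residual has the sign that allows testing with
    \<open>u\<close> and with \<open>y + u\<close>. The bounds that result do not depend on \<open>R\<close>.\<close>
  have compl: "p * v \<le> 0" if "(p \<le> 0 \<or> v < 0) \<and> (p \<ge> 0 \<or> v > 0)" for p v :: real
    using that by (auto simp: mult_le_0_iff)
  have "P K * u K \<le> 0" if "K \<in> V" for K
    using P[OF that] R by (intro compl) auto
  then have uC: "\<And>K. K \<in> V \<Longrightarrow> \<bar>u K\<bar> \<le> C"
    using Cb[of c u] c by (auto simp: P_def less_imp_le)
  have P0: "P K = 0" if "K \<in> V" for K
    using P[OF that] uC[OF that] R by auto
  have "Q K * (y K + u K) \<le> 0" if "K \<in> V" for K
    using Q[OF that] uC[OF that] R by (intro compl) auto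
  then have "(\<Sum>K\<in>V. Q K * (y K + u K)) \<le> 0"
    by (intro sum_nonpos) auto
  moreover have "(\<Sum>K\<in>V. Q K * (y K + u K)) =
      (\<Sum>K\<in>V. m K * (c K - d K) * (y K + u K)) / \<Delta>t + (\<Sum>K\<in>V. outflow k c u K * (y K + u K))"
    by (simp add: Q_def distrib_right sum.distrib sum_divide_distrib)
  ultimately have test: "(\<Sum>K\<in>V. m K * (c K - d K) * (y K + u K)) / \<Delta>t
      + 1 / 2 * (\<Sum>K\<in>V. \<Sum>L\<in>V. w K L * flux k (c K) (c L) (u K) (u L) * (y K + u K - (y L + u L))) \<le> 0"
    by (simp add: outflow_test)
  define D where "D = (\<lambda>K L. w K L * flux k (c K) (c L) (u K) (u L) * (y K + u K - (y L + u L)))"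
  define X where "X = (\<lambda>K. m K * (c K - d K) * (y K + u K) + m K * (1 + C))"
  have D0: "D K L \<ge> 0" if "K \<in> V" "L \<in> V" for K L
    using flux_dissipation_nonneg[OF that, of c k u] c by (simp add: D_def h)
  have X0: "X K \<ge> m K * ((c K - d K) * y K) + m K" if K: "K \<in> V" for K
  proof -
    have "\<bar>(c K - d K) * u K\<bar> \<le> 1 * C"
      unfolding abs_mult using c[of K] d[OF K] uC[OF K] by (intro mult_mono) auto
    then have "m K * ((c K - d K) * y K + 1) \<le> m K * ((c K - d K) * (y K + u K) + (1 + C))"
      using m_pos[OF K] by (intro mult_left_mono) (auto simp: algebra_simps)
    then show ?thesis by (simp add: X_def algebra_simps)
  qed
  have X1: "m K * ((c K - d K) * y K) + m K \<ge> 0" if K: "K \<in> V" for K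
  proof -
    have "m K * (- 1) \<le> m K * ((c K - d K) * y K)"
      using entropy_test_ge[of "c K" "d K"] c[of K] d[OF K] m_pos[OF K] unfolding h
      by (intro mult_left_mono) auto
    then show ?thesis by simp
  qed
  have sX: "(\<Sum>K\<in>V. X K) = (\<Sum>K\<in>V. m K * (c K - d K) * (y K + u K)) + W0"
    by (simp add: X_def W0_def sum.distrib)
  have "(\<Sum>K\<in>V. X K) \<ge> 0" "(\<Sum>K\<in>V. \<Sum>L\<in>V. D K L) \<ge> 0"
    using X0 X1 D0 by (fastforce intro!: sum_nonneg)+
  moreover have t: "((\<Sum>K\<in>V. X K) - W0) / \<Delta>t + 1 / 2 * (\<Sum>K\<in>V. \<Sum>L\<in>V. D K L) \<le> 0"
    using test unfolding sX D_def by simp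
  ultimately have "((\<Sum>K\<in>V. X K) - W0) / \<Delta>t \<le> 0" "- W0 / \<Delta>t \<le> ((\<Sum>K\<in>V. X K) - W0) / \<Delta>t"
    using dt by (linarith, intro divide_right_mono) auto
  with t have SX: "(\<Sum>K\<in>V. X K) \<le> W0" and SD: "(\<Sum>K\<in>V. \<Sum>L\<in>V. D K L) \<le> 2 * W0 / \<Delta>t"
    using dt by (auto simp: divide_le_0_iff)
  have "(y, u) \<in> bounded_states k C W d"
    unfolding bounded_states_def
  proof (clarsimp, intro conjI ballI)
    fix K assume K: "K \<in> V"
    show "\<bar>u K\<bar> \<le> C" by (rule uC[OF K])
    have "m K * ((c K - d K) * y K) \<le> X K"
      using X0[OF K] m_pos[OF K] by linarith
    also have "\<dots> \<le> (\<Sum>K\<in>V. X K)"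
      using K finite_V X0 X1 by (intro member_le_sum) fastforce+
    also have "\<dots> \<le> W" using SX by (simp add: W_def)
    finally show "m K * ((logistic (y K) - d K) * y K) \<le> W" by (simp add: c_def)
  next
    fix K L assume K: "K \<in> V" and L: "L \<in> V"
    have "D K L \<le> (\<Sum>L\<in>V. D K L)"
      using K L finite_V D0 by (intro member_le_sum) auto
    also have "\<dots> \<le> (\<Sum>K\<in>V. \<Sum>L\<in>V. D K L)"
      using K finite_V D0 by (intro member_le_sum[of K V "\<lambda>K. \<Sum>L\<in>V. D K L"]) (auto intro!: sum_nonneg)
    also have "\<dots> \<le> W" using SD by (simp add: W_def)
    finally show "w K L * flux k (logistic (y K)) (logistic (y L)) (u K) (u L) * (y K + u K - (y L + u L)) \<le> W"
      by (simp add: D_def c_def)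
  qed
  then have "- R < y K \<and> y K < R" if "K \<in> V" for K
    using A1[of y u K] A2[of y u K] that R by linarith
  then have "Q K = 0" if "K \<in> V" for K
    using Q[OF that] that by fastforce
  with P0 c have "(\<forall>K\<in>V. 0 < c K \<and> c K < 1) \<and> (\<forall>K\<in>V. lap u K = m K * c K + s K) \<and>
      (\<forall>K\<in>V. m K * ((c K - d K) / \<Delta>t) + outflow k c u K = 0)"
    by (auto simp: P_def Q_def algebra_simps)
  then show ?thesis by blast
qed

end

section \<open>Surface-null sets\<close>

lemma hausdorff_outer_Union_null:
  fixes A :: "'i \<Rightarrow> 'a::metric_space set"
  assumes "finite I" "\<And>i. i \<in> I \<Longrightarrow> hausdorff_outer s (A i) = 0"
  shows "hausdorff_outer s (\<Union>i\<in>I. A i) = 0"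
proof -
  have Un: "hausdorff_outer s (B \<union> C) = 0" if "hausdorff_outer s B = 0" "hausdorff_outer s C = 0" for B C :: "'a set"
  proof -
    have "hausdorff_outer s (\<Union>i. if i = (0::nat) then B else C) \<le> (\<Sum>i. hausdorff_outer s (if i = 0 then B else C))"
      by (rule hausdorff_outer_countable_subadditive)
    also have "(\<Sum>i. hausdorff_outer s (if i = (0::nat) then B else C)) = (\<Sum>i::nat. 0)"
      using that by (intro suminf_cong) auto
    finally show ?thesis
      using hausdorff_outer_mono[of "B \<union> C" "\<Union>i. if i = (0::nat) then B else C" s]
      by (auto split: if_splits)
  qed
  show ?thesis
    using assms by (induction I rule: finite_induct) (auto intro!: Un)
qed

lemma hausdorff_outer_subset_null: "A \<subseteq> B \<Longrightarrow> hausdorff_outer s B = 0 \<Longrightarrow> hausdorff_outer s A = 0"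
  using hausdorff_outer_mono[of A B s] by simp

text \<open>Sets that look one-dimensional: \<open>n\<close> pieces of diameter \<open>D / n\<close>
  cost about \<open>n * (D / n) ^ s\<close>. Two of the \<open>s\<close> powers give the decay 1/n,
  and the remaining \<open>s - 2\<close> are bounded by powers of \<delta>.\<close>

lemma hausdorff_outer_le_finite_cover:
  fixes A :: "'a::metric_space set" and U :: "nat \<Rightarrow> nat \<Rightarrow> 'a set"
  assumes cover: "\<And>n. n > 0 \<Longrightarrow> A \<subseteq> (\<Union>i<n. U n i)"
    and bd: "\<And>n i. bounded (U n i)" and diam: "\<And>n i. diameter (U n i) \<le> D / real n"
    and s: "2 \<le> s"
  shows "hausdorff_outer s A = 0"
proof -
  have D: "D \<ge> 0"
    using diam[of 1 0] diameter_ge_0[OF bd[of 1 0]] by simp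
  let ?v = "unit_ball_vol (real s)"
  have "hausdorff_pre s \<delta> A = 0" if \<delta>: "\<delta> > 0" for \<delta>
  proof -
    have "hausdorff_pre s \<delta> A \<le> ennreal (?v * D\<^sup>2 * (\<delta> ^ (s - 2)) / real n)" if n: "n > 0" "D / real n \<le> \<delta>" for n
    proof -
      let ?U = "\<lambda>i. if i < n then U n i else {}"
      have "diameter (U n i) \<le> \<delta>" for i
        using diam[of n i] n by linarith
      then have "?U \<in> hausdorff_covers \<delta> A"
        using cover[OF n(1)] bd \<delta> unfolding hausdorff_covers_def by auto
      then have "hausdorff_pre s \<delta> A \<le> (\<Sum>i. hausdorff_cost s (?U i))"
        unfolding hausdorff_pre_def by (rule INF_lower)
      also have "\<dots> = (\<Sum>i<n. hausdorff_cost s (?U i))"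
        by (rule suminf_finite) (auto simp: hausdorff_cost_def)
      also have "\<dots> \<le> (\<Sum>i<n. ennreal (?v * (D / real n) ^ s))"
      proof (rule sum_mono)
        fix i assume "i \<in> {..<n}"
        have "diameter (U n i) / 2 \<le> D / real n"
          using diam[of n i] diameter_ge_0[OF bd[of n i]] by linarith
        then have "(diameter (U n i) / 2) ^ s \<le> (D / real n) ^ s"
          using diameter_ge_0[OF bd[of n i]] by (intro power_mono) auto
        then show "hausdorff_cost s (?U i) \<le> ennreal (?v * (D / real n) ^ s)"
          by (auto simp: hausdorff_cost_def intro!: ennreal_leI mult_left_mono)
      qed
      also have "\<dots> = ennreal (real n * (?v * (D / real n) ^ s))"
        using D by (simp add: ennreal_mult ennreal_of_nat_eq_real_of_nat)
      also have "\<dots> \<le> ennreal (?v * D\<^sup>2 * (\<delta> ^ (s - 2)) / real n)"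
      proof (rule ennreal_leI)
        have "s = 2 + (s - 2)" using s by simp
        then have "(D / real n) ^ s = (D / real n) ^ (2 + (s - 2))"
          by (rule arg_cong)
        also have "\<dots> = (D / real n)\<^sup>2 * (D / real n) ^ (s - 2)"
          by (rule power_add)
        also have "\<dots> \<le> (D / real n)\<^sup>2 * \<delta> ^ (s - 2)"
          using n D by (intro mult_left_mono power_mono) auto
        finally have "real n * (?v * (D / real n) ^ s) \<le> real n * (?v * ((D / real n)\<^sup>2 * \<delta> ^ (s - 2)))"
          by (intro mult_left_mono) auto
        also have "\<dots> = ?v * D\<^sup>2 * (\<delta> ^ (s - 2)) / real n"
          using n by (simp add: power2_eq_square field_simps)
        finally show "real n * (?v * (D / real n) ^ s) \<le> ?v * D\<^sup>2 * (\<delta> ^ (s - 2)) / real n" .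
      qed
      finally show ?thesis .
    qed
    note b = this
    have "(\<lambda>n. D / real n) \<longlonglongrightarrow> 0"
      by (rule lim_const_over_n)
    then have "\<forall>\<^sub>F n in sequentially. D / real n < \<delta>"
      using \<delta> by (rule order_tendstoD(2))
    then have ev: "\<forall>\<^sub>F n in sequentially. hausdorff_pre s \<delta> A \<le> ennreal (?v * D\<^sup>2 * (\<delta> ^ (s - 2)) / real n)"
      using eventually_gt_at_top[of 0] by eventually_elim (use b in auto)
    have "(\<lambda>n. ennreal (?v * D\<^sup>2 * (\<delta> ^ (s - 2)) / real n)) \<longlonglongrightarrow> ennreal 0"
      by (intro tendsto_ennrealI lim_const_over_n)
    from tendsto_lowerbound[OF this ev] show ?thesis by simp
  qed
  then show ?thesis by (simp add: hausdorff_outer_def)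
qed

lemma hausdorff_outer_segment:
  fixes p v :: "'a::real_normed_vector"
  assumes s: "2 \<le> s"
  shows "hausdorff_outer s ((\<lambda>t. p + t *\<^sub>R v) ` {0..1}) = 0"
proof (rule hausdorff_outer_le_finite_cover[OF _ _ _ s])
  let ?U = "\<lambda>n i. (\<lambda>t. p + t *\<^sub>R v) ` {real i / real n..(real i + 1) / real n}"
  show "(\<lambda>t. p + t *\<^sub>R v) ` {0..1} \<subseteq> (\<Union>i<n. ?U n i)" if n: "n > 0" for n
  proof
    fix x assume "x \<in> (\<lambda>t. p + t *\<^sub>R v) ` {0..1}"
    then obtain t where t: "0 \<le> t" "t \<le> 1" "x = p + t *\<^sub>R v" by auto
    show "x \<in> (\<Union>i<n. ?U n i)"
    \<comment> \<open>For \<open>t = 1\<close> the floor would give the index \<open>n\<close>, one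
      too many; this point belongs to the last piece.\<close>
    proof (cases "t = 1")
      case True
      then have "x \<in> ?U n (n - 1)"
        using n t by (intro image_eqI[of _ _ t]) (auto simp: field_simps of_nat_diff)
      then show ?thesis using n by (intro UN_I[of "n - 1"]) auto
    next
      case False
      define i where "i = nat \<lfloor>t * real n\<rfloor>"
      have "real i \<le> t * real n" "t * real n \<le> real i + 1"
        using t by (auto simp: i_def)
      moreover have "t * real n < real n"
        using t False n by simp
      then have "i < n"
        using calculation(1) by linarith
      moreover have "x \<in> ?U n i"
        using n t calculation by (intro image_eqI[of _ _ t]) (auto simp: field_simps)
      ultimately show ?thesis by blast
    qed
  qed
  have dist: "dist x y \<le> norm v / real n" if xy: "x \<in> ?U n i" "y \<in> ?U n i" for x y n i
  proof -
    obtain a where a: "x = p + a *\<^sub>R v" "a \<in> {real i / real n..(real i + 1) / real n}"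
      using xy(1) by (rule imageE)
    obtain b where b: "y = p + b *\<^sub>R v" "b \<in> {real i / real n..(real i + 1) / real n}"
      using xy(2) by (rule imageE)
    note ab = a b
    then have "\<bar>a - b\<bar> \<le> 1 / real n"
      by (auto simp: add_divide_distrib)
    then have "\<bar>a - b\<bar> * norm v \<le> 1 / real n * norm v"
      by (intro mult_right_mono) auto
    then show ?thesis
      using ab by (simp add: dist_norm flip: scaleR_diff_left)
  qed
  show "bounded (?U n i)" for n i
    using dist unfolding bounded_two_points by blast
  show "diameter (?U n i) \<le> norm v / real n" for n i
    using dist by (intro diameter_le) (auto simp: dist_norm)
qed

lemma hausdorff_outer_singleton:
  fixes p :: "'a::metric_space"
  assumes "1 \<le> s"
  shows "hausdorff_outer s {p} = 0"
proof -
  have "hausdorff_pre s \<delta> {p} = 0" if "\<delta> > 0" for \<delta>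
  proof -
    have "(\<lambda>i. if i = (0::nat) then {p} else {}) \<in> hausdorff_covers \<delta> {p}"
      using that by (auto simp: hausdorff_covers_def)
    then have "hausdorff_pre s \<delta> {p} \<le> (\<Sum>i. hausdorff_cost s (if i = (0::nat) then {p} else {}))"
      unfolding hausdorff_pre_def by (rule INF_lower)
    also have "\<dots> = (\<Sum>i::nat. 0)"
      using assms by (intro suminf_cong) (auto simp: hausdorff_cost_def)
    finally show ?thesis by simp
  qed
  then show ?thesis by (simp add: hausdorff_outer_def)
qed

text \<open>In dimension at most 3 a set of codimension two is empty, a single point, or a bounded
  part of a line in dimension 3, and in the last case the surface measure has exponent 2.\<close>

lemma surface_outer_lowdim:
  fixes S :: "'a::euclidean_space set"
  assumes dim: "DIM('a) \<le> 3" and S: "bounded S" "aff_dim S \<le> int DIM('a) - 2"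
  shows "surface_outer S = 0"
proof (cases "S = {}")
  case False
  then obtain p where p: "p \<in> S" by blast
  have "aff_dim S \<ge> 0"
    using False aff_dim_geq[of S] aff_dim_empty[of S] by linarith
  then have d: "DIM('a) \<ge> 2" using S by linarith
  show ?thesis
  proof (cases "aff_dim S = 0")
    case True
    then obtain a where "S = {a}" by (auto simp: aff_dim_eq_0)
    then show ?thesis using d by (simp add: hausdorff_outer_singleton)
  next
    case False
    then have "2 \<le> DIM('a) - 1" "aff_dim S \<le> 1"
      using dim S \<open>aff_dim S \<ge> 0\<close> by linarith+
    then have "collinear S" by (simp add: collinear_aff_dim)
    then obtain u where u: "\<And>x. x \<in> S \<Longrightarrow> \<exists>c. x - p = c *\<^sub>R u"
      using p unfolding collinear_def by metis
    obtain B where B: "B > 0" "\<And>x. x \<in> S \<Longrightarrow> norm x \<le> B"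
      using S(1) bounded_pos by blast
    show ?thesis
    proof (cases "u = 0")
      case True
      then have "S \<subseteq> {p}" using u by auto
      then show ?thesis
        using d hausdorff_outer_singleton[of "DIM('a) - 1" p] hausdorff_outer_subset_null by (metis One_nat_def Suc_leI diff_is_0_eq' not_less_eq_eq numeral_2_eq_2 zero_less_diff linorder_not_le)
    next
      case False
      \<comment> \<open>Bounds the parameter of every point of \<open>S\<close> on the line through
        \<open>p\<close> in direction \<open>u\<close>, so that one segment contains
        \<open>S\<close>.\<close>
      define R where "R = 2 * B / norm u"
      have R: "R > 0" using False B by (simp add: R_def)
      have "S \<subseteq> (\<lambda>t. (p - R *\<^sub>R u) + t *\<^sub>R ((2 * R) *\<^sub>R u)) ` {0..1}"
      proof
        fix x assume x: "x \<in> S"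
        from u[OF x] obtain c where c: "x - p = c *\<^sub>R u" by blast
        have "norm (x - p) \<le> 2 * B"
          using norm_triangle_ineq4[of x p] B(2)[OF x] B(2)[OF p] by linarith
        then have "\<bar>c\<bar> \<le> R"
          using False by (simp add: c R_def pos_le_divide_eq)
        then have "(c + R) / (2 * R) \<in> {0..1}"
          using R by (auto simp: field_simps)
        moreover have "((c + R) / (2 * R)) * (2 * R) = c + R"
          using R by simp
        then have "x = (p - R *\<^sub>R u) + ((c + R) / (2 * R)) *\<^sub>R ((2 * R) *\<^sub>R u)"
          using c by (simp add: algebra_simps)
        ultimately show "x \<in> (\<lambda>t. (p - R *\<^sub>R u) + t *\<^sub>R ((2 * R) *\<^sub>R u)) ` {0..1}"
          by blast
      qed
      then show ?thesis
        by (rule hausdorff_outer_subset_null) (use \<open>2 \<le> DIM('a) - 1\<close> in \<open>rule hausdorff_outer_segment\<close>)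
    qed
  qed
qed simp


text \<open>About \<open>R / \<delta>\<close> balls of radius \<open>2 * \<delta>\<close> along the
  axis contain the tube over a set of diameter \<delta>. Their volume has the order of \<delta> to
  the power \<open>DIM('a) - 1\<close>, which is the Hausdorff cost of that set. Diameter 0 is
  separate: the tube then lies in a line.\<close>

lemma tube_cover:
  fixes U :: "'a::euclidean_space set"
  assumes d: "2 \<le> DIM('a)" and U: "bounded U" "diameter U \<le> 1" and u: "norm u = 1" and R: "R > 0"
  shows "\<exists>T\<in>lmeasurable. {x + s *\<^sub>R u |x s. x \<in> U \<and> \<bar>s\<bar> \<le> R} \<subseteq> T \<and>
    measure lebesgue T \<le> (2 * R + 3) * unit_ball_vol (real DIM('a)) * 2 ^ DIM('a) * diameter U ^ (DIM('a) - 1)"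
proof (cases "U = {}")
  case True
  then show ?thesis using R by (intro bexI[of _ "{}"]) (auto intro!: mult_nonneg_nonneg)
next
  case False
  then obtain p where p: "p \<in> U" by blast
  define \<delta> where "\<delta> = diameter U"
  have \<delta>0: "\<delta> \<ge> 0" using diameter_ge_0[OF U(1)] by (simp add: \<delta>_def)
  have dist_p: "dist x p \<le> \<delta>" if "x \<in> U" for x
    using diameter_bounded_bound[OF U(1) that p] by (simp add: \<delta>_def)
  show ?thesis
  proof (cases "\<delta> = 0")
    case True
    have "{x + s *\<^sub>R u |x s. x \<in> U \<and> \<bar>s\<bar> \<le> R} \<subseteq> (\<lambda>x. p + x) ` span {u}"
      using dist_p True by (fastforce simp: span_singleton)
    moreover have "dim (span {u}) < DIM('a)"
      using d dim_le_card'[of "{u}"] by simp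
    then have "negligible (span {u})"
      by (simp add: negligible_lowdim)
    then have "negligible ((\<lambda>x. p + x) ` span {u})"
      by (rule negligible_translation)
    ultimately show ?thesis
      using R by (intro bexI[of _ "(\<lambda>x. p + x) ` span {u}"])
        (auto simp: negligible_imp_measure0 negligible_imp_measurable intro!: mult_nonneg_nonneg diameter_ge_0 U zero_le_power)
  next
    case False
    then have \<delta>: "0 < \<delta>" using \<delta>0 by simp
    define n where "n = nat \<lceil>R / \<delta>\<rceil>"
    define J where "J = {- int n..int n}"
    let ?T = "\<Union>j\<in>J. cball (p + (of_int j * \<delta>) *\<^sub>R u) (2 * \<delta>)"
    have n: "R / \<delta> \<le> real n" "real n \<le> R / \<delta> + 1"
      using R \<delta> by (auto simp: n_def)
    have "{x + s *\<^sub>R u |x s. x \<in> U \<and> \<bar>s\<bar> \<le> R} \<subseteq> ?T"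
    proof clarify
      fix x s assume x: "x \<in> U" and s: "\<bar>s\<bar> \<le> R"
      define j where "j = \<lfloor>s / \<delta>\<rfloor>"
      have "\<bar>s / \<delta>\<bar> \<le> R / \<delta>"
        using s \<delta> by (simp add: divide_right_mono)
      then have "\<bar>s / \<delta>\<bar> \<le> real n" using n by linarith
      then have "- real n \<le> s / \<delta>" "s / \<delta> \<le> real n" by linarith+
      then have "j \<in> J"
        unfolding j_def J_def by (auto simp: le_floor_iff floor_le_iff)
      have "of_int j \<le> s / \<delta>" "s / \<delta> \<le> of_int j + 1"
        by (auto simp: j_def)
      then have "\<bar>s - of_int j * \<delta>\<bar> \<le> \<delta>"
        using \<delta> by (simp add: field_simps abs_le_iff)
      moreover have "dist (p + (of_int j * \<delta>) *\<^sub>R u) (x + s *\<^sub>R u) = norm ((x - p) + (s - of_int j * \<delta>) *\<^sub>R u)"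
        by (simp add: dist_norm norm_minus_commute algebra_simps)
      moreover have "norm ((x - p) + (s - of_int j * \<delta>) *\<^sub>R u) \<le> norm (x - p) + \<bar>s - of_int j * \<delta>\<bar>"
        using norm_triangle_ineq[of "x - p" "(s - of_int j * \<delta>) *\<^sub>R u"] u by simp
      ultimately have "dist (p + (of_int j * \<delta>) *\<^sub>R u) (x + s *\<^sub>R u) \<le> 2 * \<delta>"
        using dist_p[OF x] by (simp add: dist_norm)
      then show "x + s *\<^sub>R u \<in> ?T"
        using \<open>j \<in> J\<close> by auto
    qed
    moreover have fin: "finite J" "card J = 2 * n + 1"
      by (auto simp: J_def)
    have lm: "?T \<in> lmeasurable"
      using fin by (intro fmeasurable.finite_UN) auto
    moreover have "measure lebesgue ?T \<le> (2 * R + 3) * unit_ball_vol (real DIM('a)) * 2 ^ DIM('a) * \<delta> ^ (DIM('a) - 1)"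
    proof -
      let ?v = "unit_ball_vol (real DIM('a))"
      have "measure lebesgue ?T \<le> (\<Sum>j\<in>J. measure lebesgue (cball (p + (of_int j * \<delta>) *\<^sub>R u) (2 * \<delta>)))"
        using fin by (intro measure_UNION_le) auto
      also have "\<dots> = real (2 * n + 1) * (?v * (2 * \<delta>) ^ DIM('a))"
        using \<delta> fin by (simp add: content_cball)
      also have "\<dots> \<le> ((2 * R + 3) / \<delta>) * (?v * (2 * \<delta>) ^ DIM('a))"
      proof (intro mult_right_mono)
        \<comment> \<open>The number of balls is at most \<open>2 * R / \<delta> + 3\<close>;
          because the diameter is at most 1, the 3 can be absorbed as
          \<open>3 / \<delta>\<close>.\<close>
        have "1 \<le> 1 / \<delta>" using U \<delta> by (simp add: \<delta>_def)
        then show "real (2 * n + 1) \<le> (2 * R + 3) / \<delta>"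
          using n by (simp add: add_divide_distrib)
      qed (use \<delta> in auto)
      also have "\<dots> = (2 * R + 3) * ?v * 2 ^ DIM('a) * (\<delta> ^ DIM('a) / \<delta>)"
        by (simp add: power_mult_distrib)
      also have "\<delta> ^ DIM('a) / \<delta> = \<delta> ^ (DIM('a) - 1)"
        using \<delta> by (simp add: power_diff)
      finally show ?thesis .
    qed
    ultimately show ?thesis unfolding \<delta>_def by blast
  qed
qed

text \<open>A surface-null set casts a negligible shadow in every direction. Tubes over the sets of
  a cheap cover have small total volume, which avoids any projection or Fubini argument.\<close>

lemma negligible_tube:
  fixes N :: "'a::euclidean_space set"
  assumes N: "surface_outer N = 0" and u: "norm u = 1" and R: "R > 0"
  shows "negligible {x + s *\<^sub>R u |x s. x \<in> N \<and> \<bar>s\<bar> \<le> R}"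
proof -
  let ?d = "DIM('a)"
  have pre: "hausdorff_pre (?d - 1) 1 N = 0"
  proof -
    have "hausdorff_pre (?d - 1) 1 N \<le> surface_outer N"
      unfolding hausdorff_outer_def by (intro SUP_upper) auto
    then show ?thesis using N by simp
  qed
  have cov: "\<exists>U\<in>hausdorff_covers 1 N. (\<Sum>i. hausdorff_cost (?d - 1) (U i)) < ennreal e" if "e > 0" for e
  proof -
    have "hausdorff_pre (?d - 1) 1 N < ennreal e" using pre that by simp
    then show ?thesis unfolding hausdorff_pre_def INF_less_iff .
  qed
  show ?thesis
  proof (cases "?d \<ge> 2")
    \<comment> \<open>In dimension one the cost is a count: every nonempty covering set costs 1, so
      cost below 1 forces \<open>N\<close> to be empty.\<close>
    case False
    then have d: "?d - 1 = 0" by simp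
    obtain U where U: "U \<in> hausdorff_covers 1 N" "(\<Sum>i. hausdorff_cost (?d - 1) (U i)) < ennreal 1"
      using cov[of 1] by auto
    have "U i = {}" for i
    proof (rule ccontr)
      assume "U i \<noteq> {}"
      then have "ennreal 1 = hausdorff_cost (?d - 1) (U i)"
        using d by (simp add: hausdorff_cost_def)
      also have "\<dots> = sum (\<lambda>i. hausdorff_cost (?d - 1) (U i)) {i}" by simp
      also have "\<dots> \<le> (\<Sum>i. hausdorff_cost (?d - 1) (U i))"
        by (intro sum_le_suminf) auto
      finally show False using U(2) by simp
    qed
    then have "N = {}" using U(1) by (auto simp: hausdorff_covers_def)
    then show ?thesis by simp
  next
    case True
    define v where "v = unit_ball_vol (real (?d - 1))"
    have v: "v > 0" unfolding v_def by (intro unit_ball_vol_pos) auto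
    define C where "C = (2 * R + 3) * unit_ball_vol (real ?d) * 2 ^ ?d * 2 ^ (?d - 1) / v"
    have C: "C > 0" unfolding C_def using R v by (intro divide_pos_pos mult_pos_pos) auto
    define tube where "tube A = {x + s *\<^sub>R u |x s. x \<in> A \<and> \<bar>s\<bar> \<le> R}" for A
    have tube_UN: "tube A \<subseteq> (\<Union>i. tube (B i))" if "A \<subseteq> (\<Union>i. B i)" for A and B :: "nat \<Rightarrow> 'a set"
      using that unfolding tube_def by blast
    show ?thesis
      unfolding negligible_outer_le tube_def[symmetric]
    proof (intro allI impI)
      fix e :: real assume e: "e > 0"
      obtain U where U: "U \<in> hausdorff_covers 1 N" "(\<Sum>i. hausdorff_cost (?d - 1) (U i)) < ennreal (e / C)"
        using cov[of "e / C"] e C by auto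
      have Ub: "bounded (U i)" "diameter (U i) \<le> 1" for i
        using U(1) by (auto simp: hausdorff_covers_def)
      have "\<exists>T. T \<in> lmeasurable \<and> tube (U i) \<subseteq> T \<and>
          emeasure lebesgue T \<le> ennreal C * hausdorff_cost (?d - 1) (U i)" for i
      proof (cases "U i = {}")
        case True
        then show ?thesis by (intro exI[of _ "{}"]) (auto simp: tube_def)
      next
        case False
        from tube_cover[OF True Ub(1)[of i] Ub(2)[of i] u R, folded tube_def]
        obtain T where T: "T \<in> lmeasurable" "tube (U i) \<subseteq> T"
          "measure lebesgue T \<le> (2 * R + 3) * unit_ball_vol (real ?d) * 2 ^ ?d * diameter (U i) ^ (?d - 1)"
          by (elim bexE conjE) (rule that)
        have "emeasure lebesgue T = ennreal (measure lebesgue T)"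
          using T(1) by (simp add: emeasure_eq_measure2)
        also have "\<dots> \<le> ennreal (C * (v * (diameter (U i) / 2) ^ (?d - 1)))"
        proof (rule ennreal_leI, rule order_trans[OF T(3)])
          have "C * (v * (diameter (U i) / 2) ^ (?d - 1)) =
              (2 * R + 3) * unit_ball_vol (real ?d) * 2 ^ ?d * diameter (U i) ^ (?d - 1)"
            using v by (simp add: C_def power_divide)
          then show "(2 * R + 3) * unit_ball_vol (real ?d) * 2 ^ ?d * diameter (U i) ^ (?d - 1)
              \<le> C * (v * (diameter (U i) / 2) ^ (?d - 1))" by simp
        qed
        also have "\<dots> = ennreal C * hausdorff_cost (?d - 1) (U i)"
          using False C by (simp add: hausdorff_cost_def v_def ennreal_mult')
        finally show ?thesis using T by blast
      qed
      then obtain T where T: "\<And>i. T i \<in> lmeasurable"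
        "\<And>i. tube (U i) \<subseteq> T i"
        "\<And>i. emeasure lebesgue (T i) \<le> ennreal C * hausdorff_cost (?d - 1) (U i)"
        by metis
      have "tube N \<subseteq> (\<Union>i. T i)"
      proof (rule order_trans[OF tube_UN])
        show "N \<subseteq> (\<Union>i. U i)" using U(1) by (simp add: hausdorff_covers_def)
      qed (intro UN_mono order_refl T(2))
      moreover have em: "emeasure lebesgue (\<Union>i. T i) \<le> ennreal e"
      proof -
        have "emeasure lebesgue (\<Union>i. T i) \<le> (\<Sum>i. emeasure lebesgue (T i))"
          using T(1) by (intro emeasure_subadditive_countably) (auto simp: fmeasurableD)
        also have "\<dots> \<le> (\<Sum>i. ennreal C * hausdorff_cost (?d - 1) (U i))"
          by (intro suminf_le T(3)) auto
        also have "\<dots> = ennreal C * (\<Sum>i. hausdorff_cost (?d - 1) (U i))"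
          by simp
        also have "\<dots> \<le> ennreal C * ennreal (e / C)"
          using U(2) by (intro mult_left_mono) auto
        also have "\<dots> = ennreal e"
          using C e by (simp flip: ennreal_mult')
        finally show ?thesis .
      qed
      moreover have "(\<Union>i. T i) \<in> lmeasurable"
        using T(1) em by (intro fmeasurableI) (auto intro: le_less_trans simp: fmeasurableD)
      moreover have "measure lebesgue (\<Union>i. T i) \<le> e"
        using em e by (simp add: measure_def enn2real_leI) 
      ultimately show "\<exists>T. tube N \<subseteq> T \<and> T \<in> lmeasurable \<and> measure lebesgue T \<le> e"
        by blast
    qed
  qed
qed

section \<open>Convex cells with a common face\<close>

text \<open>Negating both \<open>a\<close> and \<open>b\<close> describes the other side of the same
  hyperplane, so one notion serves both.\<close>

definition half_ball_in :: "'a::euclidean_space set \<Rightarrow> 'a \<Rightarrow> real \<Rightarrow> 'a \<Rightarrow> bool" where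
  "half_ball_in K a b p \<longleftrightarrow> (\<exists>r>0. ball p r \<inter> {x. b < a \<bullet> x} \<subseteq> K)"

text \<open>The cone with apex \<open>k\<close> over a disc in the hyperplane around
  \<open>p\<close> contains a half ball at \<open>p\<close>, and by convexity it lies in
  \<open>K\<close> apart from the disc.\<close>

lemma half_ball_inI:
  fixes K :: "'a::euclidean_space set"
  assumes K: "open K" "convex K" "k \<in> K" "b < a \<bullet> k"
    and p: "a \<bullet> p = b" and r: "r > 0" "ball p r \<inter> {x. a \<bullet> x = b} \<subseteq> closure K"
  shows "half_ball_in K a b p"
proof -
  \<comment> \<open>\<open>q x\<close> is the central projection of \<open>x\<close> from
    \<open>k\<close> onto the hyperplane, so \<open>x\<close> is the combination of
    \<open>q x\<close> and \<open>k\<close> with weights \<open>1 - s x\<close> and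
    \<open>s x\<close>. As \<open>x\<close> tends to \<open>p\<close>, so does
    \<open>q x\<close>.\<close>
  define s where "s x = (a \<bullet> x - b) / (a \<bullet> k - b)" for x
  define q where "q x = (1 / (1 - s x)) *\<^sub>R (x - s x *\<^sub>R k)" for x
  have sp: "s p = 0" by (simp add: s_def p)
  have cs: "isCont s p" unfolding s_def using K(4) by (intro continuous_intros) auto
  have "isCont q p" unfolding q_def by (intro continuous_intros cs) (simp add: sp)
  moreover have "q p = p" by (simp add: q_def sp)
  ultimately have "(q \<longlongrightarrow> p) (nhds p)"
    by (metis isCont_def tendsto_at_iff_tendsto_nhds)
  then have "\<forall>\<^sub>F x in nhds p. q x \<in> ball p r"
    using r by (intro topological_tendstoD) auto
  moreover have "(s \<longlongrightarrow> 0) (nhds p)"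
    using cs sp by (metis isCont_def tendsto_at_iff_tendsto_nhds)
  then have "\<forall>\<^sub>F x in nhds p. s x < 1"
    by (rule order_tendstoD(2)) simp
  ultimately have "\<forall>\<^sub>F x in nhds p. q x \<in> ball p r \<and> s x < 1"
    by (rule eventually_conj)
  then obtain r' where r': "r' > 0" "\<And>x. dist x p < r' \<Longrightarrow> q x \<in> ball p r \<and> s x < 1"
    unfolding eventually_nhds_metric by blast
  have "x \<in> K" if x: "x \<in> ball p r'" "b < a \<bullet> x" for x
  proof -
    have qs: "q x \<in> ball p r" "s x < 1"
      using r'(2)[of x] x by (auto simp: dist_commute)
    have s0: "s x > 0" using x K(4) by (simp add: s_def)
    have "s x * (a \<bullet> k - b) = a \<bullet> x - b"
      using K(4) by (simp add: s_def)
    then have "a \<bullet> x - s x * (a \<bullet> k) = (1 - s x) * b"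
      by (simp add: algebra_simps)
    then have "a \<bullet> q x = b"
      using qs by (simp add: q_def inner_diff_right)
    then have "q x \<in> closure K" using r qs by auto
    then have "q x - s x *\<^sub>R (q x - k) \<in> interior K"
      using K s0 qs by (intro mem_interior_closure_convex_shrink) (auto simp: interior_open)
    moreover have "q x - s x *\<^sub>R (q x - k) = (1 - s x) *\<^sub>R q x + s x *\<^sub>R k"
      by (simp add: algebra_simps)
    moreover have "(1 - s x) *\<^sub>R q x = x - s x *\<^sub>R k"
      using qs by (simp add: q_def)
    ultimately show "x \<in> K"
      using interior_subset by auto
  qed
  then show ?thesis
    using r' unfolding half_ball_in_def by blast
qed

lemma half_ball_in_either:
  fixes K :: "'a::euclidean_space set"
  assumes K: "open K" "convex K" "K \<noteq> {}" and a: "a \<noteq> 0"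
    and p: "a \<bullet> p = b" and r: "r > 0" "ball p r \<inter> {x. a \<bullet> x = b} \<subseteq> closure K"
  shows "half_ball_in K a b p \<or> half_ball_in K (- a) (- b) p"
proof -
  have "\<not> K \<subseteq> {x. a \<bullet> x = b}"
    using interior_mono[of K "{x. a \<bullet> x = b}"] K a by (auto simp: interior_open)
  then obtain k where k: "k \<in> K" "a \<bullet> k \<noteq> b" by blast
  then consider "b < a \<bullet> k" | "- b < (- a) \<bullet> k" by fastforce
  then show ?thesis
  proof cases
    case 1
    then show ?thesis using half_ball_inI[OF K(1,2) k(1) 1 p r] by blast
  next
    case 2
    then show ?thesis using half_ball_inI[OF K(1,2) k(1) 2 _ r(1)] p r(2) by simp
  qed
qed

lemma half_ball_in_not_disjoint:
  assumes "half_ball_in K a b p" "half_ball_in L a b p" "a \<noteq> 0" "a \<bullet> p = b"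
  shows "K \<inter> L \<noteq> {}"
proof -
  obtain r r' where r: "r > 0" "ball p r \<inter> {x. b < a \<bullet> x} \<subseteq> K" "r' > 0" "ball p r' \<inter> {x. b < a \<bullet> x} \<subseteq> L"
    using assms by (auto simp: half_ball_in_def)
  define e where "e = min r r' / (2 * norm a)"
  have e: "e > 0" using r assms by (simp add: e_def)
  have "norm (e *\<^sub>R a) = min r r' / 2"
    using e assms r by (simp add: e_def)
  then have "norm (e *\<^sub>R a) < r" "norm (e *\<^sub>R a) < r'"
    using r by linarith+
  then have "p + e *\<^sub>R a \<in> ball p r \<inter> ball p r'"
    by (simp add: dist_norm)
  moreover have "b < a \<bullet> (p + e *\<^sub>R a)"
    using assms e by (simp add: inner_add_right)
  ultimately show ?thesis using r by blast
qed

text \<open>Disjoint cells cannot occupy the same side of a common disc, so they occupy opposite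
  sides, and their closures together with the disc fill a ball.\<close>

lemma half_balls_cover:
  fixes K L :: "'a::euclidean_space set"
  assumes "open K" "convex K" "K \<noteq> {}" "open L" "convex L" "L \<noteq> {}" "K \<inter> L = {}" "a \<noteq> 0"
    and p: "a \<bullet> p = b" and r: "r > 0" "ball p r \<inter> {x. a \<bullet> x = b} \<subseteq> closure K \<inter> closure L"
  shows "p \<in> interior (closure K \<union> closure L)"
proof -
  have "\<exists>r'>0. ball p r' \<subseteq> closure A \<union> closure B"
    if AB: "half_ball_in A a b p" "half_ball_in B (- a) (- b) p" "A = K \<and> B = L \<or> A = L \<and> B = K" for A B
  proof -
    obtain s s' where s: "s > 0" "ball p s \<inter> {x. b < a \<bullet> x} \<subseteq> A" "s' > 0" "ball p s' \<inter> {x. a \<bullet> x < b} \<subseteq> B"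
      using AB(1,2) unfolding half_ball_in_def inner_minus_left neg_less_iff_less by blast
    have "x \<in> closure A \<union> closure B" if "x \<in> ball p (min r (min s s'))" for x
    proof -
      have "x \<in> ball p r" "x \<in> ball p s" "x \<in> ball p s'" using that by auto
      moreover have "A \<subseteq> closure A" "B \<subseteq> closure B" by (auto simp: closure_subset)
      ultimately show ?thesis
        using s r AB(3) by (cases "a \<bullet> x" b rule: linorder_cases) blast+
    qed
    moreover have "0 < min r (min s s')" using s r by simp
    ultimately show ?thesis by blast
  qed
  moreover have "half_ball_in K a b p \<or> half_ball_in K (- a) (- b) p" "half_ball_in L a b p \<or> half_ball_in L (- a) (- b) p"
    by (intro half_ball_in_either[OF _ _ _ _ p r(1)]; use assms in blast)+
  moreover have "\<not> (half_ball_in K a b p \<and> half_ball_in L a b p)" "\<not> (half_ball_in K (- a) (- b) p \<and> half_ball_in L (- a) (- b) p)"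
    using half_ball_in_not_disjoint[of K a b p L] half_ball_in_not_disjoint[of K "- a" "- b" p L] assms by auto
  ultimately have "\<exists>r'>0. ball p r' \<subseteq> closure K \<union> closure L"
    by (metis Un_commute)
  then show ?thesis by (simp add: mem_interior)
qed

text \<open>A pigeonhole argument: three pairwise disjoint cells, but two sides of the disc.\<close>

lemma no_third_cell:
  fixes K L J :: "'a::euclidean_space set"
  assumes "open K" "convex K" "K \<noteq> {}" "open L" "convex L" "L \<noteq> {}" "open J" "convex J" "J \<noteq> {}"
    and dis: "K \<inter> L = {}" "K \<inter> J = {}" "L \<inter> J = {}" and a: "a \<noteq> 0"
    and p: "a \<bullet> p = b" and r: "r > 0" "ball p r \<inter> {x. a \<bullet> x = b} \<subseteq> closure K \<inter> closure L \<inter> closure J"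
  shows False
proof -
  have "half_ball_in K a b p \<or> half_ball_in K (- a) (- b) p" "half_ball_in L a b p \<or> half_ball_in L (- a) (- b) p"
    "half_ball_in J a b p \<or> half_ball_in J (- a) (- b) p"
    by (intro half_ball_in_either[OF _ _ _ _ p r(1)]; use assms in blast)+
  moreover have "- a \<noteq> 0" "(- a) \<bullet> p = - b" using a p by auto
  ultimately show False
    using dis a p half_ball_in_not_disjoint by metis
qed

text \<open>Positive surface measure excludes affine dimension \<open>d - 2\<close> or less, so
  \<open>S\<close> spans its hyperplane and relative interior means interior within the
  hyperplane.\<close>

lemma face_disc:
  fixes S :: "'a::euclidean_space set"
  assumes dim: "DIM('a) \<le> 3" and S: "bounded S" "surface_outer S \<noteq> 0" and a: "a \<noteq> 0" and Sa: "S \<subseteq> {x. a \<bullet> x = b}"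
    and p: "p \<in> rel_interior S"
  shows "\<exists>r>0. ball p r \<inter> {x. a \<bullet> x = b} \<subseteq> S"
proof -
  have "aff_dim S > int DIM('a) - 2"
    using surface_outer_lowdim[OF dim S(1)] S(2) by linarith
  moreover have "aff_dim S \<le> aff_dim {x. a \<bullet> x = b}"
    by (rule aff_dim_subset[OF Sa])
  moreover have "aff_dim {x. a \<bullet> x = b} = int DIM('a) - 1"
    using a by (simp add: aff_dim_hyperplane of_nat_diff)
  ultimately have "aff_dim (affine hull S) = aff_dim {x. a \<bullet> x = b}"
    by (simp add: aff_dim_affine_hull)
  moreover have "affine hull S \<subseteq> {x. a \<bullet> x = b}"
    using Sa affine_hyperplane by (rule hull_minimal)
  moreover have "affine hull S \<noteq> {}" using p rel_interior_subset by auto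
  ultimately have "affine hull S = {x. a \<bullet> x = b}"
    using affine_affine_hull affine_hyperplane by (intro affine_dim_equal) auto
  then show ?thesis
    using p by (auto simp: mem_rel_interior_ball)
qed

text \<open>The relative boundary consists of finitely many facets, each of codimension at least two
  in the space.\<close>

lemma polyhedron_surface_rel_frontier:
  fixes S :: "'a::euclidean_space set"
  assumes dim: "DIM('a) \<le> 3" and S: "polyhedron S" "bounded S" and a: "a \<noteq> 0" "S \<subseteq> {x. a \<bullet> x = b}"
  shows "surface_outer (rel_frontier S) = 0"
proof -
  have "surface_outer F = 0" if F: "F facet_of S" for F
  proof (rule surface_outer_lowdim[OF dim])
    show "bounded F" using F S(2) by (meson bounded_subset facet_of_imp_subset)
    have "aff_dim S \<le> int DIM('a) - 1"
      using aff_dim_subset[OF a(2)] a(1) by (simp add: aff_dim_hyperplane of_nat_diff)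
    then show "aff_dim F \<le> int DIM('a) - 2"
      using F by (simp add: facet_of_def)
  qed
  moreover have "rel_frontier S = (\<Union>F\<in>{F. F facet_of S}. F)"
    using rel_frontier_of_polyhedron[OF S(1)] by simp
  ultimately show ?thesis
    using finite_polyhedron_facets[OF S(1)] by (simp only:) (rule hausdorff_outer_Union_null, auto)
qed

text \<open>The domain has no slits or punctures: below every boundary point there are points with a
  neighbourhood free of \<Omega>. This is what places open cells, and relative interiors of common
  faces, inside \<Omega>.\<close>

lemma lipschitz_boundary_interior_closure:
  fixes \<Omega> :: "'a::euclidean_space set"
  assumes \<Omega>: "open \<Omega>" "lipschitz_boundary \<Omega>"
  shows "interior (closure \<Omega>) = \<Omega>"
proof
  show "\<Omega> \<subseteq> interior (closure \<Omega>)"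
    using \<Omega> by (simp add: interior_maximal closure_subset)
  show "interior (closure \<Omega>) \<subseteq> \<Omega>"
  proof (rule ccontr)
    assume "\<not> interior (closure \<Omega>) \<subseteq> \<Omega>"
    then obtain x where x: "x \<in> interior (closure \<Omega>)" "x \<notin> \<Omega>" by blast
    have "x \<in> closure \<Omega>" using x(1) interior_subset by blast
    then have "x \<in> frontier \<Omega>"
      using x(2) \<Omega>(1) by (simp add: frontier_def interior_open)
    then obtain r e L g where r: "r > 0" and e: "norm e = 1"
      and g: "L-lipschitz_on {z. z \<bullet> e = 0} (g :: 'a \<Rightarrow> real)"
      and eq: "\<Omega> \<inter> ball x r = {y \<in> ball x r. g (y - (y \<bullet> e) *\<^sub>R e) < y \<bullet> e}"
      using \<Omega>(2) unfolding lipschitz_boundary_def by blast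
    define \<pi> where "\<pi> y = y - (y \<bullet> e) *\<^sub>R e" for y
    have ee: "e \<bullet> e = 1" using e by (simp add: norm_eq_1)
    define f where "f y = g (\<pi> y) - y \<bullet> e" for y
    have cf: "continuous_on UNIV f"
    proof -
      have "continuous_on UNIV (\<lambda>y. g (\<pi> y))"
      proof (rule continuous_on_compose2[OF lipschitz_on_continuous_on[OF g]])
        show "continuous_on UNIV \<pi>" unfolding \<pi>_def by (intro continuous_intros)
        show "range \<pi> \<subseteq> {z. z \<bullet> e = 0}"
          by (auto simp: \<pi>_def inner_diff_left ee)
      qed
      then show ?thesis unfolding f_def by (intro continuous_intros)
    qed
    have "x \<notin> {y \<in> ball x r. g (y - (y \<bullet> e) *\<^sub>R e) < y \<bullet> e}"
      using x(2) unfolding eq[symmetric] by blast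
    then have fx: "f x \<ge> 0"
      using r by (simp add: f_def \<pi>_def not_less)
    obtain s where s: "s > 0" "ball x s \<subseteq> closure \<Omega>"
      using x(1) by (auto simp: mem_interior)
    define t where "t = min r s / 2"
    have t: "t > 0" "t < r" "t < s" using r s by (auto simp: t_def)
    \<comment> \<open>Moving against \<open>e\<close> keeps the projection and lowers the height, so
      \<open>f\<close> becomes strictly positive, while \<open>t < s\<close> keeps \<open>y\<close>
      in the ball that was assumed to lie in the closure.\<close>
    define y where "y = x - t *\<^sub>R e"
    have "\<pi> y = \<pi> x" by (simp add: \<pi>_def y_def inner_diff_left ee algebra_simps)
    moreover have "y \<bullet> e = x \<bullet> e - t" by (simp add: y_def inner_diff_left ee)
    ultimately have fy: "f y > 0" using fx t by (simp add: f_def)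
    have yb: "y \<in> ball x r" "y \<in> ball x s"
      using t e by (auto simp: y_def dist_norm)
    have "open ({y. f y > 0} \<inter> ball x r)"
      using cf by (intro open_Int open_ball open_Collect_less continuous_on_const)
    moreover have "y \<in> {y. f y > 0} \<inter> ball x r" using fy yb by simp
    moreover have "{y. f y > 0} \<inter> ball x r \<inter> \<Omega> = {}"
    proof -
      have "\<not> f y > 0" if "y \<in> \<Omega> \<inter> ball x r" for y
        using that unfolding eq by (simp add: f_def \<pi>_def)
      then show ?thesis by blast
    qed
    ultimately have "y \<notin> closure \<Omega>"
      by (metis disjoint_iff open_Int_closure_eq_empty)
    with s(2) yb(2) show False by blast
  qed
qed

section \<open>Admissible meshes\<close>

locale fv_domain =
  fixes \<Omega> \<Gamma>D \<Gamma>N :: "'a::euclidean_space set" and M :: "'a fv_mesh"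
  assumes dim: "DIM('a) \<le> 3"
    and \<Omega>: "open \<Omega>" "connected \<Omega>" "bounded \<Omega>" "lipschitz_boundary \<Omega>"
    and boundary: "boundary_splitting \<Omega> \<Gamma>D \<Gamma>N"
    and mesh: "admissible_mesh \<Omega> \<Gamma>D \<Gamma>N M"
begin

lemma finite_mesh: "finite (cells M)" "finite (faces M)"
  and cell_all: "\<forall>K\<in>cells M. K \<noteq> {} \<and> open K \<and> convex K \<and> polyhedron (closure K)"
  and cells_disjoint_all: "\<forall>K\<in>cells M. \<forall>L\<in>cells M. K \<noteq> L \<longrightarrow> K \<inter> L = {}"
  and closure_cells: "(\<Union>K\<in>cells M. closure K) = closure \<Omega>"
  and face_all: "\<forall>\<sigma>\<in>faces M. closed \<sigma> \<and> (\<exists>a b. a \<noteq> 0 \<and> \<sigma> \<subseteq> {x. a \<bullet> x = b}) \<and> face_meas \<sigma> > 0"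
  and face_overlap_all: "\<forall>\<sigma>\<in>faces M. \<forall>\<sigma>'\<in>faces M. \<sigma> \<noteq> \<sigma>' \<longrightarrow> surface_outer (\<sigma> \<inter> \<sigma>') = 0"
  and cfaces_all: "\<forall>K\<in>cells M. cfaces M K \<subseteq> faces M \<and> frontier K = \<Union>(cfaces M K)"
  and faces_cfaces: "(\<Union>K\<in>cells M. cfaces M K) = faces M"
  and closures_meet_all: "\<forall>K\<in>cells M. \<forall>L\<in>cells M. K \<noteq> L \<longrightarrow>
        closure K \<inter> closure L \<in> faces M \<or> surface_outer (closure K \<inter> closure L) = 0"
  and faces_int_ext: "faces M = int_faces M \<union> ext_faces \<Omega> M"
  and ctr_all: "\<forall>K\<in>cells M. ctr M K \<in> K" and inj_ctr: "inj_on (ctr M) (cells M)"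
  and ext_face_all: "\<forall>\<sigma>\<in>ext_faces \<Omega> M. \<sigma> \<subseteq> \<Gamma>D \<or> \<sigma> \<subseteq> closure \<Gamma>N"
  and fctr_all: "\<forall>K\<in>cells M. \<forall>\<sigma>\<in>cfaces M K \<inter> ext_faces \<Omega> M.
        fctr M \<sigma> \<in> \<sigma> \<and> (\<forall>y\<in>\<sigma>. \<forall>z\<in>\<sigma>. orthogonal (fctr M \<sigma> - ctr M K) (y - z))"
  using mesh[unfolded admissible_mesh_def] by satx+

lemmas cell = cell_all[rule_format]
  and cells_disjoint = cells_disjoint_all[rule_format]
  and face = face_all[rule_format]
  and face_overlap = face_overlap_all[rule_format]
  and cfaces = cfaces_all[rule_format]
  and closures_meet = closures_meet_all[rule_format]
  and ext_face_cases = ext_face_all[rule_format]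

lemma ctr: "K \<in> cells M \<Longrightarrow> ctr M K \<in> K" "inj_on (ctr M) (cells M)"
  using ctr_all inj_ctr by blast+

lemma fctr: "K \<in> cells M \<Longrightarrow> \<sigma> \<in> cfaces M K \<Longrightarrow> \<sigma> \<in> ext_faces \<Omega> M \<Longrightarrow> fctr M \<sigma> \<in> \<sigma>"
  using fctr_all by blast

lemma interior_closure: "interior (closure \<Omega>) = \<Omega>"
  using \<Omega> by (intro lipschitz_boundary_interior_closure)

lemma cell_subset: "K \<in> cells M \<Longrightarrow> K \<subseteq> \<Omega>"
proof -
  assume K: "K \<in> cells M"
  then have "K \<subseteq> closure \<Omega>" using closure_cells closure_subset by blast
  then show "K \<subseteq> \<Omega>"
    using interior_maximal[of K "closure \<Omega>"] cell[OF K] interior_closure by simp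
qed

lemma cell_bounded: "K \<in> cells M \<Longrightarrow> bounded K"
  using cell_subset \<Omega>(3) bounded_subset by blast

lemma frontier_cell: "K \<in> cells M \<Longrightarrow> frontier K = closure K - K"
  using cell by (simp add: frontier_def interior_open)

lemma face_subset_closure: "K \<in> cells M \<Longrightarrow> \<sigma> \<in> cfaces M K \<Longrightarrow> \<sigma> \<subseteq> closure K"
  using cfaces[of K] frontier_cell[of K] by blast

lemma face_surface: "\<sigma> \<in> faces M \<Longrightarrow> surface_outer \<sigma> \<noteq> 0"
  using face by (fastforce simp: face_meas_def)

text \<open>The intersection of the closures contains a face, so it is not null and hence a face
  itself. Two faces whose overlap is not null coincide.\<close>

lemma shared_face:
  assumes "K \<in> cells M" "L \<in> cells M" "K \<noteq> L" "\<sigma> \<in> cfaces M K" "\<sigma> \<in> cfaces M L"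
  shows "\<sigma> = closure K \<inter> closure L"
proof -
  have \<sigma>: "\<sigma> \<in> faces M" using cfaces assms by blast
  have sub: "\<sigma> \<subseteq> closure K \<inter> closure L"
    using assms face_subset_closure by blast
  then have "surface_outer (closure K \<inter> closure L) \<noteq> 0"
    using face_surface[OF \<sigma>] hausdorff_outer_subset_null by blast
  then have "closure K \<inter> closure L \<in> faces M"
    using closures_meet assms by blast
  moreover have "\<sigma> \<inter> (closure K \<inter> closure L) = \<sigma>" using sub by blast
  ultimately show ?thesis
    using face_overlap[OF \<sigma>] face_surface[OF \<sigma>] by metis
qed

text \<open>Admissibility does not say outright that \<open>K|L\<close> is listed among the faces of
  \<open>K\<close>. If it were not, the listed faces would cover it by null overlaps.\<close>

lemma common_face_in_cfaces:
  assumes "K \<in> cells M" "L \<in> cells M" "K \<noteq> L" and \<sigma>: "closure K \<inter> closure L \<in> faces M"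
  shows "closure K \<inter> closure L \<in> cfaces M K"
proof (rule ccontr)
  assume n: "closure K \<inter> closure L \<notin> cfaces M K"
  let ?s = "closure K \<inter> closure L"
  have "K \<inter> closure L = {}"
    using cells_disjoint[OF assms(1-3)] cell[OF assms(1)] open_Int_closure_eq_empty by blast
  then have "?s \<subseteq> frontier K"
    using frontier_cell assms by blast
  then have "?s \<subseteq> (\<Union>\<sigma>\<in>cfaces M K. ?s \<inter> \<sigma>)"
    using cfaces[OF assms(1)] by auto
  moreover have "surface_outer (\<Union>\<sigma>\<in>cfaces M K. ?s \<inter> \<sigma>) = 0"
  proof (rule hausdorff_outer_Union_null)
    show "finite (cfaces M K)"
      using cfaces[OF assms(1)] finite_mesh(2) finite_subset by blast
    show "surface_outer (?s \<inter> \<sigma>') = 0" if "\<sigma>' \<in> cfaces M K" for \<sigma>'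
      using face_overlap[OF \<sigma>, of \<sigma>'] cfaces[OF assms(1)] that n by blast
  qed
  ultimately show False
    using face_surface[OF \<sigma>] hausdorff_outer_subset_null by blast
qed

lemma common_face_disc:
  assumes "K \<in> cells M" "L \<in> cells M" and \<sigma>: "closure K \<inter> closure L \<in> faces M"
    and p: "p \<in> rel_interior (closure K \<inter> closure L)"
  shows "\<exists>a b r. a \<noteq> 0 \<and> a \<bullet> p = b \<and> r > 0 \<and> ball p r \<inter> {x. a \<bullet> x = b} \<subseteq> closure K \<inter> closure L"
proof -
  obtain a b where ab: "a \<noteq> 0" "closure K \<inter> closure L \<subseteq> {x. a \<bullet> x = b}"
    using face[OF \<sigma>] by blast
  have "bounded (closure K \<inter> closure L)"
    using cell_bounded[OF assms(1)] by (meson bounded_closure bounded_Int)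
  from face_disc[OF dim this face_surface[OF \<sigma>] ab p]
  obtain r where "r > 0" "ball p r \<inter> {x. a \<bullet> x = b} \<subseteq> closure K \<inter> closure L" by blast
  moreover have "a \<bullet> p = b" using p ab rel_interior_subset by blast
  ultimately show ?thesis using ab by blast
qed

lemma common_face_interior:
  assumes "K \<in> cells M" "L \<in> cells M" "K \<noteq> L" and \<sigma>: "closure K \<inter> closure L \<in> faces M"
  shows "rel_interior (closure K \<inter> closure L) \<subseteq> \<Omega>"
proof
  fix p assume "p \<in> rel_interior (closure K \<inter> closure L)"
  from common_face_disc[OF assms(1,2) \<sigma> this] obtain a b r
    where "a \<noteq> 0" "a \<bullet> p = b" "r > 0" "ball p r \<inter> {x. a \<bullet> x = b} \<subseteq> closure K \<inter> closure L"
    by blast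
  then have "p \<in> interior (closure K \<union> closure L)"
    using cell[OF assms(1)] cell[OF assms(2)] cells_disjoint[OF assms(1-3)]
    by (intro half_balls_cover) auto
  moreover have "closure K \<union> closure L \<subseteq> closure \<Omega>"
    using closure_cells assms by blast
  ultimately show "p \<in> \<Omega>"
    using interior_mono interior_closure by blast
qed

lemma common_face_rel_interior:
  assumes "K \<in> cells M" "L \<in> cells M" and \<sigma>: "closure K \<inter> closure L \<in> faces M"
  shows "rel_interior (closure K \<inter> closure L) \<noteq> {}"
proof -
  have "convex (closure K \<inter> closure L)"
    using cell assms by (intro convex_Int convex_closure) auto
  moreover have "closure K \<inter> closure L \<noteq> {}"
    using face_surface[OF \<sigma>] by auto
  ultimately show ?thesis by (simp add: rel_interior_eq_empty)
qed

text \<open>Makes the definite description in \<open>nbr\<close> meaningful: a third cell at the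
  same face would need a third side.\<close>

lemma neighbour_unique:
  assumes "K \<in> cells M" "L \<in> cells M" "J \<in> cells M" "K \<noteq> L" "K \<noteq> J"
    and \<sigma>: "closure K \<inter> closure L \<in> faces M" and eq: "closure K \<inter> closure J = closure K \<inter> closure L"
  shows "J = L"
proof (rule ccontr)
  assume "J \<noteq> L"
  obtain p where "p \<in> rel_interior (closure K \<inter> closure L)"
    using common_face_rel_interior[OF assms(1,2) \<sigma>] by blast
  from common_face_disc[OF assms(1,2) \<sigma> this] obtain a b r
    where r: "a \<noteq> 0" "a \<bullet> p = b" "r > 0" "ball p r \<inter> {x. a \<bullet> x = b} \<subseteq> closure K \<inter> closure L"
    by blast
  have "ball p r \<inter> {x. a \<bullet> x = b} \<subseteq> closure K \<inter> closure L \<inter> closure J"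
    using r(4) eq by blast
  then show False
    using no_third_cell[of K L J a p b r] cell[OF assms(1)] cell[OF assms(2)] cell[OF assms(3)]
      cells_disjoint[OF assms(1,2,4)] cells_disjoint[OF assms(1,3,5)] cells_disjoint[OF assms(2,3)] \<open>J \<noteq> L\<close> r
    by blast
qed

lemma nbr_eq:
  assumes "K \<in> cells M" "L \<in> cells M" "K \<noteq> L" "closure K \<inter> closure L \<in> faces M"
  shows "nbr M K (closure K \<inter> closure L) = L"
  unfolding nbr_def
proof (rule the_equality)
  show "L \<in> cells M \<and> L \<noteq> K \<and> closure K \<inter> closure L = closure K \<inter> closure L"
    using assms by blast
  show "J = L" if "J \<in> cells M \<and> J \<noteq> K \<and> closure K \<inter> closure J = closure K \<inter> closure L" for J
    using neighbour_unique[of K L J] assms that by blast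
qed

section \<open>Interior faces, exterior faces and transmissibilities\<close>

lemma int_face_of_cell:
  assumes "K \<in> cells M" "\<sigma> \<in> cfaces M K" "\<sigma> \<in> int_faces M"
  obtains L where "L \<in> cells M" "L \<noteq> K" "\<sigma> = closure K \<inter> closure L" "nbr M K \<sigma> = L"
proof -
  obtain A B where AB: "A \<in> cells M" "B \<in> cells M" "A \<noteq> B" "\<sigma> = closure A \<inter> closure B" "\<sigma> \<in> faces M"
    using assms(3) by (auto simp: int_faces_def)
  have "\<sigma> \<in> cfaces M A" "\<sigma> \<in> cfaces M B"
    using common_face_in_cfaces[of A B] common_face_in_cfaces[of B A] AB by (auto simp: Int_commute)
  moreover have "A \<noteq> K \<or> B \<noteq> K" using AB(3) by blast
  ultimately obtain L where L: "L \<in> cells M" "L \<noteq> K" "\<sigma> \<in> cfaces M L" using AB by blast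
  then have "\<sigma> = closure K \<inter> closure L"
    using shared_face[OF assms(1) L(1)] assms(2) by auto
  then show ?thesis
    using that[OF L(1,2)] nbr_eq[OF assms(1) L(1)] L AB(5) by auto
qed

lemma int_face_not_ext: "\<sigma> \<in> int_faces M \<Longrightarrow> \<not> \<sigma> \<subseteq> frontier \<Omega>"
proof
  assume "\<sigma> \<in> int_faces M" and f: "\<sigma> \<subseteq> frontier \<Omega>"
  then obtain A B where AB: "A \<in> cells M" "B \<in> cells M" "A \<noteq> B" "\<sigma> = closure A \<inter> closure B" "\<sigma> \<in> faces M"
    by (auto simp: int_faces_def)
  obtain p where p: "p \<in> rel_interior (closure A \<inter> closure B)"
    using common_face_rel_interior[of A B] AB by auto
  then have "p \<in> \<Omega>" using common_face_interior[of A B] AB by auto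
  moreover have "p \<in> frontier \<Omega>" using p f AB(4) rel_interior_subset by blast
  ultimately show False using \<Omega>(1) by (simp add: frontier_def interior_open)
qed

lemma int_dir_disjoint: "int_faces M \<inter> dir_faces \<Gamma>D M = {}"
  using int_face_not_ext boundary unfolding boundary_splitting_def dir_faces_def by blast

lemma ext_face_single_cell:
  assumes "K \<in> cells M" "L \<in> cells M" "\<sigma> \<in> cfaces M K" "\<sigma> \<in> cfaces M L" "\<sigma> \<notin> int_faces M"
  shows "K = L"
proof (rule ccontr)
  assume "K \<noteq> L"
  then have "\<sigma> = closure K \<inter> closure L" using shared_face assms by blast
  then have "\<sigma> \<in> int_faces M"
    using assms cfaces[OF assms(1)] \<open>K \<noteq> L\<close> unfolding int_faces_def by blast
  with assms(5) show False ..
qed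

lemma owner: "\<sigma> \<in> faces M \<Longrightarrow> owner M \<sigma> \<in> cells M \<and> \<sigma> \<in> cfaces M (owner M \<sigma>)"
proof -
  assume "\<sigma> \<in> faces M"
  then have "\<exists>K. K \<in> cells M \<and> \<sigma> \<in> cfaces M K" using faces_cfaces by blast
  then show ?thesis unfolding owner_def by (rule someI_ex)
qed

text \<open>The distance is positive on interior faces because centers are distinct, and on exterior
  faces because the center lies in the open cell while the face point lies on its frontier.\<close>

lemma transm_pos:
  assumes \<sigma>: "\<sigma> \<in> faces M"
  shows "transm M \<sigma> > 0"
proof -
  let ?K = "owner M \<sigma>"
  have K: "?K \<in> cells M" "\<sigma> \<in> cfaces M ?K" using owner[OF \<sigma>] by auto
  have "face_dist M \<sigma> > 0"
  proof (cases "\<sigma> \<in> int_faces M")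
    case True
    then obtain L where "L \<in> cells M" "L \<noteq> ?K" "nbr M ?K \<sigma> = L"
      using int_face_of_cell[OF K] by metis
    then have "ctr M ?K \<noteq> ctr M (nbr M ?K \<sigma>)"
      using ctr(2) K by (auto dest: inj_onD)
    then show ?thesis using True by (simp add: face_dist_def Let_def)
  next
    case False
    then have "\<sigma> \<in> ext_faces \<Omega> M" using \<sigma> faces_int_ext by blast
    then have "fctr M \<sigma> \<in> frontier ?K"
      using fctr[OF K] cfaces[OF K(1)] K(2) by blast
    then have "fctr M \<sigma> \<notin> ?K"
      unfolding frontier_cell[OF K(1)] by simp
    then have "ctr M ?K \<noteq> fctr M \<sigma>"
      using ctr(1)[OF K(1)] by metis
    then show ?thesis using False by (simp add: face_dist_def Let_def)
  qed
  then show ?thesis using face[OF \<sigma>] by (simp add: transm_def)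
qed

lemma cells_linked:
  assumes A: "A \<subseteq> cells M" "A \<noteq> {}" "A \<noteq> cells M"
  shows "\<exists>K\<in>A. \<exists>L\<in>cells M - A. closure K \<inter> closure L \<in> faces M"
proof (rule ccontr)
  assume contra: "\<not> ?thesis"
  define CA where "CA = (\<Union>K\<in>A. closure K)"
  define CB where "CB = (\<Union>K\<in>cells M - A. closure K)"
  have "finite A" by (rule finite_subset[OF A(1) finite_mesh(1)])
  then have "closed CA" unfolding CA_def by (intro closed_UN ballI closed_closure)
  have "closed CB" unfolding CB_def using finite_mesh(1) by (intro closed_UN ballI closed_closure) simp
  have inA: "closure K \<subseteq> CA" if "K \<in> A" for K
    using that by (auto simp: CA_def)
  have inB: "closure K \<subseteq> CB" if "K \<in> cells M" "K \<notin> A" for K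
    using that by (auto simp: CB_def)
  have cov: "\<Omega> \<subseteq> CA \<union> CB"
  proof
    fix x assume "x \<in> \<Omega>"
    then have "x \<in> (\<Union>K\<in>cells M. closure K)"
      using closure_cells closure_subset[of \<Omega>] by blast
    then obtain K where "K \<in> cells M" "x \<in> closure K" by blast
    then show "x \<in> CA \<union> CB" using inA[of K] inB[of K] by blast
  qed
  have ne: "C \<inter> \<Omega> \<noteq> {}" if "K \<in> cells M" "closure K \<subseteq> C" for K C
    using cell[OF that(1)] cell_subset[OF that(1)] closure_subset[of K] that(2) by blast
  obtain K0 L0 where K0: "K0 \<in> A" and L0: "L0 \<in> cells M" "L0 \<notin> A" using A by blast
  have "CA \<inter> \<Omega> \<noteq> {}" using ne[OF _ inA[OF K0]] K0 A(1) by blast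
  moreover have "CB \<inter> \<Omega> \<noteq> {}" using ne[OF L0(1) inB[OF L0]] .
  \<comment> \<open>Used twice: for \<Omega>, to find one meeting point, and below for each single
    segment.\<close>
  moreover have meet: "CA \<inter> CB \<inter> S \<noteq> {}"
    if "connected S" "S \<subseteq> CA \<union> CB" "CA \<inter> S \<noteq> {}" "CB \<inter> S \<noteq> {}" for S
    using that \<open>closed CA\<close> \<open>closed CB\<close> unfolding connected_closed by metis
  ultimately have "CA \<inter> CB \<inter> \<Omega> \<noteq> {}"
    using \<Omega>(2) cov by metis
  then obtain p where p: "p \<in> \<Omega>" "p \<in> CA" "p \<in> CB" by blast
  \<comment> \<open>The ball is convex and lies in \<Omega>, so segments between its points remain
    where \<open>CA\<close> and \<open>CB\<close> cover everything.\<close>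
  obtain r where r: "r > 0" "ball p r \<subseteq> \<Omega>" using p(1) \<Omega>(1) open_contains_ball by blast
  obtain K L where K: "K \<in> A" "p \<in> closure K" and L: "L \<in> cells M - A" "p \<in> closure L"
    using p(2,3) by (auto simp: CA_def CB_def)
  have KL: "K \<in> cells M" "L \<in> cells M" "K \<noteq> L" using K L A by auto
  have "ball p r \<inter> K \<noteq> {}" "ball p r \<inter> L \<noteq> {}"
    using open_Int_closure_eq_empty[OF open_ball, of p r K] open_Int_closure_eq_empty[OF open_ball, of p r L]
      K(2) L(2) centre_in_ball[of p r] r(1) by blast+
  then obtain x y where x: "x \<in> ball p r" "x \<in> K" and y: "y \<in> ball p r" "y \<in> L" by blast
  have "open (ball p r \<inter> K)" "open (ball p r \<inter> L)" using cell KL by auto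
  then obtain e1 e2 where e12: "e1 > 0" "ball x e1 \<subseteq> ball p r \<inter> K" "e2 > 0" "ball y e2 \<subseteq> ball p r \<inter> L"
    using IntI[OF x] IntI[OF y] unfolding open_contains_ball by metis
  define e where "e = min e1 e2"
  have e: "e > 0" "ball x e \<subseteq> ball p r \<inter> K" "ball y e \<subseteq> ball p r \<inter> L"
    using e12 subset_ball[of e e1 x] subset_ball[of e e2 y] by (auto simp: e_def)
  have "x \<noteq> y" using x y cells_disjoint[OF KL] by blast
  define R where "R = norm (y - x)"
  define u where "u = (1 / R) *\<^sub>R (y - x)"
  have R: "R > 0" using \<open>x \<noteq> y\<close> by (simp add: R_def)
  have u: "norm u = 1" "R *\<^sub>R u = y - x" using R by (simp_all add: u_def R_def)
  have null: "surface_outer (CA \<inter> CB) = 0"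
  proof -
    have "CA \<inter> CB \<subseteq> (\<Union>(K, L)\<in>A \<times> (cells M - A). closure K \<inter> closure L)"
      by (auto simp: CA_def CB_def)
    moreover have "surface_outer (\<Union>(K, L)\<in>A \<times> (cells M - A). closure K \<inter> closure L) = 0"
    proof (rule hausdorff_outer_Union_null)
      show "finite (A \<times> (cells M - A))" using \<open>finite A\<close> finite_mesh by blast
      fix i assume "i \<in> A \<times> (cells M - A)"
      then obtain K L where i: "i = (K, L)" "K \<in> A" "L \<in> cells M - A" by blast
      then have "surface_outer (closure K \<inter> closure L) = 0"
        using contra closures_meet[of K L] A by blast
      then show "surface_outer (case i of (K, L) \<Rightarrow> closure K \<inter> closure L) = 0"
        using i(1) by simp
    qed
    ultimately show ?thesis using hausdorff_outer_subset_null by blast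
  qed
  text \<open>The segments in direction \<open>u\<close> from the ball around \<open>x\<close> to the ball around \<open>y\<close> all cross
    \<open>CA \<inter> CB\<close>, whose shadow in direction \<open>u\<close> is therefore not negligible.\<close>
  have "ball x e \<subseteq> {z + s *\<^sub>R u |z s. z \<in> CA \<inter> CB \<and> \<bar>s\<bar> \<le> R}"
  proof
    fix z assume z: "z \<in> ball x e"
    have "z + R *\<^sub>R u \<in> ball y e" using z by (simp add: u dist_norm algebra_simps)
    with z e have zb: "z \<in> ball p r" "z + R *\<^sub>R u \<in> ball p r" "z \<in> K" "z + R *\<^sub>R u \<in> L" by auto
    then have "z \<in> CA" "z + R *\<^sub>R u \<in> CB"
      using inA[OF K(1)] inB[of L] L(1) closure_subset[of K] closure_subset[of L] by blast+
    moreover have seg: "closed_segment z (z + R *\<^sub>R u) \<subseteq> ball p r"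
      using zb by (intro closed_segment_subset) auto
    ultimately have "CA \<inter> CB \<inter> closed_segment z (z + R *\<^sub>R u) \<noteq> {}"
      using cov r(2) ends_in_segment[of z "z + R *\<^sub>R u"] by (intro meet connected_segment) blast+
    then obtain q where q: "q \<in> CA \<inter> CB" "q \<in> closed_segment z (z + R *\<^sub>R u)" by blast
    then obtain v where v: "0 \<le> v" "v \<le> 1" "q = (1 - v) *\<^sub>R z + v *\<^sub>R (z + R *\<^sub>R u)"
      by (auto simp: closed_segment_def)
    have "z = q + (- (v * R)) *\<^sub>R u" using v by (simp add: algebra_simps)
    moreover have "\<bar>- (v * R)\<bar> \<le> R" using v R by (simp add: abs_mult mult_left_le_one_le)
    ultimately show "z \<in> {z + s *\<^sub>R u |z s. z \<in> CA \<inter> CB \<and> \<bar>s\<bar> \<le> R}" using q(1) by blast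
  qed
  then have "negligible (ball x e)"
    using negligible_tube[OF null u(1) R] negligible_subset by blast
  then show False using e(1) open_not_negligible[of "ball x e"] by auto
qed

lemma dirichlet_face: "dir_faces \<Gamma>D M \<noteq> {}"
proof
  assume none: "dir_faces \<Gamma>D M = {}"
  have "\<Gamma>D - closure \<Gamma>N \<subseteq> (\<Union>\<sigma>\<in>int_faces M. rel_frontier \<sigma>)"
  proof
    fix x assume x: "x \<in> \<Gamma>D - closure \<Gamma>N"
    then have "x \<in> frontier \<Omega>" using boundary by (auto simp: boundary_splitting_def)
    then have xc: "x \<in> closure \<Omega>" and xn: "x \<notin> \<Omega>" using \<Omega>(1) by (auto simp: frontier_def interior_open)
    obtain K where K: "K \<in> cells M" "x \<in> closure K" using xc closure_cells by blast
    then have "x \<in> frontier K" using frontier_cell cell_subset xn by blast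
    then obtain \<sigma> where \<sigma>: "\<sigma> \<in> cfaces M K" "x \<in> \<sigma>" using cfaces[OF K(1)] by blast
    then have "\<sigma> \<in> faces M" using cfaces[OF K(1)] by blast
    have "\<sigma> \<notin> ext_faces \<Omega> M"
    proof
      assume "\<sigma> \<in> ext_faces \<Omega> M"
      then have "\<sigma> \<subseteq> \<Gamma>D" using ext_face_cases x \<sigma>(2) by blast
      then show False using none \<open>\<sigma> \<in> faces M\<close> by (auto simp: dir_faces_def)
    qed
    then have int: "\<sigma> \<in> int_faces M" using \<open>\<sigma> \<in> faces M\<close> faces_int_ext by blast
    then obtain A B where AB: "A \<in> cells M" "B \<in> cells M" "A \<noteq> B" "\<sigma> = closure A \<inter> closure B"
      by (auto simp: int_faces_def)
    then have "x \<notin> rel_interior \<sigma>"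
      using common_face_interior[of A B] xn \<open>\<sigma> \<in> faces M\<close> by auto
    then have "x \<in> rel_frontier \<sigma>"
      using \<sigma>(2) closure_subset by (auto simp: rel_frontier_def)
    with int show "x \<in> (\<Union>\<sigma>\<in>int_faces M. rel_frontier \<sigma>)" by blast
  qed
  moreover have "surface_outer (\<Union>\<sigma>\<in>int_faces M. rel_frontier \<sigma>) = 0"
  proof (rule hausdorff_outer_Union_null)
    show "finite (int_faces M)" using finite_mesh(2) by (simp add: int_faces_def)
    fix \<sigma> assume "\<sigma> \<in> int_faces M"
    then obtain A B where AB: "A \<in> cells M" "B \<in> cells M" "A \<noteq> B" "\<sigma> = closure A \<inter> closure B" "\<sigma> \<in> faces M"
      by (auto simp: int_faces_def)
    obtain a b where ab: "a \<noteq> 0" "\<sigma> \<subseteq> {x. a \<bullet> x = b}" using face[OF AB(5)] by blast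
    have "polyhedron \<sigma>" "bounded \<sigma>"
      using AB cell cell_bounded by (auto intro!: polyhedron_Int bounded_Int bounded_closure)
    then show "surface_outer (rel_frontier \<sigma>) = 0"
      by (rule polyhedron_surface_rel_frontier[OF dim _ _ ab])
  qed
  ultimately have "surface_outer (\<Gamma>D - closure \<Gamma>N) = 0"
    using hausdorff_outer_subset_null by blast
  moreover have "surface_outer (\<Gamma>D - closure \<Gamma>N) > 0"
    using boundary unfolding boundary_splitting_def by (elim conjE)
  ultimately show False by simp
qed

end

section \<open>The scheme as a network\<close>

context fv_domain
begin

definition link :: "'a set \<Rightarrow> 'a set \<Rightarrow> real" where
  "link K L = (if K \<noteq> L \<and> closure K \<inter> closure L \<in> faces M then transm M (closure K \<inter> closure L) else 0)"

definition dir_weight :: "'a set \<Rightarrow> real" where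
  "dir_weight K = (\<Sum>\<sigma>\<in>dir_faces \<Gamma>D M \<inter> cfaces M K. transm M \<sigma>)"

definition dir_source :: "('a set \<Rightarrow> real) \<Rightarrow> 'a set \<Rightarrow> real" where
  "dir_source g K = (\<Sum>\<sigma>\<in>dir_faces \<Gamma>D M \<inter> cfaces M K. transm M \<sigma> * g \<sigma>)"

lemma finite_cfaces: "K \<in> cells M \<Longrightarrow> finite (cfaces M K)"
  using cfaces[of K] finite_mesh(2) finite_subset by blast

lemma finite_dir_faces: "finite (dir_faces \<Gamma>D M)"
  using finite_mesh(2) by (simp add: dir_faces_def)

lemma common_face_int:
  assumes "K \<in> cells M" "L \<in> cells M" "K \<noteq> L" "closure K \<inter> closure L \<in> faces M"
  shows "closure K \<inter> closure L \<in> cfaces M K \<inter> int_faces M"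
  using common_face_in_cfaces[OF assms] assms by (auto simp: int_faces_def)

lemma measure_cell_pos: "K \<in> cells M \<Longrightarrow> measure lebesgue K > 0"
proof -
  assume K: "K \<in> cells M"
  have "K \<in> lmeasurable"
    using cell[OF K] cell_bounded[OF K] by (simp add: lmeasurable_open)
  moreover have "\<not> negligible K"
    using cell[OF K] open_not_negligible by blast
  ultimately have "measure lebesgue K \<noteq> 0"
    by (simp add: negligible_iff_measure)
  then show ?thesis
    by (simp add: less_le)
qed

sublocale network "cells M" link dir_weight "measure lebesgue"
proof
  show "finite (cells M)" by (rule finite_mesh(1))
  show "link K L = link L K" for K L
    by (simp add: link_def Int_commute)
  show "0 \<le> link K L" for K L
    using transm_pos by (simp add: link_def less_imp_le)
  show "0 \<le> dir_weight K" for K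
    unfolding dir_weight_def
  proof (rule sum_nonneg)
    show "0 \<le> transm M \<sigma>" if "\<sigma> \<in> dir_faces \<Gamma>D M \<inter> cfaces M K" for \<sigma>
      using that transm_pos by (auto simp: dir_faces_def intro: less_imp_le)
  qed
  show "0 < measure lebesgue K" if "K \<in> cells M" for K
    using measure_cell_pos[OF that] .
  show "\<exists>K\<in>A. \<exists>L\<in>cells M - A. 0 < link K L" if A: "A \<subseteq> cells M" "A \<noteq> {}" "A \<noteq> cells M" for A
  proof -
    obtain K L where "K \<in> A" "L \<in> cells M - A" "closure K \<inter> closure L \<in> faces M"
      using cells_linked[OF A] by blast
    moreover from this have "0 < link K L"
      using transm_pos by (auto simp: link_def)
    ultimately show ?thesis by blast
  qed
  obtain \<sigma> where \<sigma>: "\<sigma> \<in> dir_faces \<Gamma>D M" using dirichlet_face by blast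
  then have "\<sigma> \<in> faces M" by (simp add: dir_faces_def)
  then obtain K where K: "K \<in> cells M" "\<sigma> \<in> cfaces M K" using faces_cfaces by blast
  have "0 < dir_weight K"
    unfolding dir_weight_def
  proof (rule sum_pos)
    show "finite (dir_faces \<Gamma>D M \<inter> cfaces M K)" using finite_dir_faces by simp
    show "dir_faces \<Gamma>D M \<inter> cfaces M K \<noteq> {}" using \<sigma> K by blast
    show "0 < transm M \<tau>" if "\<tau> \<in> dir_faces \<Gamma>D M \<inter> cfaces M K" for \<tau>
      using that transm_pos by (auto simp: dir_faces_def)
  qed
  with K(1) show "\<exists>K\<in>cells M. 0 < dir_weight K" by blast
qed

text \<open>Interior faces of \<open>K\<close> correspond bijectively to the neighbours of
  \<open>K\<close>, so sums over faces become sums over the graph.\<close>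

lemma sum_int_faces:
  assumes K: "K \<in> cells M"
  shows "(\<Sum>\<sigma>\<in>cfaces M K \<inter> int_faces M. transm M \<sigma> * f (nbr M K \<sigma>)) = (\<Sum>L\<in>cells M. link K L * f L)"
proof -
  let ?N = "{L \<in> cells M. K \<noteq> L \<and> closure K \<inter> closure L \<in> faces M}"
  have "(\<Sum>\<sigma>\<in>cfaces M K \<inter> int_faces M. transm M \<sigma> * f (nbr M K \<sigma>))
      = (\<Sum>L\<in>?N. transm M (closure K \<inter> closure L) * f L)"
  proof (rule sum.reindex_bij_witness[where i = "\<lambda>L. closure K \<inter> closure L" and j = "nbr M K"])
    fix \<sigma> assume \<sigma>: "\<sigma> \<in> cfaces M K \<inter> int_faces M"
    then obtain L where L: "L \<in> cells M" "L \<noteq> K" "\<sigma> = closure K \<inter> closure L" "nbr M K \<sigma> = L"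
      using int_face_of_cell[OF K] by blast
    then show "closure K \<inter> closure (nbr M K \<sigma>) = \<sigma>" by simp
    show "nbr M K \<sigma> \<in> ?N" using L \<sigma> by (auto simp: int_faces_def)
    show "transm M (closure K \<inter> closure (nbr M K \<sigma>)) * f (nbr M K \<sigma>) = transm M \<sigma> * f (nbr M K \<sigma>)"
      using L by simp
  next
    fix L assume L: "L \<in> ?N"
    then show "nbr M K (closure K \<inter> closure L) = L"
      using nbr_eq[OF K] by blast
    show "closure K \<inter> closure L \<in> cfaces M K \<inter> int_faces M"
      using common_face_int[OF K] L by blast
  qed
  also have "\<dots> = (\<Sum>L\<in>?N. link K L * f L)"
    by (rule sum.cong) (auto simp: link_def)
  also have "\<dots> = (\<Sum>L\<in>cells M. link K L * f L)"
    using finite_mesh(1) by (intro sum.mono_neutral_left) (auto simp: link_def)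
  finally show ?thesis .
qed

lemma jump_int: "\<sigma> \<in> int_faces M \<Longrightarrow> jump M \<Gamma>D g \<Phi> K \<sigma> = \<Phi> (nbr M K \<sigma>) - \<Phi> K"
  by (simp add: jump_def)

lemma jump_dir: "\<sigma> \<in> dir_faces \<Gamma>D M \<Longrightarrow> jump M \<Gamma>D g \<Phi> K \<sigma> = g \<sigma> - \<Phi> K"
  using int_dir_disjoint by (auto simp: jump_def)

lemma jump_other: "\<sigma> \<notin> int_faces M \<Longrightarrow> \<sigma> \<notin> dir_faces \<Gamma>D M \<Longrightarrow> jump M \<Gamma>D g \<Phi> K \<sigma> = 0"
  by (simp add: jump_def)

lemma sum_split_faces:
  fixes f :: "'a set \<Rightarrow> real"
  assumes "finite S" "\<And>\<sigma>. \<sigma> \<in> S \<Longrightarrow> \<sigma> \<notin> int_faces M \<Longrightarrow> \<sigma> \<notin> dir_faces \<Gamma>D M \<Longrightarrow> f \<sigma> = 0"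
  shows "sum f S = sum f (S \<inter> int_faces M) + sum f (dir_faces \<Gamma>D M \<inter> S)"
proof -
  have "sum f S = sum f (S \<inter> int_faces M \<union> dir_faces \<Gamma>D M \<inter> S)"
    using assms by (intro sum.mono_neutral_right) auto
  also have "\<dots> = sum f (S \<inter> int_faces M) + sum f (dir_faces \<Gamma>D M \<inter> S)"
    using assms(1) int_dir_disjoint by (intro sum.union_disjoint) auto
  finally show ?thesis .
qed

text \<open>A Dirichlet jump splits into its datum, which joins the source, and
  \<open>- \<Phi> K\<close>, which gives the zero order term of \<open>lap\<close>; Neumann jumps
  vanish.\<close>

lemma discrete_poisson_iff:
  "discrete_poisson M \<Gamma>D g cdp c \<Phi> \<longleftrightarrow>
     (\<forall>K\<in>cells M. lap \<Phi> K = measure lebesgue K * c K + (measure lebesgue K * cdp K + dir_source g K))"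
proof -
  have "- (\<Sum>\<sigma>\<in>cfaces M K. transm M \<sigma> * jump M \<Gamma>D g \<Phi> K \<sigma>) = lap \<Phi> K - dir_source g K"
    if K: "K \<in> cells M" for K
  proof -
    have "(\<Sum>\<sigma>\<in>cfaces M K. transm M \<sigma> * jump M \<Gamma>D g \<Phi> K \<sigma>)
        = (\<Sum>\<sigma>\<in>cfaces M K \<inter> int_faces M. transm M \<sigma> * jump M \<Gamma>D g \<Phi> K \<sigma>)
        + (\<Sum>\<sigma>\<in>dir_faces \<Gamma>D M \<inter> cfaces M K. transm M \<sigma> * jump M \<Gamma>D g \<Phi> K \<sigma>)"
      using finite_cfaces[OF K] by (intro sum_split_faces) (auto simp: jump_other)
    moreover have "(\<Sum>\<sigma>\<in>cfaces M K \<inter> int_faces M. transm M \<sigma> * jump M \<Gamma>D g \<Phi> K \<sigma>)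
        = (\<Sum>L\<in>cells M. link K L * (\<Phi> L - \<Phi> K))"
      unfolding sum_int_faces[OF K, of "\<lambda>L. \<Phi> L - \<Phi> K", symmetric]
      by (rule sum.cong) (auto simp: jump_int)
    moreover have "(\<Sum>\<sigma>\<in>dir_faces \<Gamma>D M \<inter> cfaces M K. transm M \<sigma> * jump M \<Gamma>D g \<Phi> K \<sigma>)
        = dir_source g K - dir_weight K * \<Phi> K"
      unfolding dir_source_def dir_weight_def
      by (simp add: jump_dir right_diff_distrib sum_subtractf sum_distrib_right)
    moreover have "(\<Sum>L\<in>cells M. link K L * (\<Phi> L - \<Phi> K)) = - (\<Sum>L\<in>cells M. link K L * (\<Phi> K - \<Phi> L))"
      unfolding sum_negf[symmetric] by (rule sum.cong) (auto simp: algebra_simps)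
    ultimately show ?thesis by (simp add: lap_def)
  qed
  then show ?thesis
    unfolding discrete_poisson_def by (auto simp: algebra_simps)
qed

lemma sum_num_flux:
  assumes K: "K \<in> cells M"
  shows "(\<Sum>\<sigma>\<in>cfaces M K. num_flux k M c \<Phi> K \<sigma>) = outflow k c \<Phi> K"
proof -
  have "(\<Sum>\<sigma>\<in>cfaces M K. num_flux k M c \<Phi> K \<sigma>) = (\<Sum>\<sigma>\<in>cfaces M K \<inter> int_faces M. num_flux k M c \<Phi> K \<sigma>)"
    using finite_cfaces[OF K] by (intro sum.mono_neutral_right) (auto simp: num_flux_def)
  also have "\<dots> = outflow k c \<Phi> K"
    unfolding outflow_def sum_int_faces[OF K, of "\<lambda>L. flux k (c K) (c L) (\<Phi> K) (\<Phi> L)", symmetric]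
    by (rule sum.cong) (auto simp: num_flux_def)
  finally show ?thesis .
qed

lemma scheme_step_iff:
  "scheme_step k M \<Gamma>D g cdp \<Delta>t d c \<Phi> \<longleftrightarrow>
     (\<forall>K\<in>cells M. \<forall>\<sigma>\<in>cfaces M K \<inter> int_faces M.
        0 < c K \<and> c K < 1 \<and> 0 < c (nbr M K \<sigma>) \<and> c (nbr M K \<sigma>) < 1) \<and>
     (\<forall>K\<in>cells M. lap \<Phi> K = measure lebesgue K * c K + (measure lebesgue K * cdp K + dir_source g K)) \<and>
     (\<forall>K\<in>cells M. measure lebesgue K * ((c K - d K) / \<Delta>t) + outflow k c \<Phi> K = 0)"
  unfolding scheme_step_def discrete_poisson_iff by (simp add: sum_num_flux)

section \<open>Summation over faces and the energy\<close>

lemma cells_of_dir_face: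
  assumes \<sigma>: "\<sigma> \<in> dir_faces \<Gamma>D M"
  shows "{K \<in> cells M. \<sigma> \<in> cfaces M K} = {owner M \<sigma>}"
proof -
  have "\<sigma> \<in> faces M" "\<sigma> \<notin> int_faces M" using \<sigma> int_dir_disjoint by (auto simp: dir_faces_def)
  then show ?thesis
    using owner[of \<sigma>] ext_face_single_cell[of _ "owner M \<sigma>" \<sigma>] by blast
qed

lemma sum_dir_faces:
  fixes f :: "'a set \<Rightarrow> 'a set \<Rightarrow> real"
  shows "(\<Sum>K\<in>cells M. \<Sum>\<sigma>\<in>dir_faces \<Gamma>D M \<inter> cfaces M K. f K \<sigma>) = (\<Sum>\<sigma>\<in>dir_faces \<Gamma>D M. f (owner M \<sigma>) \<sigma>)"
proof -
  have "(\<Sum>K\<in>cells M. \<Sum>\<sigma>\<in>dir_faces \<Gamma>D M \<inter> cfaces M K. f K \<sigma>)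
      = (\<Sum>K\<in>cells M. \<Sum>\<sigma> | \<sigma> \<in> dir_faces \<Gamma>D M \<and> \<sigma> \<in> cfaces M K. f K \<sigma>)"
    by (simp add: Int_def)
  also have "\<dots> = (\<Sum>\<sigma>\<in>dir_faces \<Gamma>D M. \<Sum>K | K \<in> cells M \<and> \<sigma> \<in> cfaces M K. f K \<sigma>)"
    by (rule sum.swap_restrict[OF finite_mesh(1) finite_dir_faces])
  also have "\<dots> = (\<Sum>\<sigma>\<in>dir_faces \<Gamma>D M. f (owner M \<sigma>) \<sigma>)"
    by (rule sum.cong) (auto simp: cells_of_dir_face)
  finally show ?thesis .
qed

lemma sum_int_faces_twice:
  "(\<Sum>K\<in>cells M. \<Sum>L\<in>cells M. link K L * (\<Phi> L - \<Phi> K)\<^sup>2)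
     = 2 * (\<Sum>\<sigma>\<in>int_faces M. transm M \<sigma> * (\<Phi> (nbr M (owner M \<sigma>) \<sigma>) - \<Phi> (owner M \<sigma>))\<^sup>2)"
proof -
  let ?f = "\<lambda>K \<sigma>. transm M \<sigma> * (\<Phi> (nbr M K \<sigma>) - \<Phi> K)\<^sup>2"
  have fin: "finite (int_faces M)" using finite_mesh(2) by (simp add: int_faces_def)
  have "(\<Sum>K\<in>cells M. \<Sum>L\<in>cells M. link K L * (\<Phi> L - \<Phi> K)\<^sup>2)
      = (\<Sum>K\<in>cells M. \<Sum>\<sigma>\<in>cfaces M K \<inter> int_faces M. ?f K \<sigma>)"
    by (rule sum.cong[OF refl], rule sum_int_faces[symmetric])
  also have "\<dots> = (\<Sum>K\<in>cells M. \<Sum>\<sigma> | \<sigma> \<in> int_faces M \<and> \<sigma> \<in> cfaces M K. ?f K \<sigma>)"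
    by (simp add: Int_def conj_commute)
  also have "\<dots> = (\<Sum>\<sigma>\<in>int_faces M. \<Sum>K | K \<in> cells M \<and> \<sigma> \<in> cfaces M K. ?f K \<sigma>)"
    by (rule sum.swap_restrict[OF finite_mesh(1) fin])
  also have "\<dots> = (\<Sum>\<sigma>\<in>int_faces M. 2 * ?f (owner M \<sigma>) \<sigma>)"
  proof (rule sum.cong[OF refl])
    fix \<sigma> assume \<sigma>: "\<sigma> \<in> int_faces M"
    let ?K = "owner M \<sigma>"
    have \<sigma>f: "\<sigma> \<in> faces M" using \<sigma> by (simp add: int_faces_def)
    have K: "?K \<in> cells M" "\<sigma> \<in> cfaces M ?K" using owner[OF \<sigma>f] by auto
    obtain L where L: "L \<in> cells M" "L \<noteq> ?K" "\<sigma> = closure ?K \<inter> closure L" "nbr M ?K \<sigma> = L"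
      using int_face_of_cell[OF K \<sigma>] by blast
    have \<sigma>L: "\<sigma> = closure L \<inter> closure ?K" using L(3) by (simp only: Int_commute)
    have f: "closure L \<inter> closure ?K \<in> faces M" using \<sigma>f \<sigma>L by metis
    have "nbr M L (closure L \<inter> closure ?K) = ?K"
      by (rule nbr_eq[OF L(1) K(1) L(2) f])
    then have nL: "nbr M L \<sigma> = ?K" using \<sigma>L by metis
    have "closure L \<inter> closure ?K \<in> cfaces M L"
      by (rule common_face_in_cfaces[OF L(1) K(1) L(2) f])
    then have "\<sigma> \<in> cfaces M L" using \<sigma>L by metis
    moreover have "J = L" if "J \<in> cells M" "\<sigma> \<in> cfaces M J" "J \<noteq> ?K" for J
    proof -
      have "\<sigma> = closure ?K \<inter> closure J"
        using shared_face[OF K(1) that(1)] that K(2) by auto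
      then show ?thesis
        using nbr_eq[OF K(1) that(1)] that(3) \<sigma>f L(4) by metis
    qed
    \<comment> \<open>Exactly two cells own an interior face, and the squared jump is the same from
      either side.\<close>
    ultimately have "{J \<in> cells M. \<sigma> \<in> cfaces M J} = {?K, L}"
      using K L by blast
    then have "(\<Sum>J | J \<in> cells M \<and> \<sigma> \<in> cfaces M J. ?f J \<sigma>) = ?f ?K \<sigma> + ?f L \<sigma>"
      using L(2) by simp
    also have "?f L \<sigma> = ?f ?K \<sigma>"
      using nL L(4) by (simp add: power2_commute)
    finally show "(\<Sum>J | J \<in> cells M \<and> \<sigma> \<in> cfaces M J. ?f J \<sigma>) = 2 * ?f ?K \<sigma>" by simp
  qed
  finally show ?thesis by (simp add: sum_distrib_left)
qed

text \<open>The boundary term of the energy cancels the linear part of the Dirichlet jumps.\<close>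

lemma energy_eq:
  "energy M \<Gamma>D g c \<Phi> = (\<Sum>K\<in>cells M. measure lebesgue K * mixing_entropy (c K)) + 1 / 2 * form \<Phi> \<Phi>
     - 1 / 2 * (\<Sum>\<sigma>\<in>dir_faces \<Gamma>D M. transm M \<sigma> * (g \<sigma>)\<^sup>2)"
proof -
  let ?o = "owner M"
  let ?I = "\<Sum>\<sigma>\<in>int_faces M. transm M \<sigma> * (\<Phi> (nbr M (?o \<sigma>) \<sigma>) - \<Phi> (?o \<sigma>))\<^sup>2"
  have "(\<Sum>\<sigma>\<in>faces M. transm M \<sigma> * \<bar>jump M \<Gamma>D g \<Phi> (?o \<sigma>) \<sigma>\<bar>\<^sup>2)
      = (\<Sum>\<sigma>\<in>faces M \<inter> int_faces M. transm M \<sigma> * \<bar>jump M \<Gamma>D g \<Phi> (?o \<sigma>) \<sigma>\<bar>\<^sup>2)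
      + (\<Sum>\<sigma>\<in>dir_faces \<Gamma>D M \<inter> faces M. transm M \<sigma> * \<bar>jump M \<Gamma>D g \<Phi> (?o \<sigma>) \<sigma>\<bar>\<^sup>2)"
    using finite_mesh(2) by (intro sum_split_faces) (auto simp: jump_other)
  moreover have "faces M \<inter> int_faces M = int_faces M" "dir_faces \<Gamma>D M \<inter> faces M = dir_faces \<Gamma>D M"
    by (auto simp: int_faces_def dir_faces_def)
  ultimately have J: "(\<Sum>\<sigma>\<in>faces M. transm M \<sigma> * \<bar>jump M \<Gamma>D g \<Phi> (?o \<sigma>) \<sigma>\<bar>\<^sup>2)
      = ?I + (\<Sum>\<sigma>\<in>dir_faces \<Gamma>D M. transm M \<sigma> * (g \<sigma> - \<Phi> (?o \<sigma>))\<^sup>2)"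
    by (simp add: jump_int jump_dir)
  have B: "(\<Sum>K\<in>cells M. \<Sum>\<sigma>\<in>dir_faces \<Gamma>D M \<inter> cfaces M K. transm M \<sigma> * g \<sigma> * jump M \<Gamma>D g \<Phi> K \<sigma>)
      = (\<Sum>\<sigma>\<in>dir_faces \<Gamma>D M. transm M \<sigma> * g \<sigma> * (g \<sigma> - \<Phi> (?o \<sigma>)))"
    by (simp add: sum_dir_faces jump_dir)
  have "(\<Sum>K\<in>cells M. dir_weight K * (\<Phi> K * \<Phi> K))
      = (\<Sum>K\<in>cells M. \<Sum>\<sigma>\<in>dir_faces \<Gamma>D M \<inter> cfaces M K. transm M \<sigma> * (\<Phi> K)\<^sup>2)"
    by (simp add: dir_weight_def sum_distrib_right power2_eq_square)
  then have D: "(\<Sum>K\<in>cells M. dir_weight K * (\<Phi> K * \<Phi> K)) = (\<Sum>\<sigma>\<in>dir_faces \<Gamma>D M. transm M \<sigma> * (\<Phi> (?o \<sigma>))\<^sup>2)"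
    by (simp only: sum_dir_faces)
  have "(\<Sum>K\<in>cells M. \<Sum>L\<in>cells M. link K L * ((\<Phi> K - \<Phi> L) * (\<Phi> K - \<Phi> L))) = 2 * ?I"
    unfolding sum_int_faces_twice[symmetric] by (simp add: power2_eq_square algebra_simps)
  then have F: "form \<Phi> \<Phi> = ?I + (\<Sum>\<sigma>\<in>dir_faces \<Gamma>D M. transm M \<sigma> * (\<Phi> (?o \<sigma>))\<^sup>2)"
    by (simp add: form_def D)
  have "1 / 2 * (\<Sum>\<sigma>\<in>dir_faces \<Gamma>D M. transm M \<sigma> * (g \<sigma> - \<Phi> (?o \<sigma>))\<^sup>2)
      - (\<Sum>\<sigma>\<in>dir_faces \<Gamma>D M. transm M \<sigma> * g \<sigma> * (g \<sigma> - \<Phi> (?o \<sigma>)))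
    = (\<Sum>\<sigma>\<in>dir_faces \<Gamma>D M. 1 / 2 * (transm M \<sigma> * (\<Phi> (?o \<sigma>))\<^sup>2) - 1 / 2 * (transm M \<sigma> * (g \<sigma>)\<^sup>2))"
    unfolding sum_distrib_left sum_subtractf[symmetric]
    by (rule sum.cong) (auto simp: power2_eq_square algebra_simps)
  also have "\<dots> = 1 / 2 * (\<Sum>\<sigma>\<in>dir_faces \<Gamma>D M. transm M \<sigma> * (\<Phi> (?o \<sigma>))\<^sup>2)
      - 1 / 2 * (\<Sum>\<sigma>\<in>dir_faces \<Gamma>D M. transm M \<sigma> * (g \<sigma>)\<^sup>2)"
    by (simp add: sum_subtractf sum_distrib_left)
  finally have "1 / 2 * (\<Sum>\<sigma>\<in>dir_faces \<Gamma>D M. transm M \<sigma> * (g \<sigma> - \<Phi> (?o \<sigma>))\<^sup>2)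
      - (\<Sum>\<sigma>\<in>dir_faces \<Gamma>D M. transm M \<sigma> * g \<sigma> * (g \<sigma> - \<Phi> (?o \<sigma>)))
    = 1 / 2 * (\<Sum>\<sigma>\<in>dir_faces \<Gamma>D M. transm M \<sigma> * (\<Phi> (?o \<sigma>))\<^sup>2)
      - 1 / 2 * (\<Sum>\<sigma>\<in>dir_faces \<Gamma>D M. transm M \<sigma> * (g \<sigma>)\<^sup>2)" .
  moreover have "1 / 2 * a - b = 1 / 2 * p - q \<Longrightarrow> h + 1 / 2 * (i + a) - b = h + 1 / 2 * (i + p) - q"
    for a b p q h i :: real
    by (simp add: distrib_left)
  ultimately show ?thesis
    unfolding energy_def J B F by blast
qed

text \<open>Fluxes cancel in pairs and exterior fluxes vanish. Conservation carries the strict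
  bounds on the mean from one time step to the next.\<close>

lemma scheme_step_mass:
  assumes "\<Delta>t > 0" "scheme_step k M \<Gamma>D g cdp \<Delta>t d c \<Phi>"
  shows "(\<Sum>K\<in>cells M. measure lebesgue K * c K) = (\<Sum>K\<in>cells M. measure lebesgue K * d K)"
proof -
  have "(\<Sum>K\<in>cells M. measure lebesgue K * ((c K - d K) / \<Delta>t)) + (\<Sum>K\<in>cells M. outflow k c \<Phi> K) = 0"
    using assms(2) unfolding scheme_step_iff sum.distrib[symmetric] by simp
  then have "(\<Sum>K\<in>cells M. measure lebesgue K * (c K - d K)) / \<Delta>t = 0"
    by (simp add: sum_outflow sum_divide_distrib)
  then show ?thesis
    using assms(1) by (simp add: right_diff_distrib sum_subtractf)
qed

text \<open>With at least two cells, \<open>K\<close> has an interior face and the bounds are part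
  of the flux being defined. A mesh of one cell evaluates no flux; there mass conservation fixes
  \<open>c K\<close>.\<close>

lemma scheme_step_positive:
  assumes dt: "\<Delta>t > 0" and st: "scheme_step k M \<Gamma>D g cdp \<Delta>t d c \<Phi>"
    and d: "0 < (\<Sum>K\<in>cells M. measure lebesgue K * d K)" "(\<Sum>K\<in>cells M. measure lebesgue K * d K) < (\<Sum>K\<in>cells M. measure lebesgue K)"
    and K: "K \<in> cells M"
  shows "0 < c K \<and> c K < 1"
proof (cases "cells M = {K}")
  case True
  then show ?thesis
    using d scheme_step_mass[OF dt st] measure_cell_pos[OF K] by (simp add: zero_less_mult_iff mult_less_cancel_left2)
next
  case False
  then obtain L where L: "L \<in> cells M" "K \<noteq> L" "closure K \<inter> closure L \<in> faces M"
    using cells_linked[of "{K}"] K by blast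
  then have "closure K \<inter> closure L \<in> cfaces M K \<inter> int_faces M"
    using common_face_int K by blast
  then show ?thesis
    using st K unfolding scheme_step_def by blast
qed

lemma scheme_step_exists:
  assumes dt: "\<Delta>t > 0" and d01: "\<And>K. K \<in> cells M \<Longrightarrow> 0 \<le> d K \<and> d K \<le> 1"
    and d: "0 < (\<Sum>K\<in>cells M. measure lebesgue K * d K)" "(\<Sum>K\<in>cells M. measure lebesgue K * d K) < (\<Sum>K\<in>cells M. measure lebesgue K)"
  shows "\<exists>c \<Phi>. (\<forall>K\<in>cells M. 0 \<le> c K \<and> c K \<le> 1) \<and> scheme_step k M \<Gamma>D g cdp \<Delta>t d c \<Phi>"
proof -
  have "\<exists>K\<in>cells M. 0 < d K"
  proof (rule ccontr)
    assume "\<not> ?thesis"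
    then have "(\<Sum>K\<in>cells M. measure lebesgue K * d K) \<le> 0"
      by (intro sum_nonpos mult_nonneg_nonpos) (auto simp: not_less)
    with d(1) show False by simp
  qed
  then obtain K0 where K0: "K0 \<in> cells M" "0 < d K0" by blast
  have "\<exists>K\<in>cells M. d K < 1"
  proof (rule ccontr)
    assume "\<not> ?thesis"
    then have "(\<Sum>K\<in>cells M. measure lebesgue K) \<le> (\<Sum>K\<in>cells M. measure lebesgue K * d K)"
      by (intro sum_mono) (auto simp: not_less mult_le_cancel_left1)
    with d(2) show False by simp
  qed
  then obtain K1 where K1: "K1 \<in> cells M" "d K1 < 1" by blast
  obtain c \<Phi> where c: "\<forall>K\<in>cells M. 0 < c K \<and> c K < 1"
    and P: "\<forall>K\<in>cells M. lap \<Phi> K = measure lebesgue K * c K + (measure lebesgue K * cdp K + dir_source g K)"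
    and C: "\<forall>K\<in>cells M. measure lebesgue K * ((c K - d K) / \<Delta>t) + outflow k c \<Phi> K = 0"
    using exists_step[OF dt d01 K0 K1, of "\<lambda>K. measure lebesgue K * cdp K + dir_source g K" k] by metis
  have "nbr M K \<sigma> \<in> cells M" if "K \<in> cells M" "\<sigma> \<in> cfaces M K" "\<sigma> \<in> int_faces M" for K \<sigma>
    using int_face_of_cell[OF that] by metis
  then have "scheme_step k M \<Gamma>D g cdp \<Delta>t d c \<Phi>"
    unfolding scheme_step_iff using c P C by blast
  then show ?thesis using c by (meson less_imp_le)
qed

lemma scheme_step_energy:
  assumes dt: "\<Delta>t > 0" and d01: "\<And>K. K \<in> cells M \<Longrightarrow> 0 \<le> d K \<and> d K \<le> 1"
    and d: "0 < (\<Sum>K\<in>cells M. measure lebesgue K * d K)" "(\<Sum>K\<in>cells M. measure lebesgue K * d K) < (\<Sum>K\<in>cells M. measure lebesgue K)"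
    and P: "discrete_poisson M \<Gamma>D g cdp d \<Psi>" and st: "scheme_step k M \<Gamma>D g cdp \<Delta>t d c \<Phi>"
  shows "energy M \<Gamma>D g c \<Phi> \<le> energy M \<Gamma>D g d \<Psi>"
  unfolding energy_eq
  using energy_decay[where u = \<Phi> and v = \<Psi> and k = k
      and s = "\<lambda>K. measure lebesgue K * cdp K + dir_source g K",
      OF dt scheme_step_positive[OF dt st d] d01]
    P[unfolded discrete_poisson_iff] st[unfolded scheme_step_iff] by simp

section \<open>Cell averages of the initial datum\<close>

lemma negligible_uncovered: "negligible (\<Omega> - \<Union>(cells M))"
proof (rule negligible_subset)
  show "negligible (\<Union>K\<in>cells M. frontier K)"
    using finite_mesh(1) cell by (intro negligible_Union) (auto intro: negligible_convex_frontier)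
  show "\<Omega> - \<Union>(cells M) \<subseteq> (\<Union>K\<in>cells M. frontier K)"
  proof
    fix x assume x: "x \<in> \<Omega> - \<Union>(cells M)"
    then have "x \<in> (\<Union>K\<in>cells M. closure K)"
      using closure_cells closure_subset[of \<Omega>] by blast
    then show "x \<in> (\<Union>K\<in>cells M. frontier K)" using x frontier_cell by blast
  qed
qed

text \<open>Cells are disjoint and miss only their frontiers, which are negligible by convexity, so
  integrals over \<Omega> split into integrals over cells.\<close>

lemma cell_avg_bounds:
  assumes f: "f \<in> borel_measurable (lebesgue_on \<Omega>)" "AE x in lebesgue_on \<Omega>. 0 \<le> f x \<and> f x \<le> 1"
  shows "K \<in> cells M \<Longrightarrow> 0 \<le> cell_avg f K \<and> cell_avg f K \<le> 1"
    and "(\<Sum>K\<in>cells M. measure lebesgue K * cell_avg f K) = measure lebesgue \<Omega> * cell_avg f \<Omega>"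
    and "(\<Sum>K\<in>cells M. measure lebesgue K) = measure lebesgue \<Omega>"
proof -
  have \<Omega>m: "\<Omega> \<in> lmeasurable" using \<Omega> by (simp add: lmeasurable_open)
  have Km: "K \<in> lmeasurable" if "K \<in> cells M" for K
    using cell[OF that] cell_bounded[OF that] by (simp add: lmeasurable_open)
  have ind: "integrable lebesgue (indicator A :: 'a \<Rightarrow> real)" if "A \<in> lmeasurable" for A
    using that by (intro integrable_real_indicator) (auto simp: fmeasurable_def)
  have m: "(\<lambda>x. indicator \<Omega> x *\<^sub>R f x) \<in> borel_measurable lebesgue"
    using f(1) \<Omega>m by (subst (asm) borel_measurable_restrict_space_iff) (auto simp: fmeasurableD)
  have ae: "AE x in lebesgue. x \<in> \<Omega> \<longrightarrow> 0 \<le> f x \<and> f x \<le> 1"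
    using f(2) \<Omega>m by (subst (asm) AE_restrict_space_iff) (auto simp: fmeasurableD)
  have int\<Omega>: "set_integrable lebesgue \<Omega> f"
    unfolding set_integrable_def
  proof (rule Bochner_Integration.integrable_bound[OF _ m])
    show "integrable lebesgue (indicator \<Omega> :: 'a \<Rightarrow> real)"
      by (rule ind[OF \<Omega>m])
    show "AE x in lebesgue. norm (indicator \<Omega> x *\<^sub>R f x) \<le> norm (indicator \<Omega> x :: real)"
      using ae by eventually_elim (auto simp: indicator_def)
  qed
  have int: "set_integrable lebesgue K f" if "K \<in> cells M" for K
    using set_integrable_subset[OF int\<Omega> _ cell_subset[OF that]] Km[OF that] by (simp add: fmeasurableD)
  have I: "measure lebesgue K * cell_avg f K = (LINT x:K|lebesgue. f x)" if "K \<in> cells M" for K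
    using measure_cell_pos[OF that] by (simp add: cell_avg_def)
  show "0 \<le> cell_avg f K \<and> cell_avg f K \<le> 1" if K: "K \<in> cells M"
  proof -
    have "0 \<le> (LINT x:K|lebesgue. f x)"
      unfolding set_lebesgue_integral_def
      by (rule integral_nonneg_AE) (use ae cell_subset[OF K] in \<open>auto elim!: eventually_mono simp: indicator_def\<close>)
    moreover have "(LINT x:K|lebesgue. f x) \<le> (LINT x:K|lebesgue. (1::real))"
      unfolding set_lebesgue_integral_def
    proof (rule integral_mono_AE)
      show "integrable lebesgue (\<lambda>x. indicator K x *\<^sub>R f x)" using int[OF K] by (simp add: set_integrable_def)
      show "integrable lebesgue (\<lambda>x. indicator K x *\<^sub>R (1::real))"
        using ind[OF Km[OF K]] by simp
      show "AE x in lebesgue. indicator K x *\<^sub>R f x \<le> indicator K x *\<^sub>R (1::real)"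
        using ae cell_subset[OF K] by (auto elim!: eventually_mono simp: indicator_def)
    qed
    moreover have "(LINT x:K|lebesgue. (1::real)) = measure lebesgue K"
      using Km[OF K] by (simp add: set_lebesgue_integral_def)
    ultimately show ?thesis
      using measure_cell_pos[OF K] by (simp add: cell_avg_def)
  qed
  have sum_ind: "(\<Sum>K\<in>cells M. indicator K x) = (indicator (\<Union>(cells M)) x :: real)" for x
    using finite_mesh(1) cells_disjoint by (subst indicator_UN_disjoint[symmetric, where f = id, simplified]) (auto simp: disjoint_family_on_def)
  have aeN: "AE x in lebesgue. indicator (\<Union>(cells M)) x = (indicator \<Omega> x :: real)"
  proof -
    have "AE x in lebesgue. x \<notin> \<Omega> - \<Union>(cells M)"
      using negligible_uncovered by (intro AE_not_in) (simp add: negligible_iff_null_sets)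
    then show ?thesis
      by eventually_elim (use cell_subset in \<open>auto simp: indicator_def\<close>)
  qed
  have S: "(\<Sum>K\<in>cells M. LINT x:K|lebesgue. h x) = (LINT x:\<Omega>|lebesgue. h x)"
    if h: "\<And>K. K \<in> cells M \<Longrightarrow> set_integrable lebesgue K h" "set_integrable lebesgue \<Omega> h" for h :: "'a \<Rightarrow> real"
  proof -
    have "(\<Sum>K\<in>cells M. LINT x:K|lebesgue. h x) = (LINT x|lebesgue. (\<Sum>K\<in>cells M. indicator K x *\<^sub>R h x))"
      unfolding set_lebesgue_integral_def using h(1)
      by (subst Bochner_Integration.integral_sum) (auto simp: set_integrable_def)
    also have "\<dots> = (LINT x|lebesgue. indicator \<Omega> x *\<^sub>R h x)"
    proof (rule integral_cong_AE)
      show "(\<lambda>x. \<Sum>K\<in>cells M. indicator K x *\<^sub>R h x) \<in> borel_measurable lebesgue"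
        using h(1) by (intro borel_measurable_sum) (auto simp: set_integrable_def)
      show "(\<lambda>x. indicator \<Omega> x *\<^sub>R h x) \<in> borel_measurable lebesgue"
        using h(2) by (auto simp: set_integrable_def)
      show "AE x in lebesgue. (\<Sum>K\<in>cells M. indicator K x *\<^sub>R h x) = indicator \<Omega> x *\<^sub>R h x"
        using aeN by eventually_elim (simp add: sum_ind flip: sum_distrib_right)
    qed
    finally show ?thesis by (simp add: set_lebesgue_integral_def)
  qed
  have one: "(LINT x:A|lebesgue. (1::real)) = measure lebesgue A" "set_integrable lebesgue A (\<lambda>_. 1 :: real)"
    if "A \<in> lmeasurable" for A :: "'a set"
    using that ind[OF that] by (simp_all add: set_lebesgue_integral_def set_integrable_def)
  show tot: "(\<Sum>K\<in>cells M. measure lebesgue K) = measure lebesgue \<Omega>"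
    using S[of "\<lambda>_. 1"] one Km \<Omega>m by simp
  have "(\<Sum>K\<in>cells M. measure lebesgue K * cell_avg f K) = (LINT x:\<Omega>|lebesgue. f x)"
    using S[OF int int\<Omega>] by (simp add: I)
  also have "\<dots> = measure lebesgue \<Omega> * cell_avg f \<Omega>"
  proof (cases "measure lebesgue \<Omega> = 0")
    case True
    then have "negligible \<Omega>" using \<Omega>m by (simp add: negligible_iff_measure)
    then have "\<Omega> = {}" using \<Omega>(1) open_not_negligible by blast
    then show ?thesis by (simp add: set_lebesgue_integral_def)
  qed (simp add: cell_avg_def)
  finally show "(\<Sum>K\<in>cells M. measure lebesgue K * cell_avg f K) = measure lebesgue \<Omega> * cell_avg f \<Omega>" .
qed

end

theorem theorem2p1:
  fixes \<Omega> \<Gamma>D \<Gamma>N :: "(real ^ 'd) set"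
    and cdp c0 \<Phi>D :: "real ^ 'd \<Rightarrow> real"
    and M :: "(real ^ 'd) fv_mesh"
    and T :: real and N :: nat and t :: "nat \<Rightarrow> real"
    and k :: flux_kind
  assumes dim: "CARD('d) \<in> {1, 2, 3}"
    and domain: "open \<Omega>" "connected \<Omega>" "bounded \<Omega>"
      "polyhedral_boundary \<Omega>" "lipschitz_boundary \<Omega>"
    and boundary: "boundary_splitting \<Omega> \<Gamma>D \<Gamma>N"
    and cdp: "ess_bounded (lebesgue_on \<Omega>) cdp"
    and c0: "ess_bounded (lebesgue_on \<Omega>) c0"
      "AE x in lebesgue_on \<Omega>. 0 \<le> c0 x \<and> c0 x \<le> 1"
      "0 < cell_avg c0 \<Omega>" "cell_avg c0 \<Omega> < 1"
    and \<Phi>D: "sobolev_H1 \<Omega> \<Phi>D" "ess_bounded (lebesgue_on \<Omega>) \<Phi>D"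
    and mesh: "admissible_mesh \<Omega> \<Gamma>D \<Gamma>N M"
    and time: "T > 0" "t 0 = 0" "t N = T" "\<forall>n\<in>{1..N}. t (n - 1) < t n"
  defines "\<Phi>D\<sigma> \<equiv> face_avg (trace_of \<Omega> \<Phi>D)"
  defines "step \<equiv> \<lambda>n. scheme_step k M \<Gamma>D \<Phi>D\<sigma> (cell_avg cdp) (t n - t (n - 1))"
  shows "(\<forall>n\<in>{1..N}. \<forall>c \<Phi>.
            (\<forall>K\<in>cells M. c 0 K = cell_avg c0 K) \<and>
            (\<forall>j\<in>{1..<n}. step j (c (j - 1)) (c j) (\<Phi> j)) \<longrightarrow>
            (\<exists>c' \<Phi>'. (\<forall>K\<in>cells M. 0 \<le> c' K \<and> c' K \<le> 1) \<and> step n (c (n - 1)) c' \<Phi>'))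
       \<and> (\<forall>c \<Phi>.
            (\<forall>K\<in>cells M. c 0 K = cell_avg c0 K) \<and>
            discrete_poisson M \<Gamma>D \<Phi>D\<sigma> (cell_avg cdp) (c 0) (\<Phi> 0) \<and>
            (\<forall>n\<in>{1..N}. step n (c (n - 1)) (c n) (\<Phi> n)) \<longrightarrow>
            (\<forall>n\<in>{1..N}.
               energy M \<Gamma>D \<Phi>D\<sigma> (c n) (\<Phi> n) \<le> energy M \<Gamma>D \<Phi>D\<sigma> (c (n - 1)) (\<Phi> (n - 1)) \<and>
               (\<forall>K\<in>cells M. 0 < c n K \<and> c n K < 1)))"
proof -
  interpret fv_domain \<Omega> \<Gamma>D \<Gamma>N M
    using dim domain boundary mesh by unfold_locales auto
  let ?mass = "\<lambda>c. \<Sum>K\<in>cells M. measure lebesgue K * c K"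
  let ?vol = "\<Sum>K\<in>cells M. measure lebesgue K"
  \<comment> \<open>The initial averages may equal 0 or 1 in some cells, so strict bounds cannot be
    the invariant. Strictness is asked of the total mass alone, and this suffices for the next
    step.\<close>
  define inv where "inv c \<longleftrightarrow> (\<forall>K\<in>cells M. 0 \<le> c K \<and> c K \<le> 1) \<and> 0 < ?mass c \<and> ?mass c < ?vol" for c
  have dt: "t n - t (n - 1) > 0" if "n \<in> {1..N}" for n
    using time(4) that by simp
  have c0m: "c0 \<in> borel_measurable (lebesgue_on \<Omega>)"
    using c0(1) by (simp add: ess_bounded_def)
  note avg = cell_avg_bounds[OF c0m c0(2)]
  \<comment> \<open>If the volume were 0, division by zero would make the average 0, against its
    positivity.\<close>
  have vol: "measure lebesgue \<Omega> > 0"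
    using c0(3) by (auto simp: cell_avg_def less_le)
  have inv0: "inv c" if c: "\<forall>K\<in>cells M. c K = cell_avg c0 K" for c
  proof -
    have "?mass c = measure lebesgue \<Omega> * cell_avg c0 \<Omega>"
      using c avg(2) by simp
    then show ?thesis
      using c avg(1,3) vol c0(3,4) by (simp add: inv_def mult_less_cancel_left2)
  qed
  have step_pos: "\<forall>K\<in>cells M. 0 < c K \<and> c K < 1" if "n \<in> {1..N}" "inv d" "step n d c \<Phi>" for n d c \<Phi>
    using scheme_step_positive[OF dt[OF that(1)]] that(2,3) unfolding step_def inv_def by blast
  have step_inv: "inv c" if "n \<in> {1..N}" "inv d" "step n d c \<Phi>" for n d c \<Phi>
    using step_pos[OF that] scheme_step_mass[OF dt[OF that(1)] that(3)[unfolded step_def]] that(2)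
    unfolding inv_def by (auto intro: less_imp_le)
  \<comment> \<open>The range of \<open>n\<close> includes \<open>Suc N\<close>, so one statement
    serves both a history ending before step \<open>n\<close> and a complete run.\<close>
  have invn: "inv (c i)" if c: "\<forall>K\<in>cells M. c 0 K = cell_avg c0 K"
    "\<forall>j\<in>{1..<n}. step j (c (j - 1)) (c j) (\<Phi> j)" "n \<le> Suc N" "i < n" for c \<Phi> n i
    using that(4)
  proof (induction i)
    case 0
    then show ?case using inv0[OF c(1)] by simp
  next
    case (Suc i)
    then have "step (Suc i) (c i) (c (Suc i)) (\<Phi> (Suc i))"
      using bspec[OF c(2), of "Suc i"] by simp
    moreover have "Suc i \<in> {1..N}" "inv (c i)"
      using Suc c(3) by auto
    ultimately show ?case by (rule step_inv[rotated 2])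
  qed
  show ?thesis
  proof (intro conjI ballI allI impI; elim conjE)
    fix n c \<Phi> assume n: "n \<in> {1..N}" and c: "\<forall>K\<in>cells M. c 0 K = cell_avg c0 K"
      "\<forall>j\<in>{1..<n}. step j (c (j - 1)) (c j) (\<Phi> j)"
    have "inv (c (n - 1))" using invn[where c = c and \<Phi> = \<Phi> and n = n and i = "n - 1", OF c] n by auto
    then show "\<exists>c' \<Phi>'. (\<forall>K\<in>cells M. 0 \<le> c' K \<and> c' K \<le> 1) \<and> step n (c (n - 1)) c' \<Phi>'"
      unfolding step_def inv_def by (intro scheme_step_exists dt[OF n]) auto
  next
    fix c \<Phi> n assume c: "\<forall>K\<in>cells M. c 0 K = cell_avg c0 K"
      and P: "discrete_poisson M \<Gamma>D \<Phi>D\<sigma> (cell_avg cdp) (c 0) (\<Phi> 0)"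
      and st: "\<forall>n\<in>{1..N}. step n (c (n - 1)) (c n) (\<Phi> n)" and n: "n \<in> {1..N}"
    have I: "inv (c (n - 1))" using invn[where c = c and \<Phi> = \<Phi> and n = "Suc N" and i = "n - 1", OF c] st n by auto
    have stn: "step n (c (n - 1)) (c n) (\<Phi> n)" using st n by blast
    have "discrete_poisson M \<Gamma>D \<Phi>D\<sigma> (cell_avg cdp) (c (n - 1)) (\<Phi> (n - 1))"
    proof (cases "n = 1")
      case False
      then have "n - 1 \<in> {1..N}" using n by auto
      then have "step (n - 1) (c (n - 1 - 1)) (c (n - 1)) (\<Phi> (n - 1))" using st by blast
      then show ?thesis unfolding step_def scheme_step_def by blast
    qed (use P in simp)
    then show "energy M \<Gamma>D \<Phi>D\<sigma> (c n) (\<Phi> n) \<le> energy M \<Gamma>D \<Phi>D\<sigma> (c (n - 1)) (\<Phi> (n - 1))"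
      using I stn unfolding step_def inv_def by (intro scheme_step_energy[OF dt[OF n]]) auto
  next
    fix c \<Phi> n K assume c: "\<forall>K\<in>cells M. c 0 K = cell_avg c0 K"
      and st: "\<forall>n\<in>{1..N}. step n (c (n - 1)) (c n) (\<Phi> n)" and n: "n \<in> {1..N}" and K: "K \<in> cells M"
    have "inv (c (n - 1))" using invn[where c = c and \<Phi> = \<Phi> and n = "Suc N" and i = "n - 1", OF c] st n by auto
    from step_pos[OF n this bspec[OF st n]] K show "0 < c n K" "c n K < 1" by auto
  qed
qed

end
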